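(* Fix $0<\gamma<n$. Let $\Omega\subset\mathbb{R}^n$ be a bounded domain and fix $x_0\in\Omega$. Let $p(\cdot),q(\cdot)\in\mathcal{P}(\Omega)$ satisfy $p(\cdot),q(\cdot)\in LH_0(\Omega)$, $1<p_-\le p_+<\infty$, $1<q_-\le q_+<\infty$, and $p(x)\le q(x)$ for all $x\in\Omega$. Let $\lambda(\cdot):\Omega\to[0,n]$ be such that $0<\lambda_-\le\lambda_+<n$ and $\lambda(\cdot)\in LH_0(\Omega)$. Let $a,b$ be real constants such that \[ 0\le b-a\le\gamma, \] \[ \frac{\lambda_+-n}{q_+}<a\le b<\frac{n}{(p')_+}, \] and such that for all $x\in\Omega$, \[ 0<\lambda_-\le\lambda(x)<n-(\gamma-b+a)\,p(x) \] and \[ \frac{\gamma+a-b}{n-\lambda(x)}=\frac{1}{p(x)}-\frac{1}{q(x)}. \] Then there exists a constant $C>0$ such that for every function $f$ on $\Omega$, \[ \big\| |\cdot-x_0|^{a}\, I_\gamma f\big\|_{M^{\lambda(\cdot)}_{q(\cdot)}(\Omega)}\le C\,\big\| |\cdot-x_0|^{b} f\big\|_{M^{\lambda(\cdot)}_{p(\cdot)}(\Omega)}. \]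
   Context: $\mathcal{P}(\Omega)$ is the set of measurable functions $p(\cdot):\Omega\to[1,\infty]$ (variable exponents). For a function $u(\cdot)$ on $\Omega$, $u_-=\operatorname{ess\,inf}_{x\in\Omega}u(x)$ and $u_+=\operatorname{ess\,sup}_{x\in\Omega}u(x)$. The conjugate exponent $p'(\cdot)$ is defined by $\frac1{p(x)}+\frac1{p'(x)}=1$, and $(p')_+$ is its essential supremum. A function $u:\Omega\to\mathbb{R}$ is in $LH_0(\Omega)$ (locally log-Hölder continuous) if there is a constant $C_0$ with $|u(x)-u(y)|\le \frac{C_0}{-\log|x-y|}$ for all $x,y\in\Omega$ with $|x-y|<\frac12$. Let $\tilde B(x,r)=\{y\in\Omega:|x-y|<r\}$. For $p(\cdot)\in\mathcal{P}(\Omega)$ and measurable $\lambda(\cdot):\Omega\to[0,n]$, define the modular \[ I_{p(\cdot),\lambda(\cdot)}(f)=\sup_{x\in\Omega,\,r>0} r^{-\lambda(x)}\int_{\tilde B(x,r)}|f(y)|^{p(y)}\,dy, \] and the variable exponent Morrey norm $\|f\|_{M^{\lambda(\cdot)}_{p(\cdot)}(\Omega)}=\inf\{\eta>0: I_{p(\cdot),\lambda(\cdot)}(f/\eta)\le1\}$ for measurable $f$ on $\Omega$ (with value $+\infty$ if the set is empty). The fractional integral of a function $f$ on $\Omega$ is $I_\gamma f(x)=\int_\Omega \frac{f(y)}{|x-y|^{n-\gamma}}\,dy$ (i.e. $f$ is extended by zero outside $\Omega$). Functions are measurable; the inequality is trivial when the right-hand side is infinite. *)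

theory Defs
  imports "HOL-Analysis.Analysis" "HOL-Probability.Essential_Supremum"
begin

definition ess_sup_on :: "'a::euclidean_space set \<Rightarrow> ('a \<Rightarrow> ereal) \<Rightarrow> ereal" where
  "ess_sup_on \<Omega> u = esssup (lebesgue_on \<Omega>) u"

definition ess_inf_on :: "'a::euclidean_space set \<Rightarrow> ('a \<Rightarrow> ereal) \<Rightarrow> ereal" where
  "ess_inf_on \<Omega> u = - esssup (lebesgue_on \<Omega>) (\<lambda>x. - u x)"

definition variable_exponents :: "'a::euclidean_space set \<Rightarrow> ('a \<Rightarrow> ereal) set" where
  "variable_exponents \<Omega> = {p \<in> borel_measurable (lebesgue_on \<Omega>). \<forall>x\<in>\<Omega>. 1 \<le> p x}"

text \<open>
  The solution \<open>p'\<close> of \<open>1/p + 1/p' = 1\<close> for \<open>p \<in> [1, \<infinity>]\<close>; in \<^typ>\<open>ereal\<close>, \<open>1 / 0 = \<infinity>\<close> and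
  \<open>1 / \<infinity> = 0\<close>, so that \<open>1' = \<infinity>\<close> and \<open>\<infinity>' = 1\<close>.
\<close>
definition conjugate_exponent :: "ereal \<Rightarrow> ereal" where
  "conjugate_exponent p = 1 / (1 - 1 / p)"

lemma conjugate_exponent_eq:
  assumes "1 \<le> p"
  shows "1 / p + 1 / conjugate_exponent p = 1"
proof (cases p)
  case (real r)
  with assms have "1 \<le> r" by simp
  with real show ?thesis
    by (cases "r = 1") (auto simp: conjugate_exponent_def one_ereal_def divide_ereal_def field_simps)
next
  case PInf
  then show ?thesis by (simp add: conjugate_exponent_def)
next
  case MInf
  with assms show ?thesis by simp
qed

text \<open>
  The case \<open>x = y\<close> is harmless: since \<open>ln 0 = 0\<close> and \<open>C / 0 = 0\<close>, it reads \<open>0 \<le> 0\<close>.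
\<close>
definition LH0 :: "'a::euclidean_space set \<Rightarrow> ('a \<Rightarrow> real) set" where
  "LH0 \<Omega> = {u. \<exists>C. \<forall>x\<in>\<Omega>. \<forall>y\<in>\<Omega>. norm (x - y) < 1 / 2 \<longrightarrow>
      \<bar>u x - u y\<bar> \<le> C / (- ln (norm (x - y)))}"

definition morrey_modular ::
  "'a::euclidean_space set \<Rightarrow> ('a \<Rightarrow> real) \<Rightarrow> ('a \<Rightarrow> real) \<Rightarrow> ('a \<Rightarrow> real) \<Rightarrow> ennreal" where
  "morrey_modular \<Omega> p lam f =
     (SUP x\<in>\<Omega>. SUP r\<in>{0<..}.
        ennreal (r powr (- lam x)) *
        (\<integral>\<^sup>+ y. ennreal (\<bar>f y\<bar> powr p y) \<partial>lebesgue_on {y \<in> \<Omega>. norm (x - y) < r}))"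

text \<open>The infimum of the empty set is \<open>\<infinity>\<close> in \<^typ>\<open>ennreal\<close>.\<close>
definition morrey_norm ::
  "'a::euclidean_space set \<Rightarrow> ('a \<Rightarrow> real) \<Rightarrow> ('a \<Rightarrow> real) \<Rightarrow> ('a \<Rightarrow> real) \<Rightarrow> ennreal" where
  "morrey_norm \<Omega> p lam f =
     Inf {ennreal \<eta> | \<eta>. 0 < \<eta> \<and> morrey_modular \<Omega> p lam (\<lambda>x. f x / \<eta>) \<le> 1}"

definition riesz_integrand :: "real \<Rightarrow> ('a::euclidean_space \<Rightarrow> real) \<Rightarrow> 'a \<Rightarrow> 'a \<Rightarrow> real" where
  "riesz_integrand \<gamma> f x y = f y / norm (x - y) powr (real DIM('a) - \<gamma>)"

text \<open>
  The Bochner integral of a non-integrable function is \<open>0\<close>; this is the fractional integral only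
  at points \<open>x\<close> where \<open>riesz_integrand \<gamma> f x\<close> is integrable over \<open>\<Omega>\<close>.
\<close>
definition fractional_integral ::
  "'a::euclidean_space set \<Rightarrow> real \<Rightarrow> ('a \<Rightarrow> real) \<Rightarrow> 'a \<Rightarrow> real" where
  "fractional_integral \<Omega> \<gamma> f x = (\<integral>y. riesz_integrand \<gamma> f x y \<partial>lebesgue_on \<Omega>)"

end

theory Submission
  imports Defs
begin

text \<open>
  Put \<open>g = |y - x\<^sub>0|\<^sup>b |f|\<close>, normalised to modular at most \<open>1\<close>, \<open>\<alpha> = \<gamma> + a - b\<close>, \<open>\<kappa> = (n - \<lambda>) / p\<close> and
  \<open>\<kappa>q = (n - \<lambda>) / q = \<kappa> - \<alpha>\<close>. Log-Hoelder continuity makes \<open>s\<^bsup>u(x)\<^esup>\<close> and \<open>s\<^bsup>u(y)\<^esup>\<close> comparable when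
  \<open>|x - y| \<le> s\<close>, which gives the two averaging bounds
  \<open>\<integral>\<^bsub>B(x,s)\<^esub> g \<lesssim> s\<^bsup>n-\<kappa>(x)\<^esup>\<close> and \<open>\<integral>\<^bsub>B(x,s)\<^esub> g \<lesssim> s\<^sup>n (M G(x) + 1)\<^bsup>\<sigma>/p(x)\<^esup>\<close>, where \<open>G = g\<^bsup>p/\<sigma>\<^esup>\<close>,
  \<open>1 < \<sigma> < p\<^sub>-\<close> and \<open>M\<close> is the maximal operator. The part of \<open>I\<^sub>\<gamma> f(x)\<close> coming from \<open>|y - x\<^sub>0|\<close> much smaller or
  much larger than \<open>|x - x\<^sub>0|\<close> is summed over dyadic shells around \<open>x\<^sub>0\<close>; after multiplication by
  \<open>|x - x\<^sub>0|\<^sup>a\<close> it is bounded by \<open>|x - x\<^sub>0|\<^bsup>-\<kappa>q(x\<^sub>0)\<^esup>\<close>, whose \<open>q(x)\<close>-th power is comparable to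
  \<open>|x - x\<^sub>0|\<^bsup>\<lambda>(x)-n\<^esup>\<close>. The remaining part is dominated by a fractional integral of \<open>g\<close> of order \<open>\<alpha>\<close> (by \<open>M\<close> itself
  if \<open>\<alpha> = 0\<close>), and Hedberg's argument bounds its \<open>q(x)\<close>-th power by \<open>(M G(x) + 1)\<^sup>\<sigma>\<close>. Both bounds have
  constant-exponent Morrey estimates, the second by the Hardy-Littlewood theorem in \<open>L\<^sup>\<sigma>\<close>.
\<close>

section \<open>Maximal functions\<close>

text \<open>The modular is not homogeneous, so every bound is proved for functions of modular at
  most 1 and rescaled only at the end. The gain from \<open>G\<close> is that its \<sigma>-th power
  is exactly the integrand \<open>g y powr p y\<close> of the modular: the maximal theorem is then
  needed only for the constant exponent \<sigma>, while \<open>p y / \<sigma> \<ge> 1\<close> still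
  permits a Jensen-type comparison. The "+ 1" next to the maximal function is the price of that
  comparison. The restrictions on \<open>a\<close> and \<open>b\<close> are what makes the two shell
  sums around \<open>x0\<close> converge: the inner one has exponent
  \<open>n - \<kappa> x0 - b\<close>, which the bound on \<open>b\<close> keeps above
  \<open>lam x0 / p x0\<close>, and the outer one has exponent
  \<open>\<gamma> - \<kappa> x0 - b = - (a + \<kappa>q x0)\<close>, negative by the bound on
  \<open>a\<close>. Both sums use exponents frozen at \<open>x0\<close>; log-Hoelder continuity then
  moves the result to \<open>x\<close>. Measurability of the fractional integral in \<open>x\<close>
  is never established. Every integral in \<open>x\<close> is bounded through measurable
  majorants.\<close>

lemma emeasure_lebesgue_ball:
  fixes x :: "'a::euclidean_space"
  assumes "0 \<le> s"
  shows "emeasure lebesgue (ball x s) = ennreal (unit_ball_vol (real DIM('a)) * s ^ DIM('a))"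
  using emeasure_ball[OF assms, of x] by simp

lemma borel_measurable_on_ball:
  fixes f :: "'a::euclidean_space \<Rightarrow> ennreal"
  shows "f \<in> borel_measurable lebesgue \<Longrightarrow> (\<lambda>y. f y * indicator (ball x s) y) \<in> borel_measurable lebesgue"
  by (intro borel_measurable_times_ennreal borel_measurable_indicator) simp_all

lemma borel_measurable_norm_powr:
  fixes x :: "'a::euclidean_space"
  shows "(\<lambda>y. norm (x - y) powr e) \<in> borel_measurable lebesgue"
proof (rule measurable_completion)
  have "(\<lambda>y. norm (x - y) powr e) \<in> borel_measurable borel" by measurable
  then show "(\<lambda>y. norm (x - y) powr e) \<in> borel_measurable lborel" by simp
qed

lemma AE_lebesgue_neq: "AE y in lebesgue. y \<noteq> (c :: 'a::euclidean_space)"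
proof (rule AE_I'[of "{c}"])
  show "{c} \<in> null_sets lebesgue" by (intro null_sets_completionI) (simp add: null_sets_def)
qed auto

text \<open>The integral is a supremum over simple minorants, and division by \<open>c\<close> turns
  a simple minorant of \<open>c * f\<close> into a measurable minorant of \<open>f\<close>, so
  measurability of \<open>f\<close> does not enter. The final estimate applies this to a power of
  the majorant of the fractional integral.\<close>

lemma nn_integral_cmult_le:
  assumes c: "0 < (c::real)"
  shows "(\<integral>\<^sup>+x. ennreal c * f x \<partial>M) \<le> ennreal c * (\<integral>\<^sup>+x. f x \<partial>M)"
  unfolding nn_integral_def[of M "\<lambda>x. ennreal c * f x"]
proof (rule SUP_least, clarify)
  fix g assume g: "simple_function M g" "g \<le> (\<lambda>x. ennreal c * f x)"
  have gm: "(\<lambda>x. g x / ennreal c) \<in> borel_measurable M"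
    using borel_measurable_simple_function[OF g(1)] by measurable
  have cc: "ennreal c * (t / ennreal c) = t" for t
    using c by (subst ennreal_times_divide, subst mult.commute, subst ennreal_mult_divide_eq) auto
  have gf: "g x / ennreal c \<le> f x" for x
  proof -
    have "g x / ennreal c \<le> ennreal c * f x / ennreal c"
      using g(2) by (intro divide_right_mono_ennreal) (simp add: le_fun_def)
    also have "\<dots> = f x" using c by (subst mult.commute, subst ennreal_mult_divide_eq) auto
    finally show ?thesis .
  qed
  have "integral\<^sup>S M g = (\<integral>\<^sup>+x. ennreal c * (g x / ennreal c) \<partial>M)"
    unfolding cc by (simp add: nn_integral_eq_simple_integral g(1))
  also have "\<dots> = ennreal c * (\<integral>\<^sup>+x. g x / ennreal c \<partial>M)" by (rule nn_integral_cmult[OF gm])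
  also have "\<dots> \<le> ennreal c * (\<integral>\<^sup>+x. f x \<partial>M)" by (intro mult_left_mono nn_integral_mono gf) simp
  finally show "integral\<^sup>S M g \<le> ennreal c * (\<integral>\<^sup>+x. f x \<partial>M)" .
qed

text \<open>Vitali covering: among the balls that witness the level set, a disjoint subfamily has
  fivefold dilates covering all of them. Each dilate has measure at most
  \<open>5 ^ n * w / t\<close> times the mass of \<open>F\<close> in the original ball, and
  disjointness adds these masses to at most the total. \<open>U\<close> is the union of the dilates,
  a measurable substitute for the level set itself.\<close>

lemma weak_type_maximal:
  fixes F :: "'a::euclidean_space \<Rightarrow> ennreal"
  assumes [measurable]: "F \<in> borel_measurable lebesgue" and t: "0 < (t::real)"
  obtains U where "U \<in> sets lebesgue"
    "{x. \<exists>s>0. ennreal (t * s ^ DIM('a)) < (\<integral>\<^sup>+y\<in>ball x s. F y \<partial>lebesgue)} \<subseteq> U"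
    "emeasure lebesgue U \<le> ennreal (5 ^ DIM('a) * unit_ball_vol (real DIM('a)) / t) * (\<integral>\<^sup>+y. F y \<partial>lebesgue)"
proof (cases "(\<integral>\<^sup>+y. F y \<partial>lebesgue) = \<infinity>")
  case True
  have "0 < unit_ball_vol (real DIM('a))" by simp
  then have "unit_ball_vol (real DIM('a)) \<noteq> 0" by linarith
  then have "ennreal (5 ^ DIM('a) * unit_ball_vol (real DIM('a)) / t) * (\<integral>\<^sup>+y. F y \<partial>lebesgue) = \<infinity>"
    using True t by (simp add: ennreal_mult_eq_top_iff)
  then show ?thesis by (intro that[of UNIV]) auto
next
  case False
  let ?n = "DIM('a)" and ?w = "unit_ball_vol (real DIM('a))"
  define I where "I = enn2real (\<integral>\<^sup>+y. F y \<partial>lebesgue)"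
  have I: "(\<integral>\<^sup>+y. F y \<partial>lebesgue) = ennreal I" "0 \<le> I"
    using False by (auto simp: I_def less_top)
  define K where "K = {i :: 'a \<times> real. 0 < snd i \<and> ennreal (t * snd i ^ ?n) < (\<integral>\<^sup>+y\<in>ball (fst i) (snd i). F y \<partial>lebesgue)}"
  \<comment> \<open>Vitali's lemma requires bounded radii. Comparing with the total mass
    \<open>I\<close> gives \<open>s ^ n \<le> I / t\<close>, which controls \<open>s\<close> once
    \<open>s \<ge> 1\<close>; the maximum with 1 takes care of smaller radii.\<close>
  have bound: "0 < snd i \<and> snd i \<le> max 1 (I / t)" if "i \<in> K" for i
  proof -
    have "ennreal (t * snd i ^ ?n) < (\<integral>\<^sup>+y\<in>ball (fst i) (snd i). F y \<partial>lebesgue)"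
      using that by (simp add: K_def)
    also have "\<dots> \<le> (\<integral>\<^sup>+y. F y \<partial>lebesgue)"
      by (intro nn_integral_mono) (auto simp: indicator_def)
    finally have "t * snd i ^ ?n < I"
      using I by (metis ennreal_leI not_le)
    then have "snd i ^ ?n \<le> I / t"
      using t by (simp add: field_simps)
    moreover have "snd i \<le> snd i ^ ?n" if "1 \<le> snd i"
      using that by (intro self_le_power) auto
    ultimately have "snd i \<le> max 1 (I / t)" by linarith
    then show ?thesis using that by (simp add: K_def)
  qed
  obtain C where C: "countable C" "C \<subseteq> K"
      "pairwise (\<lambda>i j. disjnt (ball (fst i) (snd i)) (ball (fst j) (snd j))) C"
      "(\<Union>i\<in>K. ball (fst i) (snd i)) \<subseteq> (\<Union>i\<in>C. ball (fst i) (5 * snd i))"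
    by (rule Vitali_covering_lemma_balls[where K = K and a = fst and r = snd, OF subset_refl bound])
  let ?U = "\<Union>i\<in>C. ball (fst i) (5 * snd i)"
  have "emeasure lebesgue ?U = (\<integral>\<^sup>+x. indicator ?U x \<partial>lebesgue)"
    using C(1) by (subst nn_integral_indicator) auto
  \<comment> \<open>Integrals over \<open>count_space C\<close> play the role of countable sums, so
    that sum and integral can be interchanged.\<close>
  also have "\<dots> \<le> (\<integral>\<^sup>+x. (\<integral>\<^sup>+i. indicator (ball (fst i) (5 * snd i)) x \<partial>count_space C) \<partial>lebesgue)"
  proof (intro nn_integral_mono)
    fix x :: 'a
    show "indicator ?U x \<le> (\<integral>\<^sup>+i. indicator (ball (fst i) (5 * snd i)) x \<partial>count_space C :: ennreal)"
    proof (cases "x \<in> ?U")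
      case True
      then obtain i where i: "i \<in> C" "x \<in> ball (fst i) (5 * snd i)" by blast
      show ?thesis
        using i nn_integral_ge_point[OF i(1), of "\<lambda>i. indicator (ball (fst i) (5 * snd i)) x"] True
        by (auto simp: indicator_def)
    qed auto
  qed
  also have "\<dots> = (\<integral>\<^sup>+i. (\<integral>\<^sup>+x. indicator (ball (fst i) (5 * snd i)) x \<partial>lebesgue) \<partial>count_space C)"
    by (intro nn_integral_count_space_nn_integral C borel_measurable_indicator) simp
  also have "\<dots> \<le> (\<integral>\<^sup>+i. ennreal (5 ^ ?n * ?w / t) * (\<integral>\<^sup>+y\<in>ball (fst i) (snd i). F y \<partial>lebesgue) \<partial>count_space C)"
  proof (intro nn_integral_mono)
    fix i assume "i \<in> space (count_space C)"
    then have i: "i \<in> K" using C(2) by auto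
    then have "0 < snd i" by (simp add: K_def)
    then have "(\<integral>\<^sup>+x. indicator (ball (fst i) (5 * snd i)) x \<partial>lebesgue) = ennreal (?w * (5 * snd i) ^ ?n)"
      by (subst nn_integral_indicator) (simp_all only: emeasure_lebesgue_ball, simp)
    also have "\<dots> = ennreal (5 ^ ?n * ?w / t) * ennreal (t * snd i ^ ?n)"
      using t \<open>0 < snd i\<close> by (subst ennreal_mult[symmetric]) (auto simp: power_mult_distrib)
    also have "\<dots> \<le> ennreal (5 ^ ?n * ?w / t) * (\<integral>\<^sup>+y\<in>ball (fst i) (snd i). F y \<partial>lebesgue)"
      using i by (intro mult_left_mono) (auto simp: K_def)
    finally show "(\<integral>\<^sup>+x. indicator (ball (fst i) (5 * snd i)) x \<partial>lebesgue) \<le>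
        ennreal (5 ^ ?n * ?w / t) * (\<integral>\<^sup>+y\<in>ball (fst i) (snd i). F y \<partial>lebesgue)" .
  qed
  also have "\<dots> = ennreal (5 ^ ?n * ?w / t) * (\<integral>\<^sup>+i. (\<integral>\<^sup>+y\<in>ball (fst i) (snd i). F y \<partial>lebesgue) \<partial>count_space C)"
    by (intro nn_integral_cmult) auto
  also have "(\<integral>\<^sup>+i. (\<integral>\<^sup>+y\<in>ball (fst i) (snd i). F y \<partial>lebesgue) \<partial>count_space C)
      = (\<integral>\<^sup>+y. (\<integral>\<^sup>+i. F y * indicator (ball (fst i) (snd i)) y \<partial>count_space C) \<partial>lebesgue)"
    by (intro nn_integral_count_space_nn_integral[symmetric] C borel_measurable_on_ball) simp
  \<comment> \<open>Disjointness enters here: a point \<open>y\<close> lies in at most one ball of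
    the subfamily.\<close>
  also have "\<dots> \<le> (\<integral>\<^sup>+y. F y \<partial>lebesgue)"
  proof (intro nn_integral_mono)
    fix y :: 'a
    show "(\<integral>\<^sup>+i. F y * indicator (ball (fst i) (snd i)) y \<partial>count_space C) \<le> F y"
    proof (cases "\<exists>i\<in>C. y \<in> ball (fst i) (snd i)")
      case True
      then obtain i where i: "i \<in> C" "y \<in> ball (fst i) (snd i)" by blast
      have uniq: "j = i" if "j \<in> C" "y \<in> ball (fst j) (snd j)" for j
      proof (rule ccontr)
        assume "j \<noteq> i"
        with C(3) i that(1) have "disjnt (ball (fst j) (snd j)) (ball (fst i) (snd i))"
          by (auto dest: pairwiseD)
        with i(2) that(2) show False unfolding disjnt_iff by blast
      qed
      have "(\<integral>\<^sup>+j. F y * indicator (ball (fst j) (snd j)) y \<partial>count_space C)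
          = (\<integral>\<^sup>+j. F y * indicator {i} j \<partial>count_space C)"
      proof (intro nn_integral_cong)
        fix j assume "j \<in> space (count_space C)"
        then have "j \<in> C" by simp
        then have "y \<in> ball (fst j) (snd j) \<longleftrightarrow> j = i"
          using i uniq by blast
        then show "F y * indicator (ball (fst j) (snd j)) y = F y * indicator {i} j"
          by (simp add: indicator_def del: mem_ball)
      qed
      also have "\<dots> = F y"
        using i by (subst nn_integral_cmult_indicator) auto
      finally show ?thesis by simp
    next
      case False
      then have "(\<integral>\<^sup>+j. F y * indicator (ball (fst j) (snd j)) y \<partial>count_space C) = (\<integral>\<^sup>+j. 0 \<partial>count_space C)"
        by (intro nn_integral_cong) (auto simp: indicator_def)
      then show ?thesis by simp
    qed
  qed
  finally have *: "emeasure lebesgue ?U \<le> ennreal (5 ^ ?n * ?w / t) * (\<integral>\<^sup>+y. F y \<partial>lebesgue)"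
    by (simp add: mult_left_mono)
  have "{x. \<exists>s>0. ennreal (t * s ^ ?n) < (\<integral>\<^sup>+y\<in>ball x s. F y \<partial>lebesgue)} \<subseteq> (\<Union>i\<in>K. ball (fst i) (snd i))"
  proof clarify
    fix x s assume "0 < s" "ennreal (t * s ^ ?n) < (\<integral>\<^sup>+y\<in>ball x s. F y \<partial>lebesgue)"
    then show "x \<in> (\<Union>i\<in>K. ball (fst i) (snd i))"
      by (intro UN_I[of "(x, s)"]) (simp_all add: K_def)
  qed
  then show ?thesis
    using C(1,4) * by (intro that[of ?U]) auto
qed

text \<open>The \<open>k\<close> with \<open>2 ^ k < F\<close> form an initial segment, so this is a
  geometric sum of ratio above 1, comparable to its last term, and that term is at most
  \<open>F powr (\<sigma> - 1)\<close>. It is the pointwise core of Marcinkiewicz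
  interpolation.\<close>

lemma sum_powers_two_below:
  fixes \<sigma> F :: real
  assumes \<sigma>: "1 < \<sigma>" and F: "0 \<le> F"
  shows "(\<Sum>k<N. 2 powr ((\<sigma> - 1) * real k) * indicator {y. 2 ^ k < y} F)
    \<le> 2 powr (\<sigma> - 1) / (2 powr (\<sigma> - 1) - 1) * F powr (\<sigma> - 1)"
proof -
  let ?x = "2 powr (\<sigma> - 1) :: real"
  have x: "1 < ?x" using \<sigma> by simp
  have pw: "2 powr ((\<sigma> - 1) * real k) = ?x ^ k" for k
    by (simp add: powr_powr[symmetric] powr_realpow)
  define M where "M = (LEAST k. F \<le> 2 ^ k)"
  have "\<exists>k. F \<le> 2 ^ k"
    by (metis less_imp_le one_less_numeral_iff real_arch_pow semiring_norm(76))
  then have M: "F \<le> 2 ^ M" unfolding M_def by (rule LeastI_ex)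
  have below: "2 ^ k < F" if "k < M" for k
    using not_less_Least[of k "\<lambda>k. F \<le> 2 ^ k"] that by (auto simp: M_def)
  have above: "\<not> 2 ^ k < F" if "M \<le> k" for k
    using M power_increasing[OF that, of "2::real"] by linarith
  have "(\<Sum>k<N. 2 powr ((\<sigma> - 1) * real k) * indicator {y. 2 ^ k < y} F) \<le> (\<Sum>k<M. ?x ^ k)"
  proof -
    have "(\<Sum>k<N. 2 powr ((\<sigma> - 1) * real k) * indicator {y. 2 ^ k < y} F)
        = (\<Sum>k\<in>{..<N} \<inter> {..<M}. ?x ^ k)"
      unfolding pw using above below le_less_linear[of M]
      by (intro sum.mono_neutral_cong_right) (auto simp: indicator_def not_less not_le intro: leI ccontr)
    also have "\<dots> \<le> (\<Sum>k<M. ?x ^ k)"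
      by (intro sum_mono2) auto
    finally show ?thesis .
  qed
  also have "\<dots> = (?x ^ M - 1) / (?x - 1)"
    using x by (intro geometric_sum) auto
  also have "\<dots> \<le> ?x * F powr (\<sigma> - 1) / (?x - 1)"
  proof (cases M)
    case 0
    then show ?thesis using x by simp
  next
    case (Suc k)
    have "?x ^ k = (2 ^ k) powr (\<sigma> - 1)"
      by (simp add: powr_realpow[symmetric] powr_powr mult.commute)
    also have "\<dots> \<le> F powr (\<sigma> - 1)"
      using below[of k] Suc \<sigma> by (intro powr_mono2) auto
    finally have "?x ^ M - 1 \<le> ?x * F powr (\<sigma> - 1)"
      using Suc x by (auto intro: order_trans[of _ "?x * ?x ^ k"])
    then show ?thesis using x by (intro divide_right_mono) auto
  qed
  finally show ?thesis by simp
qed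

text \<open>
  The majorant \<open>W\<close> plays the role of \<open>(M F)\<^sup>\<sigma>\<close>: its definition through measurable covers of the level
  sets makes the measurability of the maximal function irrelevant.
\<close>

lemma strong_type_maximal:
  fixes \<sigma> :: real
  assumes \<sigma>: "1 < \<sigma>"
  obtains C where "0 < C"
    "\<And>F :: 'a::euclidean_space \<Rightarrow> real. F \<in> borel_measurable lebesgue \<Longrightarrow> (\<And>y. 0 \<le> F y) \<Longrightarrow>
      \<exists>W\<in>borel_measurable lebesgue.
        (\<forall>A\<in>sets lebesgue. (\<integral>\<^sup>+x\<in>A. W x \<partial>lebesgue) \<le>
           ennreal C * (emeasure lebesgue A + (\<integral>\<^sup>+y. ennreal (F y powr \<sigma>) \<partial>lebesgue))) \<and>
        (\<forall>x s. W x < \<infinity> \<longrightarrow> 0 < s \<longrightarrow> (\<integral>\<^sup>+y\<in>ball x s. ennreal (F y) \<partial>lebesgue) \<le>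
           ennreal (s ^ DIM('a) * enn2real (W x) powr (1 / \<sigma>)))"
proof -
  let ?n = "DIM('a)" and ?w = "unit_ball_vol (real DIM('a))"
  define x where "x = (2::real) powr (\<sigma> - 1)"
  have x: "1 < x" using \<sigma> by (simp add: x_def)
  define D where "D = 2 powr \<sigma> * (5 ^ ?n * ?w) * (x / (x - 1))"
  have w: "0 < ?w" by simp
  then have w1: "1 + ?w \<noteq> 0" by linarith
  have D: "0 < D" using x w by (auto simp: D_def intro!: mult_pos_pos divide_pos_pos)
  define C where "C = (1 + ?w) powr \<sigma> * max 1 D"
  have C: "0 < C" "(1 + ?w) powr \<sigma> \<le> C" "(1 + ?w) powr \<sigma> * D \<le> C"
  proof -
    have "0 < (1 + ?w) powr \<sigma>" using w by (simp add: add_pos_pos less_imp_neq[symmetric])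
    then show "0 < C" "(1 + ?w) powr \<sigma> \<le> C" "(1 + ?w) powr \<sigma> * D \<le> C"
      unfolding C_def by (auto simp: mult_le_cancel_left1 intro!: mult_left_mono)
  qed
  have "\<exists>W\<in>borel_measurable lebesgue.
        (\<forall>A\<in>sets lebesgue. (\<integral>\<^sup>+x\<in>A. W x \<partial>lebesgue) \<le>
           ennreal C * (emeasure lebesgue A + (\<integral>\<^sup>+y. ennreal (F y powr \<sigma>) \<partial>lebesgue))) \<and>
        (\<forall>x s. W x < \<infinity> \<longrightarrow> 0 < s \<longrightarrow> (\<integral>\<^sup>+y\<in>ball x s. ennreal (F y) \<partial>lebesgue) \<le>
           ennreal (s ^ DIM('a) * enn2real (W x) powr (1 / \<sigma>)))"
    if F [measurable]: "F \<in> borel_measurable lebesgue" and F0: "\<And>y. 0 \<le> F y" for F :: "'a \<Rightarrow> real"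
  proof -
    \<comment> \<open>Marcinkiewicz truncation at height \<open>2 ^ k\<close>. The discarded part of
      \<open>F\<close> is at most \<open>2 ^ k\<close>, hence contributes at most
      \<open>2 ^ k * ?w * s ^ ?n\<close> to a ball of radius \<open>s\<close>. This is the origin of
      the factor \<open>1 + ?w\<close>.\<close>
    define Fk where "Fk k y = ennreal (F y) * indicator {y. 2 ^ k < y} (F y)" for k :: nat and y
    have [measurable]: "Fk k \<in> borel_measurable lebesgue" for k
      unfolding Fk_def by measurable
    have "\<exists>U. U \<in> sets lebesgue \<and>
        {x. \<exists>s>0. ennreal (2 ^ k * s ^ ?n) < (\<integral>\<^sup>+y\<in>ball x s. Fk k y \<partial>lebesgue)} \<subseteq> U \<and>
        emeasure lebesgue U \<le> ennreal (5 ^ ?n * ?w / 2 ^ k) * (\<integral>\<^sup>+y. Fk k y \<partial>lebesgue)" for k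
      by (rule weak_type_maximal[of "Fk k" "2 ^ k"]) auto
    then have "\<exists>U. \<forall>k. U k \<in> sets lebesgue \<and>
        {x. \<exists>s>0. ennreal (2 ^ k * s ^ ?n) < (\<integral>\<^sup>+y\<in>ball x s. Fk k y \<partial>lebesgue)} \<subseteq> U k \<and>
        emeasure lebesgue (U k) \<le> ennreal (5 ^ ?n * ?w / 2 ^ k) * (\<integral>\<^sup>+y. Fk k y \<partial>lebesgue)"
      by (intro choice allI)
    then obtain U where U [measurable]: "\<And>k. U k \<in> sets lebesgue"
      and Usub: "\<And>k x s. 0 < s \<Longrightarrow> ennreal (2 ^ k * s ^ ?n) < (\<integral>\<^sup>+y\<in>ball x s. Fk k y \<partial>lebesgue) \<Longrightarrow> x \<in> U k"
      and Uem: "\<And>k. emeasure lebesgue (U k) \<le> ennreal (5 ^ ?n * ?w / 2 ^ k) * (\<integral>\<^sup>+y. Fk k y \<partial>lebesgue)"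
      by blast
    \<comment> \<open>The weight belongs to the next level, because \<open>x \<in> U k\<close> has
      to push \<open>W x\<close> above \<open>((1 + ?w) * 2 ^ Suc k) powr \<sigma>\<close>. The
      summand 1 in \<open>W\<close> starts the induction over levels at 0 and is the source of the
      term \<open>emeasure lebesgue A\<close>.\<close>
    define V where "V x = (\<Sum>k. ennreal (2 powr ((real k + 1) * \<sigma>)) * indicator (U k) x)" for x
    define W where "W x = ennreal ((1 + ?w) powr \<sigma>) * (1 + V x)" for x
    have [measurable]: "V \<in> borel_measurable lebesgue" "W \<in> borel_measurable lebesgue"
      unfolding V_def W_def by measurable
    \<comment> \<open>The weak type bound turns the weight of level \<open>k\<close> into a multiple
      of \<open>2 powr ((\<sigma> - 1) * k)\<close> integrated against \<open>Fk k\<close>; summing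
      over \<open>k\<close> below each point reproduces \<open>F powr \<sigma>\<close>.\<close>
    have V: "(\<integral>\<^sup>+x. V x \<partial>lebesgue) \<le> ennreal D * (\<integral>\<^sup>+y. ennreal (F y powr \<sigma>) \<partial>lebesgue)"
    proof -
      have "(\<integral>\<^sup>+x. V x \<partial>lebesgue) = (\<Sum>k. ennreal (2 powr ((real k + 1) * \<sigma>)) * emeasure lebesgue (U k))"
        unfolding V_def by (subst nn_integral_suminf) (auto simp: nn_integral_cmult_indicator)
      also have "\<dots> \<le> (\<Sum>k. ennreal (2 powr ((real k + 1) * \<sigma>)) *
          (ennreal (5 ^ ?n * ?w / 2 ^ k) * (\<integral>\<^sup>+y. Fk k y \<partial>lebesgue)))"
        by (intro suminf_le mult_left_mono Uem) auto
      also have "\<dots> = (\<Sum>k. \<integral>\<^sup>+y. ennreal (2 powr \<sigma> * (5 ^ ?n * ?w) * 2 powr ((\<sigma> - 1) * real k)) * Fk k y \<partial>lebesgue)"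
      proof (intro suminf_cong)
        fix k :: nat
        have "2 powr ((real k + 1) * \<sigma>) * (5 ^ ?n * ?w / 2 ^ k)
            = 2 powr \<sigma> * (5 ^ ?n * ?w) * 2 powr ((\<sigma> - 1) * real k)"
          by (simp add: powr_realpow[symmetric] powr_diff powr_add algebra_simps)
        then show "ennreal (2 powr ((real k + 1) * \<sigma>)) *
          (ennreal (5 ^ ?n * ?w / 2 ^ k) * (\<integral>\<^sup>+y. Fk k y \<partial>lebesgue)) =
          (\<integral>\<^sup>+y. ennreal (2 powr \<sigma> * (5 ^ ?n * ?w) * 2 powr ((\<sigma> - 1) * real k)) * Fk k y \<partial>lebesgue)"
          by (subst nn_integral_cmult) (auto simp: mult.assoc[symmetric] ennreal_mult[symmetric])
      qed
      also have "\<dots> = (\<integral>\<^sup>+y. (\<Sum>k. ennreal (2 powr \<sigma> * (5 ^ ?n * ?w) * 2 powr ((\<sigma> - 1) * real k)) * Fk k y) \<partial>lebesgue)"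
        by (subst nn_integral_suminf) auto
      also have "\<dots> \<le> (\<integral>\<^sup>+y. ennreal D * ennreal (F y powr \<sigma>) \<partial>lebesgue)"
      proof (intro nn_integral_mono)
        fix y :: 'a
        let ?S = "\<lambda>N. \<Sum>k<N. 2 powr ((\<sigma> - 1) * real k) * indicator {z. 2 ^ k < z} (F y)"
        have S: "?S N \<le> x / (x - 1) * F y powr (\<sigma> - 1)" for N
          unfolding x_def by (rule sum_powers_two_below[OF \<sigma> F0])
        have "(\<Sum>k<N. ennreal (2 powr \<sigma> * (5 ^ ?n * ?w) * 2 powr ((\<sigma> - 1) * real k)) * Fk k y)
            \<le> ennreal D * ennreal (F y powr \<sigma>)" for N
        proof -
          have "(\<Sum>k<N. ennreal (2 powr \<sigma> * (5 ^ ?n * ?w) * 2 powr ((\<sigma> - 1) * real k)) * Fk k y)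
             = (\<Sum>k<N. ennreal (2 powr \<sigma> * (5 ^ ?n * ?w) * F y * (2 powr ((\<sigma> - 1) * real k) * indicator {z. 2 ^ k < z} (F y))))"
            using F0[of y] by (intro sum.cong refl) (auto simp: Fk_def ennreal_mult[symmetric] indicator_def algebra_simps)
          also have "\<dots> = ennreal (2 powr \<sigma> * (5 ^ ?n * ?w) * F y * ?S N)"
            unfolding sum_distrib_left using F0[of y] by (intro sum_ennreal) auto
          also have "\<dots> \<le> ennreal (2 powr \<sigma> * (5 ^ ?n * ?w) * F y * (x / (x - 1) * F y powr (\<sigma> - 1)))"
            using F0[of y] by (intro ennreal_leI mult_left_mono S) auto
          also have "2 powr \<sigma> * (5 ^ ?n * ?w) * F y * (x / (x - 1) * F y powr (\<sigma> - 1)) = D * (F y powr 1 * F y powr (\<sigma> - 1))"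
            using F0[of y] by (simp add: D_def)
          also have "F y powr 1 * F y powr (\<sigma> - 1) = F y powr \<sigma>"
            by (subst powr_add[symmetric]) simp
          finally show ?thesis using D by (simp add: ennreal_mult)
        qed
        then show "(\<Sum>k. ennreal (2 powr \<sigma> * (5 ^ ?n * ?w) * 2 powr ((\<sigma> - 1) * real k)) * Fk k y)
            \<le> ennreal D * ennreal (F y powr \<sigma>)"
          by (auto simp: suminf_eq_SUP intro!: SUP_least)
      qed
      also have "\<dots> = ennreal D * (\<integral>\<^sup>+y. ennreal (F y powr \<sigma>) \<partial>lebesgue)"
        by (intro nn_integral_cmult) auto
      finally show ?thesis .
    qed
    have WA: "(\<integral>\<^sup>+x\<in>A. W x \<partial>lebesgue) \<le>
           ennreal C * (emeasure lebesgue A + (\<integral>\<^sup>+y. ennreal (F y powr \<sigma>) \<partial>lebesgue))"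
      if [measurable]: "A \<in> sets lebesgue" for A
    proof -
      let ?c = "ennreal ((1 + ?w) powr \<sigma>)"
      have "(\<integral>\<^sup>+x\<in>A. W x \<partial>lebesgue) \<le> (\<integral>\<^sup>+x. ?c * (indicator A x + V x) \<partial>lebesgue)"
        by (intro nn_integral_mono) (auto simp: W_def indicator_def)
      also have "\<dots> = ?c * (emeasure lebesgue A + (\<integral>\<^sup>+x. V x \<partial>lebesgue))"
        by (simp add: nn_integral_cmult nn_integral_add)
      also have "\<dots> \<le> ?c * emeasure lebesgue A + ?c * (ennreal D * (\<integral>\<^sup>+y. ennreal (F y powr \<sigma>) \<partial>lebesgue))"
        by (simp add: distrib_left add_left_mono mult_left_mono V)
      also have "\<dots> = ?c * emeasure lebesgue A + ennreal ((1 + ?w) powr \<sigma> * D) * (\<integral>\<^sup>+y. ennreal (F y powr \<sigma>) \<partial>lebesgue)"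
        using D by (simp add: ennreal_mult mult.assoc)
      also have "\<dots> \<le> ennreal C * emeasure lebesgue A + ennreal C * (\<integral>\<^sup>+y. ennreal (F y powr \<sigma>) \<partial>lebesgue)"
        using C by (intro add_mono mult_right_mono ennreal_leI) auto
      finally show ?thesis by (simp add: distrib_left)
    qed
    have Wx: "(\<integral>\<^sup>+y\<in>ball x s. ennreal (F y) \<partial>lebesgue) \<le> ennreal (s ^ DIM('a) * enn2real (W x) powr (1 / \<sigma>))"
      if fin: "W x < \<infinity>" and s: "0 < s" for x s
    \<comment> \<open>If some average were too large, then
      \<open>(1 + ?w) * 2 ^ k \<le> ?v powr (1 / \<sigma>)\<close> would put \<open>x\<close> into
      \<open>U k\<close>, and membership in \<open>U k\<close> would give the same inequality for
      \<open>Suc k\<close>. By induction the finite value \<open>?v\<close> would exceed every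
      level.\<close>
    proof (rule ccontr)
      assume "\<not> ?thesis"
      then have less: "ennreal (s ^ ?n * enn2real (W x) powr (1 / \<sigma>)) < (\<integral>\<^sup>+y\<in>ball x s. ennreal (F y) \<partial>lebesgue)"
        by simp
      let ?v = "enn2real (W x)"
      have Wv: "W x = ennreal ?v" using fin by simp
      have mem: "x \<in> U k" if k: "(1 + ?w) * 2 ^ k \<le> ?v powr (1 / \<sigma>)" for k
      proof (rule Usub[OF s])
        have "(\<integral>\<^sup>+y\<in>ball x s. ennreal (F y) \<partial>lebesgue)
            \<le> (\<integral>\<^sup>+y. ennreal (2 ^ k) * indicator (ball x s) y + Fk k y * indicator (ball x s) y \<partial>lebesgue)"
          by (intro nn_integral_mono) (auto simp: indicator_def Fk_def not_less intro!: ennreal_leI)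
        also have "\<dots> = ennreal (2 ^ k * (?w * s ^ ?n)) + (\<integral>\<^sup>+y\<in>ball x s. Fk k y \<partial>lebesgue)"
        proof -
          have "(\<integral>\<^sup>+y. ennreal (2 ^ k) * indicator (ball x s) y \<partial>lebesgue) = ennreal (2 ^ k) * emeasure lebesgue (ball x s)"
            by (rule nn_integral_cmult_indicator) simp
          also have "\<dots> = ennreal (2 ^ k * (?w * s ^ ?n))"
            using s w by (subst emeasure_lebesgue_ball) (simp_all add: ennreal_mult[symmetric] del: ennreal_power)
          finally show ?thesis
            by (subst nn_integral_add) (simp_all add: borel_measurable_on_ball)
        qed
        finally have le: "(\<integral>\<^sup>+y\<in>ball x s. ennreal (F y) \<partial>lebesgue) \<le> ennreal (2 ^ k * (?w * s ^ ?n)) + (\<integral>\<^sup>+y\<in>ball x s. Fk k y \<partial>lebesgue)" .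
        have "ennreal (2 ^ k * s ^ ?n) + ennreal (2 ^ k * (?w * s ^ ?n)) = ennreal (s ^ ?n * ((1 + ?w) * 2 ^ k))"
          using s w by (subst ennreal_plus[symmetric]) (simp_all add: algebra_simps)
        also have "\<dots> \<le> ennreal (s ^ ?n * ?v powr (1 / \<sigma>))"
          using s by (intro ennreal_leI mult_left_mono k) auto
        also have "\<dots> < ennreal (2 ^ k * (?w * s ^ ?n)) + (\<integral>\<^sup>+y\<in>ball x s. Fk k y \<partial>lebesgue)"
          using less le by (rule less_le_trans)
        finally have *: "ennreal (2 ^ k * s ^ ?n) + ennreal (2 ^ k * (?w * s ^ ?n)) < ennreal (2 ^ k * (?w * s ^ ?n)) + (\<integral>\<^sup>+y\<in>ball x s. Fk k y \<partial>lebesgue)" .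
        show "ennreal (2 ^ k * s ^ ?n) < (\<integral>\<^sup>+y\<in>ball x s. Fk k y \<partial>lebesgue)"
        proof (rule ccontr)
          assume "\<not> ?thesis"
          then have "ennreal (2 ^ k * (?w * s ^ ?n)) + (\<integral>\<^sup>+y\<in>ball x s. Fk k y \<partial>lebesgue) \<le> ennreal (2 ^ k * (?w * s ^ ?n)) + ennreal (2 ^ k * s ^ ?n)"
            by (intro add_left_mono) simp
          also have "\<dots> = ennreal (2 ^ k * s ^ ?n) + ennreal (2 ^ k * (?w * s ^ ?n))" by (rule add.commute)
          finally show False using * by (meson leD)
        qed
      qed
      have big: "((1 + ?w) * 2 ^ Suc k) powr \<sigma> < ?v" if "x \<in> U k" for k
      proof -
        have "ennreal (2 powr ((real k + 1) * \<sigma>)) = (\<Sum>j\<in>{k}. ennreal (2 powr ((real j + 1) * \<sigma>)) * indicator (U j) x)"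
          using that by simp
        also have "\<dots> \<le> V x"
          unfolding V_def by (intro sum_le_suminf) auto
        finally have "ennreal ((1 + ?w) powr \<sigma>) * (1 + ennreal (2 powr ((real k + 1) * \<sigma>))) \<le> W x"
          unfolding W_def by (intro mult_left_mono add_left_mono) auto
        then have "ennreal ((1 + ?w) powr \<sigma> * (1 + 2 powr ((real k + 1) * \<sigma>))) \<le> ennreal ?v"
          unfolding Wv[symmetric] by (simp add: ennreal_mult)
        then have "(1 + ?w) powr \<sigma> * (1 + 2 powr ((real k + 1) * \<sigma>)) \<le> ?v"
          by (simp add: ennreal_le_iff)
        moreover have "((1 + ?w) * 2 ^ Suc k) powr \<sigma> = (1 + ?w) powr \<sigma> * 2 powr ((real k + 1) * \<sigma>)"
        proof -
          have "(2::real) ^ Suc k = 2 powr (real k + 1)"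
            by (simp add: powr_realpow[symmetric] powr_add)
          then show ?thesis
            using w w1 by (simp only: powr_powr powr_mult not_False_eq_True)
        qed
        moreover have "0 < (1 + ?w) powr \<sigma>" using w w1 by simp
        ultimately show ?thesis unfolding distrib_left by linarith
      qed
      have "(1 + ?w) powr \<sigma> \<le> ?v"
      proof -
        have "ennreal ((1 + ?w) powr \<sigma>) * (1 + 0) \<le> W x"
          unfolding W_def by (intro mult_left_mono add_left_mono) auto
        then have "ennreal ((1 + ?w) powr \<sigma>) \<le> ennreal ?v" unfolding Wv[symmetric] by simp
        then show ?thesis by (simp add: ennreal_le_iff)
      qed
      then have base: "(1 + ?w) * 2 ^ 0 \<le> ?v powr (1 / \<sigma>)"
        using powr_mono2[of "1 / \<sigma>" "(1 + ?w) powr \<sigma>" ?v] \<sigma> w by (simp add: powr_powr)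
      have "(1 + ?w) * 2 ^ k \<le> ?v powr (1 / \<sigma>)" for k
      proof (induction k)
        case (Suc k)
        have "((1 + ?w) * 2 ^ Suc k) powr \<sigma> \<le> ?v"
          using big[OF mem[OF Suc.IH]] by simp
        then have "(((1 + ?w) * 2 ^ Suc k) powr \<sigma>) powr (1 / \<sigma>) \<le> ?v powr (1 / \<sigma>)"
          using \<sigma> by (intro powr_mono2) auto
        then show ?case using \<sigma> w w1 by (simp add: powr_powr)
      qed (use base in simp)
      moreover obtain k where "?v powr (1 / \<sigma>) < 2 ^ k"
        using real_arch_pow[of 2] by auto
      moreover have "2 ^ k \<le> (1 + ?w) * 2 ^ k" for k using w by simp
      ultimately show False by (meson leD le_less_trans order_trans)
    qed
    show ?thesis using WA Wx by (intro bexI[of _ W]) auto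
  qed
  then show ?thesis using that[OF C(1)] by blast
qed

section \<open>Dyadic decomposition of Riesz kernels\<close>

lemma powr_le_dyadic:
  fixes s t e :: real
  assumes "0 < s" and "s / 2 \<le> t" and "t \<le> s"
  shows "t powr e \<le> 2 powr \<bar>e\<bar> * s powr e"
proof (cases "0 \<le> e")
  case True
  then have "t powr e \<le> 1 * s powr e" using assms by (simp add: powr_mono2)
  also have "\<dots> \<le> 2 powr \<bar>e\<bar> * s powr e" by (intro mult_right_mono) (auto simp: ge_one_powr_ge_zero)
  finally show ?thesis .
next
  case False
  then have "t powr e \<le> (s / 2) powr e"
    using assms by (intro powr_mono2') auto
  also have "\<dots> = 2 powr \<bar>e\<bar> * s powr e"
    using assms False by (simp add: powr_divide powr_minus field_simps)
  finally show ?thesis .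
qed

text \<open>On the shell between \<open>s j / 2\<close> and \<open>s j\<close> the kernel is
  comparable to \<open>s j powr e\<close>; bounding the mass of each shell by that of the full ball
  leaves a geometric series of ratio \<open>2 powr (- (e + d))\<close>. The lower bound \<epsilon>
  is kept apart from \<open>e + d\<close> so that the constant stays uniform when \<open>d\<close>
  varies with the point.\<close>

lemma nn_integral_riesz_inner:
  fixes g :: "'a::euclidean_space \<Rightarrow> ennreal" and A d e \<epsilon> \<rho> :: real
  assumes [measurable]: "g \<in> borel_measurable lebesgue" and A: "0 \<le> A" and \<rho>: "0 < \<rho>"
    and \<epsilon>: "0 < \<epsilon>" "\<epsilon> \<le> e + d"
    and g: "\<And>s. 0 < s \<Longrightarrow> s \<le> \<rho> \<Longrightarrow> (\<integral>\<^sup>+y\<in>ball x s. g y \<partial>lebesgue) \<le> ennreal (A * s powr d)"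
  shows "(\<integral>\<^sup>+y\<in>ball x \<rho>. g y * ennreal (norm (x - y) powr e) \<partial>lebesgue)
    \<le> ennreal (2 powr \<bar>e\<bar> / (1 - 2 powr (- \<epsilon>)) * A * \<rho> powr (e + d))"
proof -
  define s where "s j = \<rho> * 2 powr (- real j)" for j
  have s: "0 < s j" "s j \<le> \<rho>" for j
    using \<rho> by (auto simp: s_def powr_le_one_le mult_le_cancel_left1 intro: order_trans[OF powr_mono[of _ 0]])
  have pt: "g y * ennreal (norm (x - y) powr e) * indicator (ball x \<rho>) y
      \<le> (\<Sum>j. ennreal (2 powr \<bar>e\<bar> * s j powr e) * (g y * indicator (ball x (s j)) y))" for y
  \<comment> \<open>The centre needs no shell: \<open>0 powr e = 0\<close>, so the kernel vanishes
    at \<open>y = x\<close>.\<close>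
  proof (cases "y \<in> ball x \<rho> \<and> y \<noteq> x")
    case True
    then have d: "0 < norm (x - y)" "norm (x - y) < \<rho>" by (auto simp: dist_norm)
    \<comment> \<open>The logarithm is positive, so the truncated subtraction is exact and
      \<open>j < l \<le> j + 1\<close>. The strict inequality places \<open>y\<close> in the open
      ball of radius \<open>s j\<close>.\<close>
    define j where "j = nat \<lceil>log 2 (\<rho> / norm (x - y))\<rceil> - 1"
    define l where "l = log 2 (\<rho> / norm (x - y))"
    have l: "0 < l" unfolding l_def using d \<rho> by (subst zero_less_log_cancel_iff) auto
    have j: "real j < l" "l \<le> real j + 1"
      using l unfolding j_def l_def[symmetric] by linarith+
    have nl: "norm (x - y) = \<rho> * 2 powr (- l)"
      using d \<rho> by (simp add: l_def powr_minus)
    have up: "norm (x - y) < s j"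
      unfolding nl s_def using j \<rho> by simp
    have low: "s j / 2 \<le> norm (x - y)"
    proof -
      have "s j / 2 = \<rho> * 2 powr (- (real j + 1))"
        by (simp add: s_def powr_diff powr_minus field_simps powr_add)
      also have "\<dots> \<le> \<rho> * 2 powr (- l)" using j \<rho> by simp
      finally show ?thesis by (simp add: nl)
    qed
    have "norm (x - y) powr e \<le> 2 powr \<bar>e\<bar> * s j powr e"
      using s[of j] low up by (intro powr_le_dyadic) auto
    then have "g y * ennreal (norm (x - y) powr e) * indicator (ball x \<rho>) y
        \<le> g y * ennreal (2 powr \<bar>e\<bar> * s j powr e)"
      using True by (simp add: mult_left_mono ennreal_leI)
    also have "\<dots> = (\<Sum>i\<in>{j}. ennreal (2 powr \<bar>e\<bar> * s i powr e) * (g y * indicator (ball x (s i)) y))"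
      using up by (simp add: dist_norm mult.commute)
    also have "\<dots> \<le> (\<Sum>j. ennreal (2 powr \<bar>e\<bar> * s j powr e) * (g y * indicator (ball x (s j)) y))"
      by (intro sum_le_suminf) auto
    finally show ?thesis .
  qed (auto simp: indicator_def)
  let ?b = "2 powr (- \<epsilon>)"
  have b: "0 < ?b" "?b < 1" using \<epsilon> powr_less_mono[of "- \<epsilon>" 0 "2::real"] by auto
  have "(\<integral>\<^sup>+y\<in>ball x \<rho>. g y * ennreal (norm (x - y) powr e) \<partial>lebesgue)
      \<le> (\<integral>\<^sup>+y. (\<Sum>j. ennreal (2 powr \<bar>e\<bar> * s j powr e) * (g y * indicator (ball x (s j)) y)) \<partial>lebesgue)"
    by (intro nn_integral_mono pt)
  also have "\<dots> = (\<Sum>j. ennreal (2 powr \<bar>e\<bar> * s j powr e) * (\<integral>\<^sup>+y\<in>ball x (s j). g y \<partial>lebesgue))"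
    by (subst nn_integral_suminf; intro suminf_cong nn_integral_cmult borel_measurable_times_ennreal
        borel_measurable_const borel_measurable_on_ball assms(1))
  also have "\<dots> \<le> (\<Sum>j. ennreal (2 powr \<bar>e\<bar> * s j powr e) * ennreal (A * s j powr d))"
    by (intro suminf_le mult_left_mono g s) auto
  also have "\<dots> \<le> (\<Sum>j. ennreal (2 powr \<bar>e\<bar> * A * \<rho> powr (e + d) * ?b ^ j))"
  proof (intro suminf_le)
    fix j
    have "s j powr e * s j powr d = s j powr (e + d)" by (simp add: powr_add)
    also have "\<dots> = \<rho> powr (e + d) * 2 powr (- real j * (e + d))"
      using \<rho> by (simp add: s_def powr_mult powr_powr)
    also have "\<dots> \<le> \<rho> powr (e + d) * 2 powr (- \<epsilon> * real j)"
      using mult_left_mono[OF \<epsilon>(2), of "real j"] by (intro mult_left_mono powr_mono) (auto simp: mult.commute)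
    also have "2 powr (- \<epsilon> * real j) = ?b ^ j"
      by (simp only: powr_powr[symmetric] powr_realpow[OF b(1)])
    finally have "2 powr \<bar>e\<bar> * A * (s j powr e * s j powr d) \<le> 2 powr \<bar>e\<bar> * A * (\<rho> powr (e + d) * ?b ^ j)"
      using A by (intro mult_left_mono) auto
    then show "ennreal (2 powr \<bar>e\<bar> * s j powr e) * ennreal (A * s j powr d)
        \<le> ennreal (2 powr \<bar>e\<bar> * A * \<rho> powr (e + d) * ?b ^ j)"
      using A by (subst ennreal_mult[symmetric]) (auto intro!: ennreal_leI simp: mult_ac)
  qed auto
  also have "\<dots> = ennreal (\<Sum>j. 2 powr \<bar>e\<bar> * A * \<rho> powr (e + d) * ?b ^ j)"
    using A b by (intro suminf_ennreal2 summable_mult summable_geometric) auto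
  also have "(\<Sum>j. 2 powr \<bar>e\<bar> * A * \<rho> powr (e + d) * ?b ^ j) = 2 powr \<bar>e\<bar> * A * \<rho> powr (e + d) * (1 / (1 - ?b))"
    using b by (subst suminf_mult) (auto intro!: summable_geometric simp: suminf_geometric)
  finally show ?thesis by (simp add: mult_ac)
qed

text \<open>The mirror image of the inner bound, with a negative exponent \<open>e + d\<close>. The
  radii start at \<open>2 * \<rho>\<close>, since a point at distance exactly \<rho> must already
  lie in the first open ball.\<close>

lemma nn_integral_riesz_outer:
  fixes g :: "'a::euclidean_space \<Rightarrow> ennreal" and A d e \<epsilon> \<rho> :: real
  assumes [measurable]: "g \<in> borel_measurable lebesgue" and A: "0 \<le> A" and \<rho>: "0 < \<rho>"
    and \<epsilon>: "0 < \<epsilon>" "e + d \<le> - \<epsilon>"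
    and g: "\<And>s. \<rho> \<le> s \<Longrightarrow> (\<integral>\<^sup>+y\<in>ball x s. g y \<partial>lebesgue) \<le> ennreal (A * s powr d)"
  shows "(\<integral>\<^sup>+y\<in>- ball x \<rho>. g y * ennreal (norm (x - y) powr e) \<partial>lebesgue)
    \<le> ennreal (2 powr \<bar>e\<bar> / (1 - 2 powr (- \<epsilon>)) * A * \<rho> powr (e + d))"
proof -
  define s where "s j = \<rho> * 2 powr (real j + 1)" for j
  have s: "0 < s j" "\<rho> \<le> s j" for j
    using \<rho> by (auto simp: s_def mult_le_cancel_left1 ge_one_powr_ge_zero)
  have pt: "g y * ennreal (norm (x - y) powr e) * indicator (- ball x \<rho>) y
      \<le> (\<Sum>j. ennreal (2 powr \<bar>e\<bar> * s j powr e) * (g y * indicator (ball x (s j)) y))" for y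
  proof (cases "y \<in> - ball x \<rho>")
    case True
    then have d: "0 < norm (x - y)" "\<rho> \<le> norm (x - y)" using \<rho> by (auto simp: dist_norm)
    define l where "l = log 2 (norm (x - y) / \<rho>)"
    define j where "j = nat \<lfloor>l\<rfloor>"
    have l: "0 \<le> l" using d \<rho> by (simp add: l_def)
    have j: "real j \<le> l" "l < real j + 1"
      using l unfolding j_def by linarith+
    have nl: "norm (x - y) = \<rho> * 2 powr l"
      using d \<rho> by (simp add: l_def)
    have up: "norm (x - y) < s j"
      unfolding nl s_def using j \<rho> by simp
    have low: "s j / 2 \<le> norm (x - y)"
    proof -
      have "s j / 2 = \<rho> * 2 powr real j"
        by (simp add: s_def powr_add)
      also have "\<dots> \<le> \<rho> * 2 powr l" using j \<rho> by simp
      finally show ?thesis by (simp add: nl)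
    qed
    have "norm (x - y) powr e \<le> 2 powr \<bar>e\<bar> * s j powr e"
      using s[of j] low up by (intro powr_le_dyadic) auto
    then have "g y * ennreal (norm (x - y) powr e) * indicator (- ball x \<rho>) y
        \<le> g y * ennreal (2 powr \<bar>e\<bar> * s j powr e)"
      using True by (simp add: mult_left_mono ennreal_leI)
    also have "\<dots> = (\<Sum>i\<in>{j}. ennreal (2 powr \<bar>e\<bar> * s i powr e) * (g y * indicator (ball x (s i)) y))"
      using up by (simp add: dist_norm mult.commute)
    also have "\<dots> \<le> (\<Sum>j. ennreal (2 powr \<bar>e\<bar> * s j powr e) * (g y * indicator (ball x (s j)) y))"
      by (intro sum_le_suminf) auto
    finally show ?thesis .
  qed (auto simp: indicator_def)
  let ?b = "2 powr (- \<epsilon>)"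
  have b: "0 < ?b" "?b < 1" using \<epsilon> powr_less_mono[of "- \<epsilon>" 0 "2::real"] by auto
  have "(\<integral>\<^sup>+y\<in>- ball x \<rho>. g y * ennreal (norm (x - y) powr e) \<partial>lebesgue)
      \<le> (\<integral>\<^sup>+y. (\<Sum>j. ennreal (2 powr \<bar>e\<bar> * s j powr e) * (g y * indicator (ball x (s j)) y)) \<partial>lebesgue)"
    by (intro nn_integral_mono pt)
  also have "\<dots> = (\<Sum>j. ennreal (2 powr \<bar>e\<bar> * s j powr e) * (\<integral>\<^sup>+y\<in>ball x (s j). g y \<partial>lebesgue))"
    by (subst nn_integral_suminf; intro suminf_cong nn_integral_cmult borel_measurable_times_ennreal
        borel_measurable_const borel_measurable_on_ball assms(1))
  also have "\<dots> \<le> (\<Sum>j. ennreal (2 powr \<bar>e\<bar> * s j powr e) * ennreal (A * s j powr d))"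
    by (intro suminf_le mult_left_mono g s) auto
  also have "\<dots> \<le> (\<Sum>j. ennreal (2 powr \<bar>e\<bar> * A * \<rho> powr (e + d) * ?b ^ j))"
  proof (intro suminf_le)
    fix j
    have "s j powr e * s j powr d = s j powr (e + d)" by (simp add: powr_add)
    also have "\<dots> = \<rho> powr (e + d) * 2 powr ((real j + 1) * (e + d))"
      using \<rho> by (simp add: s_def powr_mult powr_powr)
    also have "\<dots> \<le> \<rho> powr (e + d) * 2 powr (- \<epsilon> * real j)"
    proof (intro mult_left_mono powr_mono)
      have "(real j + 1) * (e + d) \<le> (real j + 1) * (- \<epsilon>)" using \<epsilon> by (intro mult_left_mono) auto
      also have "\<dots> \<le> - \<epsilon> * real j" using \<epsilon> by (simp add: algebra_simps)
      finally show "(real j + 1) * (e + d) \<le> - \<epsilon> * real j" .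
    qed auto
    also have "2 powr (- \<epsilon> * real j) = ?b ^ j"
      by (simp only: powr_powr[symmetric] powr_realpow[OF b(1)])
    finally have "2 powr \<bar>e\<bar> * A * (s j powr e * s j powr d) \<le> 2 powr \<bar>e\<bar> * A * (\<rho> powr (e + d) * ?b ^ j)"
      using A by (intro mult_left_mono) auto
    then show "ennreal (2 powr \<bar>e\<bar> * s j powr e) * ennreal (A * s j powr d)
        \<le> ennreal (2 powr \<bar>e\<bar> * A * \<rho> powr (e + d) * ?b ^ j)"
      using A by (subst ennreal_mult[symmetric]) (auto intro!: ennreal_leI simp: mult_ac)
  qed auto
  also have "\<dots> = ennreal (\<Sum>j. 2 powr \<bar>e\<bar> * A * \<rho> powr (e + d) * ?b ^ j)"
    using A b by (intro suminf_ennreal2 summable_mult summable_geometric) auto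
  also have "(\<Sum>j. 2 powr \<bar>e\<bar> * A * \<rho> powr (e + d) * ?b ^ j) = 2 powr \<bar>e\<bar> * A * \<rho> powr (e + d) * (1 / (1 - ?b))"
    using b by (subst suminf_mult) (auto intro!: summable_geometric simp: suminf_geometric)
  finally show ?thesis by (simp add: mult_ac)
qed

text \<open>Values up to the threshold \<open>t\<close> contribute at most \<open>t\<close> times
  the measure of \<open>B\<close>; above it, \<open>g y = g y powr (1 - p y) * g y powr p y\<close>
  and the first factor is at most \<open>t powr (1 - p y)\<close>. This takes the place of Hoelder
  and Jensen for a variable exponent: each application picks \<open>t\<close> to balance the two
  terms.\<close>

lemma nn_integral_split_power:
  fixes g p :: "'a \<Rightarrow> real" and t :: real
  assumes g [measurable]: "g \<in> borel_measurable M" and p [measurable]: "(\<lambda>y. g y powr p y) \<in> borel_measurable M"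
    and B [measurable]: "B \<in> sets M"
    and t: "0 < t" and D: "0 \<le> D"
    and p1: "\<And>y. y \<in> B \<Longrightarrow> 0 < g y \<Longrightarrow> 1 \<le> p y \<and> t powr (1 - p y) \<le> D"
  shows "(\<integral>\<^sup>+y\<in>B. ennreal (g y) \<partial>M) \<le> ennreal t * emeasure M B + ennreal D * (\<integral>\<^sup>+y\<in>B. ennreal (g y powr p y) \<partial>M)"
proof -
  have "(\<integral>\<^sup>+y\<in>B. ennreal (g y) \<partial>M) \<le>
      (\<integral>\<^sup>+y. ennreal t * indicator B y + ennreal D * (ennreal (g y powr p y) * indicator B y) \<partial>M)"
  proof (intro nn_integral_mono)
    fix y
    have "g y \<le> t + D * g y powr p y" if "y \<in> B"
    proof (cases "g y \<le> t")
      case True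
      then show ?thesis using D by (simp add: add_increasing2)
    next
      case False
      then have gt: "t < g y" and g0: "0 < g y" using t by auto
      have "g y = g y powr (1 - p y) * g y powr p y"
        using g0 by (simp add: powr_add[symmetric])
      also have "\<dots> \<le> t powr (1 - p y) * g y powr p y"
        using gt t p1[OF that g0] by (intro mult_right_mono powr_mono2') auto
      also have "\<dots> \<le> D * g y powr p y"
        using p1[OF that g0] by (intro mult_right_mono) auto
      finally show ?thesis using t by simp
    qed
    then have "ennreal (g y) \<le> ennreal t + ennreal D * ennreal (g y powr p y)" if "y \<in> B"
      using that t D by (auto simp: ennreal_mult[symmetric] simp flip: ennreal_plus intro!: ennreal_leI)
    then show "ennreal (g y) * indicator B y \<le>
        ennreal t * indicator B y + ennreal D * (ennreal (g y powr p y) * indicator B y)"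
      by (auto simp: indicator_def)
  qed
  also have "\<dots> = ennreal t * emeasure M B + ennreal D * (\<integral>\<^sup>+y\<in>B. ennreal (g y powr p y) \<partial>M)"
    by (subst nn_integral_add) (auto simp: nn_integral_cmult nn_integral_cmult_indicator)
  finally show ?thesis .
qed

text \<open>The power is \<open>exp ((u y - u x) * ln r)\<close>. For \<open>r < 1 / 2\<close>
  monotonicity of the logarithm allows the modulus of continuity at \<open>norm (x - y)\<close> to
  be replaced by that at \<open>r\<close>, which cancels \<open>ln r\<close>. For larger
  \<open>r\<close> both factors are bounded, by \<open>2 * \<bar>B\<bar>\<close> and by
  \<open>ln R + ln 2\<close>.\<close>

lemma LH0_powr_bound:
  fixes u :: "'a::euclidean_space \<Rightarrow> real"
  assumes u: "u \<in> LH0 \<Omega>" and b: "\<And>x. x \<in> \<Omega> \<Longrightarrow> \<bar>u x\<bar> \<le> B" and R: "1 \<le> R"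
  obtains K where "1 \<le> K"
    "\<And>x y r. x \<in> \<Omega> \<Longrightarrow> y \<in> \<Omega> \<Longrightarrow> norm (x - y) \<le> r \<Longrightarrow> 0 < r \<Longrightarrow> r \<le> R \<Longrightarrow> r powr (u y - u x) \<le> K"
proof -
  obtain C where C: "\<And>x y. x \<in> \<Omega> \<Longrightarrow> y \<in> \<Omega> \<Longrightarrow> norm (x - y) < 1 / 2 \<Longrightarrow> \<bar>u x - u y\<bar> \<le> C / (- ln (norm (x - y)))"
    using u by (auto simp: LH0_def)
  define K where "K = exp (max \<bar>C\<bar> (2 * \<bar>B\<bar> * (ln R + ln 2)))"
  have "r powr (u y - u x) \<le> K"
    if x: "x \<in> \<Omega>" "y \<in> \<Omega>" "norm (x - y) \<le> r" "0 < r" "r \<le> R" for x y r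
  proof -
    have "(u y - u x) * ln r \<le> max \<bar>C\<bar> (2 * \<bar>B\<bar> * (ln R + ln 2))"
    proof (cases "r < 1 / 2")
      case True
      have lr: "0 < - ln r" using True that by (simp add: ln_less_zero)
      have "\<bar>u x - u y\<bar> \<le> \<bar>C\<bar> / (- ln r)"
      proof (cases "x = y")
        case False
        have "\<bar>u x - u y\<bar> \<le> C / (- ln (norm (x - y)))" using C x True by simp
        also have "\<dots> \<le> \<bar>C\<bar> / (- ln (norm (x - y)))"
          using False x True by (intro divide_right_mono) (auto simp: ln_le_zero_iff)
        also have "\<dots> \<le> \<bar>C\<bar> / (- ln r)"
          using False x lr True by (intro divide_left_mono mult_pos_pos) (auto simp: ln_less_zero)
        finally show ?thesis .
      qed (use lr in \<open>simp add: divide_nonneg_neg\<close>)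
      then have "\<bar>u x - u y\<bar> * (- ln r) \<le> \<bar>C\<bar>" using lr by (simp add: field_simps)
      moreover have "(u y - u x) * ln r \<le> \<bar>u x - u y\<bar> * (- ln r)"
        using lr by (metis abs_ge_self mult_le_cancel_right mult_minus_right minus_diff_eq mult_minus_left less_le_not_le)
      ultimately show ?thesis by linarith
    next
      case False
      have "\<bar>ln r\<bar> \<le> ln R + ln 2"
      proof -
        have "ln r \<le> ln R" using that by simp
        moreover have "ln (1 / 2) \<le> ln r" using False that by (subst ln_le_cancel_iff) auto
        moreover have "0 \<le> ln R" "0 < ln (2::real)" using R by auto
        moreover have "ln (1 / 2 :: real) = - ln 2" by (simp add: ln_div)
        ultimately show ?thesis unfolding abs_le_iff by linarith
      qed
      moreover have "\<bar>u y - u x\<bar> \<le> 2 * \<bar>B\<bar>" using b[OF x(1)] b[OF x(2)] by linarith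
      ultimately have "\<bar>(u y - u x) * ln r\<bar> \<le> 2 * \<bar>B\<bar> * (ln R + ln 2)"
        unfolding abs_mult by (intro mult_mono) auto
      then show ?thesis by linarith
    qed
    then show ?thesis using that by (simp add: powr_def K_def)
  qed
  moreover have "1 \<le> K" by (simp add: K_def)
  ultimately show ?thesis using that by blast
qed

section \<open>Functions of Morrey modular at most one\<close>

text \<open>Log-Hoelder continuity is present only through the power comparisons \<open>pK\<close>
  and \<open>lamK\<close>. They reach up to \<open>2 * R\<close>, twice the bound on the diameter,
  because the weight estimate compares exponents of points at distance up to twice the
  radius.\<close>

locale morrey_setting =
  fixes \<Omega> :: "'a::euclidean_space set" and p lam :: "'a \<Rightarrow> real" and n \<omega> R K \<sigma> L Q :: real
  assumes n: "n = real DIM('a)" and \<omega>: "\<omega> = unit_ball_vol n" and Omega: "\<Omega> \<in> sets lebesgue"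
    and diam: "\<And>x y. x \<in> \<Omega> \<Longrightarrow> y \<in> \<Omega> \<Longrightarrow> norm (x - y) < R" and R: "1 \<le> R"
    and K: "1 \<le> K"
    and pK: "\<And>x y r. x \<in> \<Omega> \<Longrightarrow> y \<in> \<Omega> \<Longrightarrow> norm (x - y) \<le> r \<Longrightarrow> 0 < r \<Longrightarrow> r \<le> 2 * R \<Longrightarrow> r powr (p y - p x) \<le> K"
    and lamK: "\<And>x y r. x \<in> \<Omega> \<Longrightarrow> y \<in> \<Omega> \<Longrightarrow> norm (x - y) \<le> r \<Longrightarrow> 0 < r \<Longrightarrow> r \<le> 2 * R \<Longrightarrow> r powr (lam y - lam x) \<le> K"
    and \<sigma>: "1 < \<sigma>" and p\<sigma>: "\<And>x. x \<in> \<Omega> \<Longrightarrow> \<sigma> \<le> p x" and pQ: "\<And>x. x \<in> \<Omega> \<Longrightarrow> p x \<le> Q"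
    and lam0: "\<And>x. x \<in> \<Omega> \<Longrightarrow> 0 \<le> lam x" and lamL: "\<And>x. x \<in> \<Omega> \<Longrightarrow> lam x \<le> L" and L: "L < n"
begin

definition \<kappa> :: "'a \<Rightarrow> real" where "\<kappa> x = (n - lam x) / p x"

text \<open>Extension by zero allows integration over full balls instead of their traces on
  \<Omega>. Measurability of the power is a separate clause, as nothing is known about
  \<open>p\<close> off \<Omega>.\<close>

definition unit_morrey :: "('a \<Rightarrow> real) \<Rightarrow> bool" where
  "unit_morrey g \<longleftrightarrow> g \<in> borel_measurable lebesgue \<and> (\<lambda>y. g y powr p y) \<in> borel_measurable lebesgue \<and>
     (\<forall>y. 0 \<le> g y) \<and> (\<forall>y. y \<notin> \<Omega> \<longrightarrow> g y = 0) \<and>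
     (\<forall>x\<in>\<Omega>. \<forall>r>0. (\<integral>\<^sup>+y\<in>ball x r. ennreal (g y powr p y) \<partial>lebesgue) \<le> ennreal (r powr lam x))"

section \<open>Elementary bounds on radii and exponents\<close>

lemma omega_pos: "0 < \<omega>" by (simp add: \<omega> n)

lemma n_pos: "0 < n" by (simp add: n)

lemma powr_n: "0 < s \<Longrightarrow> s powr n = s ^ DIM('a)"
  by (simp add: n powr_realpow)

lemma emeasure_ball_n: "0 < s \<Longrightarrow> emeasure lebesgue (ball (x :: 'a) s) = ennreal (\<omega> * s powr n)"
  by (simp only: powr_n) (simp only: \<omega> n emeasure_lebesgue_ball less_imp_le)

lemma p_gt1: "x \<in> \<Omega> \<Longrightarrow> 1 < p x" using \<sigma> p\<sigma>[of x] by simp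

lemma lam_less: "x \<in> \<Omega> \<Longrightarrow> lam x < n" using lamL[of x] L by simp

lemma powr_n_le:
  assumes z: "z \<in> \<Omega>" and r: "0 < r" "r \<le> R"
  shows "r powr n \<le> R powr n * r powr lam z"
proof -
  have "r powr n = r powr (n - lam z) * r powr lam z" by (simp add: powr_add[symmetric])
  also have "r powr (n - lam z) \<le> R powr (n - lam z)" using r lam_less[OF z] by (intro powr_mono2) auto
  also have "\<dots> \<le> R powr n" using R lam0[OF z] by (intro powr_mono) auto
  finally show ?thesis by (simp add: mult_right_mono)
qed

lemma kappa_pos: "x \<in> \<Omega> \<Longrightarrow> 0 < \<kappa> x"
  using p_gt1[of x] lam_less[of x] by (simp add: \<kappa>_def)

lemma kappa_le: "x \<in> \<Omega> \<Longrightarrow> \<kappa> x \<le> n"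
proof -
  assume x: "x \<in> \<Omega>"
  have "n - lam x \<le> n * p x"
    using lam0[OF x] p_gt1[OF x] mult_left_mono[of 1 "p x" n] n_pos by linarith
  then show ?thesis using p_gt1[OF x] by (simp add: \<kappa>_def field_simps)
qed

text \<open>Exponents can be compared only on bounded radii; this reduces larger balls to radius
  \<open>R\<close>.\<close>

lemma ball_beyond_diam:
  fixes g :: "'a \<Rightarrow> ennreal"
  assumes "\<And>y. y \<notin> \<Omega> \<Longrightarrow> g y = 0" and "x \<in> \<Omega>" and "R \<le> s"
  shows "(\<integral>\<^sup>+y\<in>ball x s. g y \<partial>lebesgue) = (\<integral>\<^sup>+y\<in>ball x R. g y \<partial>lebesgue)"
proof (intro nn_integral_cong)
  fix y
  show "g y * indicator (ball x s) y = g y * indicator (ball x R) y"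
    using assms diam[of x y] by (cases "y \<in> \<Omega>") (auto simp: indicator_def dist_norm)
qed

lemma powr_K_le:
  assumes "r powr u \<le> K" "0 \<le> c" "c \<le> d"
  shows "r powr (u * c) \<le> K powr d"
proof -
  have "r powr (u * c) = (r powr u) powr c" by (simp add: powr_powr)
  also have "\<dots> \<le> K powr c" using assms by (intro powr_mono2) auto
  also have "\<dots> \<le> K powr d" using assms K by (intro powr_mono) auto
  finally show ?thesis .
qed

text \<open>Threshold splitting at height \<open>s powr (- \<kappa> x)\<close>: the identity
  \<open>\<kappa> x * (p x - 1) + lam x = n - \<kappa> x\<close> says that the parts below and above
  this height have the same order.\<close>

lemma unit_morrey_ball:
  assumes g: "unit_morrey g" and x: "x \<in> \<Omega>" and s: "0 < s"
  shows "(\<integral>\<^sup>+y\<in>ball x s. ennreal (g y) \<partial>lebesgue) \<le> ennreal ((\<omega> + K powr n) * s powr (n - \<kappa> x))"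
proof -
  have main: "(\<integral>\<^sup>+y\<in>ball x s. ennreal (g y) \<partial>lebesgue) \<le> ennreal ((\<omega> + K powr n) * s powr (n - \<kappa> x))" if s: "0 < s" "s \<le> R" for s
  proof -
    define t where "t = s powr (- \<kappa> x)"
    \<comment> \<open>The first factor is the value for the exponent frozen at \<open>x\<close>.
      Passing from \<open>p x\<close> to \<open>p y\<close> raises a quantity bounded by
      \<open>K\<close> to the power \<open>\<kappa> x \<le> n\<close>, whence
      \<open>K powr n\<close>.\<close>
    define D where "D = s powr (\<kappa> x * (p x - 1)) * K powr n"
    have "(\<integral>\<^sup>+y\<in>ball x s. ennreal (g y) \<partial>lebesgue) \<le>
        ennreal t * emeasure lebesgue (ball x s) + ennreal D * (\<integral>\<^sup>+y\<in>ball x s. ennreal (g y powr p y) \<partial>lebesgue)"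
    proof (rule nn_integral_split_power)
      fix y assume y: "y \<in> ball x s" "0 < g y"
      then have y': "y \<in> \<Omega>" using g unfolding unit_morrey_def by force
      have "norm (x - y) \<le> s" using y by (simp add: dist_norm)
      then have "s powr (p y - p x) \<le> K" using pK[OF x y'] s R by simp
      then have "s powr ((p y - p x) * \<kappa> x) \<le> K powr n"
        using kappa_pos[OF x] kappa_le[OF x] by (intro powr_K_le) auto
      then have "s powr (\<kappa> x * (p x - 1)) * s powr ((p y - p x) * \<kappa> x) \<le> D"
        unfolding D_def by (intro mult_left_mono) auto
      moreover have "t powr (1 - p y) = s powr (\<kappa> x * (p x - 1)) * s powr ((p y - p x) * \<kappa> x)"
        by (simp add: t_def powr_powr powr_add[symmetric] algebra_simps)
      ultimately show "1 \<le> p y \<and> t powr (1 - p y) \<le> D" using p_gt1[OF y'] by simp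
    qed (use g s in \<open>auto simp: unit_morrey_def t_def D_def\<close>)
    also have "\<dots> \<le> ennreal t * ennreal (\<omega> * s powr n) + ennreal D * ennreal (s powr lam x)"
      using g x s unfolding unit_morrey_def
      by (intro add_mono mult_left_mono) (auto simp: emeasure_ball_n[simplified])
    also have "\<dots> = ennreal (t * (\<omega> * s powr n) + D * s powr lam x)"
      using s omega_pos by (simp add: t_def D_def ennreal_mult[symmetric] ennreal_plus[symmetric] del: ennreal_plus)
    also have "t * (\<omega> * s powr n) + D * s powr lam x = (\<omega> + K powr n) * s powr (n - \<kappa> x)"
    proof -
      have 1: "t * s powr n = s powr (n - \<kappa> x)"
        using s by (simp add: t_def powr_add[symmetric])
      have "\<kappa> x * (p x - 1) + lam x = n - \<kappa> x"
        using p_gt1[OF x] by (simp add: \<kappa>_def field_simps)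
      then have 2: "s powr (\<kappa> x * (p x - 1)) * s powr lam x = s powr (n - \<kappa> x)"
        by (simp add: powr_add[symmetric])
      have "t * (\<omega> * s powr n) + D * s powr lam x
          = \<omega> * (t * s powr n) + K powr n * (s powr (\<kappa> x * (p x - 1)) * s powr lam x)"
        by (simp add: D_def)
      then show ?thesis unfolding 1 2 by (simp add: algebra_simps)
    qed
    finally show ?thesis .
  qed
  show ?thesis
  proof (cases "s \<le> R")
    case False
    have "(\<integral>\<^sup>+y\<in>ball x s. ennreal (g y) \<partial>lebesgue) = (\<integral>\<^sup>+y\<in>ball x R. ennreal (g y) \<partial>lebesgue)"
      using g x False by (intro ball_beyond_diam) (auto simp: unit_morrey_def)
    also have "\<dots> \<le> ennreal ((\<omega> + K powr n) * R powr (n - \<kappa> x))" using R by (intro main) auto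
    also have "\<dots> \<le> ennreal ((\<omega> + K powr n) * s powr (n - \<kappa> x))"
      using False R kappa_le[OF x] omega_pos by (intro ennreal_leI mult_left_mono powr_mono2) auto
    finally show ?thesis .
  qed (use main s in auto)
qed

text \<open>The volume \<omega> comes from values below the threshold of the next lemma. The other
  summand pays for freezing \<open>p y\<close> at \<open>x\<close> above it; its base is the
  constant in the crude bound of \<open>A + 1\<close> by a multiple of
  \<open>s powr (- n)\<close>.\<close>

definition avg_const :: real where
  "avg_const = \<omega> + ((\<omega> + 2) * R powr n) powr Q * K powr n"

lemma avg_const_pos: "0 < avg_const"
  unfolding avg_const_def using omega_pos by (simp add: add_pos_nonneg)

text \<open>A Jensen inequality for the exponent \<open>p y / \<sigma>\<close>, frozen at
  \<open>x\<close>. It cannot hold for arbitrary functions; the unit modular makes averages at most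
  polynomially large in \<open>1 / s\<close>, and such quantities raised to
  \<open>\<bar>p x - p y\<bar>\<close> are bounded by log-Hoelder continuity.\<close>

lemma unit_morrey_average:
  assumes g: "unit_morrey g" and x: "x \<in> \<Omega>" and s: "0 < s" and h: "0 \<le> h"
    and M: "\<And>s. 0 < s \<Longrightarrow> (\<integral>\<^sup>+y\<in>ball x s. ennreal (g y powr (p y / \<sigma>)) \<partial>lebesgue) \<le> ennreal (s powr n * h)"
  shows "(\<integral>\<^sup>+y\<in>ball x s. ennreal (g y) \<partial>lebesgue) \<le> ennreal (avg_const * (h + 1) powr (\<sigma> / p x) * s powr n)"
proof -
  have gm [measurable]: "g \<in> borel_measurable lebesgue" "(\<lambda>y. g y powr p y) \<in> borel_measurable lebesgue"
    using g by (auto simp: unit_morrey_def)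
  have "(\<lambda>y. g y powr (p y / \<sigma>)) = (\<lambda>y. (g y powr p y) powr (1 / \<sigma>))"
    by (simp add: powr_powr)
  then have Gm [measurable]: "(\<lambda>y. g y powr (p y / \<sigma>)) \<in> borel_measurable lebesgue"
    by simp
  let ?C1 = "(\<omega> + 2) * R powr n"
  have Rn: "1 \<le> R powr n" using R n_pos by (simp add: ge_one_powr_ge_zero)
  have C1: "1 \<le> ?C1" using mult_mono[of 1 "\<omega> + 2" 1 "R powr n"] Rn omega_pos by simp
  have px: "1 < p x" using p_gt1[OF x] .
  have main: "(\<integral>\<^sup>+y\<in>ball x s. ennreal (g y) \<partial>lebesgue) \<le> ennreal (avg_const * (h + 1) powr (\<sigma> / p x) * s powr n)"
    if s: "0 < s" "s \<le> R" for s
  proof -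
    let ?G = "\<integral>\<^sup>+y\<in>ball x s. ennreal (g y powr (p y / \<sigma>)) \<partial>lebesgue"
    \<comment> \<open>The threshold is built from the actual normalised integral \<open>A\<close>,
      not from its bound \<open>h\<close>: only \<open>A\<close> obeys the polynomial bound in
      \<open>1 / s\<close>. Monotonicity replaces \<open>A\<close> by \<open>h\<close> at the
      end.\<close>
    define A where "A = enn2real ?G / s powr n"
    have "?G < \<infinity>" using M[OF s(1)] by (auto intro: le_less_trans)
    then have G: "?G = ennreal (s powr n * A)" using s by (simp add: A_def)
    have A0: "0 \<le> A" using s by (simp add: A_def)
    have Ah: "A \<le> h" using M[OF s(1)] s h A0 unfolding G by (simp add: ennreal_le_iff)
    have As: "A + 1 \<le> ?C1 * s powr (- n)"
    proof -
      have "?G \<le> (\<integral>\<^sup>+y. 1 * indicator (ball x s) y + ennreal (g y powr p y) * indicator (ball x s) y \<partial>lebesgue)"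
      proof (intro nn_integral_mono)
        fix y
        have "g y powr (p y / \<sigma>) \<le> 1 + g y powr p y"
        proof (cases "g y \<le> 1 \<or> y \<notin> \<Omega>")
          case True
          have "g y powr (p y / \<sigma>) \<le> 1"
            using True g \<sigma> p_gt1[of y] by (cases "y \<in> \<Omega>") (auto simp: unit_morrey_def intro!: powr_le1)
          then show ?thesis by (simp add: add_increasing2)
        next
          case False
          then have "p y / \<sigma> \<le> p y" using p_gt1[of y] \<sigma> by (simp add: field_simps)
          then have "g y powr (p y / \<sigma>) \<le> g y powr p y" using False by (intro powr_mono) auto
          then show ?thesis by simp
        qed
        then have "ennreal (g y powr (p y / \<sigma>)) \<le> 1 + ennreal (g y powr p y)"
          by (metis ennreal_1 ennreal_leI ennreal_plus powr_ge_zero zero_le_one)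
        then show "ennreal (g y powr (p y / \<sigma>)) * indicator (ball x s) y
            \<le> 1 * indicator (ball x s) y + ennreal (g y powr p y) * indicator (ball x s) y"
          by (simp add: indicator_def)
      qed
      also have "\<dots> = emeasure lebesgue (ball x s) + (\<integral>\<^sup>+y\<in>ball x s. ennreal (g y powr p y) \<partial>lebesgue)"
        by (subst nn_integral_add) (simp_all add: borel_measurable_on_ball borel_measurable_indicator)
      also have "\<dots> \<le> ennreal (\<omega> * s powr n) + ennreal (s powr lam x)"
        using g x s unfolding unit_morrey_def
        by (intro add_mono) (auto simp: emeasure_ball_n[simplified])
      also have "\<dots> = ennreal (\<omega> * s powr n + s powr lam x)"
        using s omega_pos by simp
      finally have "s powr n * A \<le> \<omega> * s powr n + s powr lam x"
        unfolding G using s omega_pos by (subst (asm) ennreal_le_iff) auto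
      moreover have "s powr n \<le> R powr n" using s n_pos by (intro powr_mono2) auto
      moreover have "s powr lam x \<le> R powr n"
      proof -
        have "s powr lam x \<le> R powr lam x" using s lam0[OF x] by (intro powr_mono2) auto
        also have "\<dots> \<le> R powr n" using R lam_less[OF x] by (intro powr_mono) auto
        finally show ?thesis .
      qed
      moreover have "\<omega> * s powr n \<le> \<omega> * R powr n"
        using calculation(2) omega_pos by (intro mult_left_mono) auto
      ultimately have "s powr n * (A + 1) \<le> ?C1"
        unfolding distrib_left distrib_right mult_1_right by linarith
      then show ?thesis using s by (simp add: powr_minus field_simps)
    qed
    \<comment> \<open>Adding 1 keeps the base at least 1, so that its powers may be bounded by
      enlarging the exponent to \<open>\<bar>p x - p y\<bar> / p x\<close>.\<close>
    define t where "t = (A + 1) powr (\<sigma> / p x)"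
    define D where "D = t powr (1 - p x / \<sigma>) * (?C1 powr Q * K powr n)"
    have "(\<integral>\<^sup>+y\<in>ball x s. ennreal (g y) \<partial>lebesgue) \<le> ennreal t * emeasure lebesgue (ball x s) + ennreal D * ?G"
    proof (rule nn_integral_split_power)
      fix y assume y: "y \<in> ball x s" "0 < g y"
      then have y': "y \<in> \<Omega>" using g unfolding unit_morrey_def by force
      have nxy: "norm (x - y) \<le> s" using y by (simp add: dist_norm)
      let ?u = "\<bar>p x - p y\<bar> / p x"
      have pxy: "\<bar>p x - p y\<bar> \<le> Q"
        using p_gt1[OF x] p_gt1[OF y'] pQ[OF x] pQ[OF y'] by (simp add: abs_le_iff)
      have "\<bar>p x - p y\<bar> \<le> \<bar>p x - p y\<bar> * p x" using px by (simp add: mult_le_cancel_left1)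
      then have "?u \<le> \<bar>p x - p y\<bar>" using px by (simp add: pos_divide_le_eq)
      then have uQ: "?u \<le> Q" using pxy by linarith
      have sK: "s powr (- \<bar>p x - p y\<bar>) \<le> K"
        using pK[OF x y' nxy] pK[OF y' x] nxy s R by (cases "p x \<ge> p y") (auto simp: norm_minus_commute)
      have "t powr (1 - p y / \<sigma>) = t powr (1 - p x / \<sigma>) * (A + 1) powr ((p x - p y) / p x)"
      proof -
        have "t powr (1 - p y / \<sigma>) = t powr (1 - p x / \<sigma>) * t powr ((p x - p y) / \<sigma>)"
          by (simp add: powr_add[symmetric] diff_divide_distrib)
        also have "t powr ((p x - p y) / \<sigma>) = (A + 1) powr ((p x - p y) / p x)"
          using \<sigma> by (simp add: t_def powr_powr)
        finally show ?thesis .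
      qed
      also have "(A + 1) powr ((p x - p y) / p x) \<le> (A + 1) powr ?u"
        using A0 px by (intro powr_mono divide_right_mono) auto
      also have "(A + 1) powr ?u \<le> (?C1 * s powr (- n)) powr ?u"
        using A0 As px by (intro powr_mono2) auto
      also have "\<dots> = ?C1 powr ?u * s powr (- \<bar>p x - p y\<bar> * (n / p x))"
        using C1 s by (simp add: powr_mult powr_powr mult.commute)
      also have "\<dots> \<le> ?C1 powr Q * K powr n"
      proof (intro mult_mono powr_K_le[OF sK])
        show "?C1 powr ?u \<le> ?C1 powr Q" using C1 uQ by (intro powr_mono) auto
        show "n / p x \<le> n" using px n_pos by (simp add: pos_divide_le_eq mult_le_cancel_left1)
      qed (use px n_pos in auto)
      finally have "t powr (1 - p y / \<sigma>) \<le> D" by (simp add: D_def mult_left_mono)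
      then show "1 \<le> p y / \<sigma> \<and> t powr (1 - p y / \<sigma>) \<le> D" using p\<sigma>[OF y'] \<sigma> by simp
    qed (use A0 in \<open>auto simp: t_def D_def\<close>)
    also have "\<dots> = ennreal (t * (\<omega> * s powr n) + D * (s powr n * A))"
      unfolding G using s omega_pos A0 
      by (simp add: emeasure_ball_n[simplified] t_def D_def ennreal_mult[symmetric] ennreal_plus[symmetric] del: ennreal_plus)
    \<comment> \<open>Above the threshold, \<open>A \<le> t powr (p x / \<sigma>)\<close> cancels
      the factor \<open>t powr (1 - p x / \<sigma>)\<close> in \<open>D\<close> down to
      \<open>t\<close>.\<close>
    also have "t * (\<omega> * s powr n) + D * (s powr n * A) \<le> avg_const * t * s powr n"
    proof -
      have "t powr (1 - p x / \<sigma>) * A \<le> t powr (1 - p x / \<sigma>) * t powr (p x / \<sigma>)"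
        using A0 px \<sigma> by (intro mult_left_mono) (auto simp: t_def powr_powr)
      also have "\<dots> = t" using A0 by (simp add: powr_add[symmetric] t_def)
      finally have "t powr (1 - p x / \<sigma>) * A * (?C1 powr Q * K powr n * s powr n) \<le> t * (?C1 powr Q * K powr n * s powr n)"
        using s by (intro mult_right_mono) auto
      then show ?thesis by (simp add: D_def avg_const_def algebra_simps)
    qed
    also have "avg_const * t * s powr n \<le> avg_const * (h + 1) powr (\<sigma> / p x) * s powr n"
      unfolding t_def using s A0 Ah px \<sigma> avg_const_pos
      by (auto intro!: mult_right_mono mult_left_mono powr_mono2)
    finally show ?thesis by (simp add: ennreal_leI)
  qed
  show ?thesis
  proof (cases "s \<le> R")
    case False
    have "(\<integral>\<^sup>+y\<in>ball x s. ennreal (g y) \<partial>lebesgue) = (\<integral>\<^sup>+y\<in>ball x R. ennreal (g y) \<partial>lebesgue)"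
      using g x False by (intro ball_beyond_diam) (auto simp: unit_morrey_def)
    also have "\<dots> \<le> ennreal (avg_const * (h + 1) powr (\<sigma> / p x) * R powr n)" using R by (intro main) auto
    also have "\<dots> \<le> ennreal (avg_const * (h + 1) powr (\<sigma> / p x) * s powr n)"
      using False R avg_const_pos using n_pos by (intro ennreal_leI mult_left_mono powr_mono2) auto
    finally show ?thesis .
  qed (use main s in auto)
qed

text \<open>Localisation to the ball around \<open>z\<close>. Averages over radii up to
  \<open>r\<close> see only \<open>G\<close> on the doubled ball, where the \<sigma>-th power of
  \<open>G\<close> has integral of order \<open>r powr lam z\<close>. Averages over larger radii are
  bounded outright by the Morrey condition, hence by a constant depending on \<open>z\<close> and
  \<open>r\<close>. The majorant therefore depends on the ball.\<close>

lemma unit_morrey_maximal: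
  obtains C where "0 < C"
    "\<And>g z r. unit_morrey g \<Longrightarrow> z \<in> \<Omega> \<Longrightarrow> 0 < r \<Longrightarrow> r \<le> R \<Longrightarrow>
      \<exists>W\<in>borel_measurable lebesgue.
        (\<integral>\<^sup>+x\<in>ball z r. W x \<partial>lebesgue) \<le> ennreal (C * r powr lam z) \<and>
        (\<forall>x\<in>\<Omega> \<inter> ball z r. W x < \<infinity> \<longrightarrow> (\<forall>s>0. (\<integral>\<^sup>+y\<in>ball x s. ennreal (g y powr (p y / \<sigma>)) \<partial>lebesgue)
           \<le> ennreal (s powr n * enn2real (W x) powr (1 / \<sigma>))))"
proof -
  obtain C0 where C0: "0 < C0" and strong:
    "\<And>F :: 'a \<Rightarrow> real. F \<in> borel_measurable lebesgue \<Longrightarrow> (\<And>y. 0 \<le> F y) \<Longrightarrow>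
      \<exists>W\<in>borel_measurable lebesgue.
        (\<forall>A\<in>sets lebesgue. (\<integral>\<^sup>+x\<in>A. W x \<partial>lebesgue) \<le>
           ennreal C0 * (emeasure lebesgue A + (\<integral>\<^sup>+y. ennreal (F y powr \<sigma>) \<partial>lebesgue))) \<and>
        (\<forall>x s. W x < \<infinity> \<longrightarrow> 0 < s \<longrightarrow> (\<integral>\<^sup>+y\<in>ball x s. ennreal (F y) \<partial>lebesgue) \<le>
           ennreal (s ^ DIM('a) * enn2real (W x) powr (1 / \<sigma>)))"
    by (rule strong_type_maximal[OF \<sigma>, where ?'a = 'a]) (rule that, assumption, blast)
  define c where "c = (\<omega> + 1) powr \<sigma> * K"
  have c: "0 \<le> c" using K by (simp add: c_def)
  define C where "C = C0 * (\<omega> * R powr n + 2 powr n) + c * \<omega>"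
  have C: "0 < C" unfolding C_def using C0 omega_pos c R by (intro add_pos_nonneg mult_pos_pos) auto
  have "\<exists>W\<in>borel_measurable lebesgue.
        (\<integral>\<^sup>+x\<in>ball z r. W x \<partial>lebesgue) \<le> ennreal (C * r powr lam z) \<and>
        (\<forall>x\<in>\<Omega> \<inter> ball z r. W x < \<infinity> \<longrightarrow> (\<forall>s>0. (\<integral>\<^sup>+y\<in>ball x s. ennreal (g y powr (p y / \<sigma>)) \<partial>lebesgue)
           \<le> ennreal (s powr n * enn2real (W x) powr (1 / \<sigma>))))"
    if g: "unit_morrey g" and z: "z \<in> \<Omega>" and r: "0 < r" "r \<le> R" for g z r
  proof -
    have gm [measurable]: "g \<in> borel_measurable lebesgue" "(\<lambda>y. g y powr p y) \<in> borel_measurable lebesgue"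
      using g by (auto simp: unit_morrey_def)
    define G where "G y = g y powr (p y / \<sigma>)" for y
    have "G = (\<lambda>y. (g y powr p y) powr (1 / \<sigma>))"
      by (simp add: powr_powr G_def fun_eq_iff)
    then have Gm [measurable]: "G \<in> borel_measurable lebesgue"
      by simp
    have G\<sigma>: "G y powr \<sigma> = g y powr p y" for y
      using \<sigma> by (simp add: G_def powr_powr)
    define F where "F y = G y * indicator (ball z (2 * r)) y" for y
    have Fm: "F \<in> borel_measurable lebesgue"
      unfolding F_def by (intro borel_measurable_times borel_measurable_indicator Gm) simp
    have F0: "0 \<le> F y" for y by (simp add: F_def G_def)
    obtain W where W [measurable]: "W \<in> borel_measurable lebesgue"
      and WA: "\<And>A. A \<in> sets lebesgue \<Longrightarrow> (\<integral>\<^sup>+x\<in>A. W x \<partial>lebesgue) \<le>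
           ennreal C0 * (emeasure lebesgue A + (\<integral>\<^sup>+y. ennreal (F y powr \<sigma>) \<partial>lebesgue))"
      and Wx: "\<And>x s. W x < \<infinity> \<Longrightarrow> 0 < s \<Longrightarrow> (\<integral>\<^sup>+y\<in>ball x s. ennreal (F y) \<partial>lebesgue) \<le>
           ennreal (s ^ DIM('a) * enn2real (W x) powr (1 / \<sigma>))"
      using strong[OF Fm F0] by blast
    \<comment> \<open>This constant carries the radii above \<open>r\<close>. Its integral over the
      ball is \<open>c * \<omega> * r powr lam z\<close>, of the required order.\<close>
    let ?k = "c * r powr (lam z - n)"
    define V where "V x = W x + ennreal ?k" for x
    have k0: "0 \<le> ?k" using c by simp
    have Vm: "V \<in> borel_measurable lebesgue" unfolding V_def by measurable
    have "(\<integral>\<^sup>+y. ennreal (F y powr \<sigma>) \<partial>lebesgue) = (\<integral>\<^sup>+y\<in>ball z (2 * r). ennreal (g y powr p y) \<partial>lebesgue)"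
      using \<sigma> G\<sigma> by (intro nn_integral_cong) (auto simp: F_def indicator_def)
    also have "\<dots> \<le> ennreal ((2 * r) powr lam z)"
      using g z r by (auto simp: unit_morrey_def)
    also have "\<dots> \<le> ennreal (2 powr n * r powr lam z)"
      using r lam_less[OF z] by (intro ennreal_leI) (auto simp: powr_mult intro!: mult_right_mono powr_mono)
    finally have F\<sigma>: "(\<integral>\<^sup>+y. ennreal (F y powr \<sigma>) \<partial>lebesgue) \<le> ennreal (2 powr n * r powr lam z)" .
    have rn: "r powr n \<le> R powr n * r powr lam z"
      using z r by (rule powr_n_le)
    have "(\<integral>\<^sup>+x\<in>ball z r. V x \<partial>lebesgue) = (\<integral>\<^sup>+x. W x * indicator (ball z r) x + ennreal ?k * indicator (ball z r) x \<partial>lebesgue)"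
      by (simp add: V_def distrib_right)
    also have "\<dots> = (\<integral>\<^sup>+x\<in>ball z r. W x \<partial>lebesgue) + ennreal ?k * emeasure lebesgue (ball z r)"
      by (subst nn_integral_add) (simp_all add: borel_measurable_on_ball nn_integral_cmult_indicator)
    also have "\<dots> \<le> ennreal C0 * (ennreal (\<omega> * r powr n) + ennreal (2 powr n * r powr lam z)) + ennreal ?k * ennreal (\<omega> * r powr n)"
      using WA[of "ball z r"] r F\<sigma> emeasure_ball_n[OF r(1), of z]
      by (intro add_mono mult_left_mono order_trans[OF WA[of "ball z r"]]) auto
    also have "\<dots> = ennreal (C0 * (\<omega> * r powr n + 2 powr n * r powr lam z) + ?k * (\<omega> * r powr n))"
      using C0 k0 omega_pos by (simp add: ennreal_mult[symmetric] ennreal_plus[symmetric] del: ennreal_plus)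
    also have "\<dots> \<le> ennreal (C * r powr lam z)"
    proof (intro ennreal_leI)
      have "r powr (lam z - n) * r powr n = r powr lam z" by (simp add: powr_add[symmetric])
      then have "c * \<omega> * (r powr (lam z - n) * r powr n) = c * \<omega> * r powr lam z" by simp
      then have k: "?k * (\<omega> * r powr n) = c * \<omega> * r powr lam z" by (simp only: mult_ac)
      have "C0 * (\<omega> * r powr n) \<le> C0 * (\<omega> * (R powr n * r powr lam z))"
        using rn C0 omega_pos by (intro mult_left_mono) auto
      then have "C0 * (\<omega> * r powr n + 2 powr n * r powr lam z) + ?k * (\<omega> * r powr n)
          \<le> C0 * (\<omega> * (R powr n * r powr lam z)) + C0 * (2 powr n * r powr lam z) + c * \<omega> * r powr lam z"
        unfolding k distrib_left by linarith
      also have "\<dots> = C * r powr lam z" by (simp add: C_def algebra_simps)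
      finally show "C0 * (\<omega> * r powr n + 2 powr n * r powr lam z) + ?k * (\<omega> * r powr n) \<le> C * r powr lam z" .
    qed
    finally have int: "(\<integral>\<^sup>+x\<in>ball z r. V x \<partial>lebesgue) \<le> ennreal (C * r powr lam z)" .
    have "(\<integral>\<^sup>+y\<in>ball x s. ennreal (G y) \<partial>lebesgue) \<le> ennreal (s powr n * enn2real (V x) powr (1 / \<sigma>))"
      if x: "x \<in> \<Omega>" "x \<in> ball z r" and fin: "V x < \<infinity>" and s: "0 < s" for x s
    proof -
      have Wfin: "W x < \<infinity>" using fin by (auto simp: V_def)
      have Vreal: "enn2real (V x) = enn2real (W x) + ?k"
        using Wfin k0 by (simp add: V_def enn2real_plus)
      show ?thesis
      proof (cases "s \<le> r")
        case True
        have "(\<integral>\<^sup>+y\<in>ball x s. ennreal (G y) \<partial>lebesgue) = (\<integral>\<^sup>+y\<in>ball x s. ennreal (F y) \<partial>lebesgue)"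
        proof (intro nn_integral_cong)
          fix y
          have "dist z y < 2 * r" if "dist x y < s"
            using dist_triangle[of z y x] that x True by simp
          then show "ennreal (G y) * indicator (ball x s) y = ennreal (F y) * indicator (ball x s) y"
            by (auto simp: F_def indicator_def)
        qed
        also have "\<dots> \<le> ennreal (s powr n * enn2real (W x) powr (1 / \<sigma>))"
          using Wx[OF Wfin s] s by (simp add: powr_n)
        also have "\<dots> \<le> ennreal (s powr n * enn2real (V x) powr (1 / \<sigma>))"
          unfolding Vreal using k0 \<sigma> by (intro ennreal_leI mult_left_mono powr_mono2) auto
        finally show ?thesis .
      next
        case False
        \<comment> \<open>Here \<open>t * s powr n\<close> and
          \<open>t powr (1 - \<sigma>) * s powr lam x\<close> coincide. As \<open>lam x < n\<close>,
          \<open>t\<close> only grows when \<open>s\<close> is lowered to \<open>r\<close>, after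
          which \<open>lam x\<close> is exchanged for \<open>lam z\<close> at the cost of
          \<open>K\<close>.\<close>
        define t where "t = s powr ((lam x - n) / \<sigma>)"
        have t: "0 < t" using s by (simp add: t_def)
        have "(\<integral>\<^sup>+y\<in>ball x s. ennreal (G y) \<partial>lebesgue) \<le> ennreal t * emeasure lebesgue (ball x s) +
            ennreal (t powr (1 - \<sigma>)) * (\<integral>\<^sup>+y\<in>ball x s. ennreal (G y powr \<sigma>) \<partial>lebesgue)"
          using t \<sigma> by (intro nn_integral_split_power) (simp_all add: G\<sigma>)
        also have "\<dots> \<le> ennreal t * ennreal (\<omega> * s powr n) + ennreal (t powr (1 - \<sigma>)) * ennreal (s powr lam x)"
          using g x s emeasure_ball_n[OF s, of x] by (intro add_mono mult_left_mono) (auto simp: unit_morrey_def G\<sigma>)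
        also have "\<dots> = ennreal (t * (\<omega> * s powr n) + t powr (1 - \<sigma>) * s powr lam x)"
          using t omega_pos by (simp add: ennreal_mult[symmetric] ennreal_plus[symmetric] del: ennreal_plus)
        also have "\<dots> \<le> ennreal (s powr n * enn2real (V x) powr (1 / \<sigma>))"
        proof (intro ennreal_leI)
          have "t powr (1 - \<sigma>) * s powr lam x = t * s powr n"
          proof -
            have "t powr (1 - \<sigma>) = t * t powr (- \<sigma>)" using t by (simp add: powr_add[symmetric] powr_mult_base)
            also have "t powr (- \<sigma>) = s powr (n - lam x)"
              using \<sigma> by (simp add: t_def powr_powr)
            also have "t * s powr (n - lam x) * s powr lam x = t * s powr n"
              by (simp add: powr_add[symmetric] mult.assoc)
            finally show ?thesis by simp
          qed
          then have "t * (\<omega> * s powr n) + t powr (1 - \<sigma>) * s powr lam x = s powr n * ((\<omega> + 1) * t)"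
            by (simp add: algebra_simps)
          also have "\<dots> \<le> s powr n * ?k powr (1 / \<sigma>)"
          proof (intro mult_left_mono)
            have rz: "r powr (lam x - lam z) \<le> K"
              using lamK[OF z x(1), of r] x r R by (simp add: dist_norm)
            have "t \<le> r powr ((lam x - n) / \<sigma>)"
              unfolding t_def using False r \<sigma> lam_less[OF x(1)] by (intro powr_mono2') (auto simp: field_simps)
            also have "\<dots> = (r powr (lam x - lam z) * r powr (lam z - n)) powr (1 / \<sigma>)"
              by (simp add: powr_powr powr_add[symmetric])
            also have "\<dots> \<le> (K * r powr (lam z - n)) powr (1 / \<sigma>)"
              using rz \<sigma> by (intro powr_mono2 mult_right_mono) auto
            finally have "(\<omega> + 1) * t \<le> (\<omega> + 1) * (K * r powr (lam z - n)) powr (1 / \<sigma>)"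
              using omega_pos by (intro mult_left_mono) auto
            also have "\<dots> = ?k powr (1 / \<sigma>)"
              using omega_pos \<sigma> K by (simp add: c_def powr_mult powr_powr)
            finally show "(\<omega> + 1) * t \<le> ?k powr (1 / \<sigma>)" .
          qed simp
          also have "\<dots> \<le> s powr n * enn2real (V x) powr (1 / \<sigma>)"
            unfolding Vreal using k0 \<sigma> by (intro mult_left_mono powr_mono2) auto
          finally show "t * (\<omega> * s powr n) + t powr (1 - \<sigma>) * s powr lam x \<le> s powr n * enn2real (V x) powr (1 / \<sigma>)" .
        qed
        finally show ?thesis .
      qed
    qed
    then show ?thesis
      using Vm int unfolding G_def by (intro bexI[of _ V]) auto
  qed
  then show ?thesis using that[OF C] by blast
qed

text \<open>At distance at least \<open>r\<close> from \<open>x0\<close> the weight is at most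
  \<open>K * r powr (lam z - n)\<close>. Closer to \<open>x0\<close> its exponent is frozen at
  \<open>x0\<close>, and \<open>lam x0 > 0\<close> makes it integrable there.\<close>

lemma power_weight_morrey:
  assumes x0: "x0 \<in> \<Omega>" and lp: "0 < lam x0"
  obtains C where "0 < C"
    "\<And>z r. z \<in> \<Omega> \<Longrightarrow> 0 < r \<Longrightarrow> r \<le> R \<Longrightarrow>
      (\<integral>\<^sup>+x\<in>\<Omega> \<inter> ball z r. ennreal (norm (x - x0) powr (lam x - n)) \<partial>lebesgue) \<le> ennreal (C * r powr lam z)"
proof -
  define c where "c = 2 powr \<bar>lam x0 - n\<bar> / (1 - 2 powr (- lam x0)) * \<omega>"
  have "2 powr (- lam x0) < 1" using lp powr_less_mono[of "- lam x0" 0 "2::real"] by simp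
  then have c: "0 \<le> c" using omega_pos by (simp add: c_def)
  define C where "C = K * \<omega> + K * c * (K * 2 powr n)"
  have C: "0 < C" unfolding C_def using K omega_pos c by (intro add_pos_nonneg mult_pos_pos) auto
  have "(\<integral>\<^sup>+x\<in>\<Omega> \<inter> ball z r. ennreal (norm (x - x0) powr (lam x - n)) \<partial>lebesgue) \<le> ennreal (C * r powr lam z)"
    if z: "z \<in> \<Omega>" and r: "0 < r" "r \<le> R" for z r
  proof -
    \<comment> \<open>If \<open>norm (z - x0) \<ge> 2 * r\<close>, no point of the ball lies within
      \<open>r\<close> of \<open>x0\<close> and the singular term is switched off. Only in the other
      case are \<open>z\<close> and \<open>x0\<close> close enough to compare
      \<open>r powr lam x0\<close> with \<open>r powr lam z\<close>.\<close>
    define D where "D = (if norm (z - x0) < 2 * r then K else 0)"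
    have D: "0 \<le> D" "D \<le> K" using K by (auto simp: D_def)
    let ?v = "\<lambda>x. ennreal (norm (x0 - x) powr (lam x0 - n)) * indicator (ball x0 r) x"
    have vm: "?v \<in> borel_measurable lebesgue"
      by (intro borel_measurable_on_ball measurable_compose[OF borel_measurable_norm_powr measurable_ennreal])
    have pt: "ennreal (norm (x - x0) powr (lam x - n)) * indicator (\<Omega> \<inter> ball z r) x
        \<le> ennreal (K * r powr (lam z - n)) * indicator (ball z r) x + ennreal D * ?v x" for x
    proof (cases "x \<in> \<Omega> \<inter> ball z r")
      case True
      then have x: "x \<in> \<Omega>" "norm (z - x) < r" by (auto simp: dist_norm)
      show ?thesis
      proof (cases "r \<le> norm (x - x0)")
        case far: True
        have "norm (x - x0) powr (lam x - n) \<le> r powr (lam x - n)"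
          using far r lam_less[OF x(1)] by (intro powr_mono2') auto
        also have "\<dots> = r powr (lam x - lam z) * r powr (lam z - n)"
          by (simp add: powr_add[symmetric])
        also have "\<dots> \<le> K * r powr (lam z - n)"
          using lamK[OF z x(1), of r] x r R by (intro mult_right_mono) auto
        finally show ?thesis using True
          by (auto intro!: add_increasing2 ennreal_leI)
      next
        case near: False
        show ?thesis
        proof (cases "x = x0")
          case False
          then have nx: "0 < norm (x - x0)" by simp
          have "norm (z - x0) < 2 * r"
            using near x norm_triangle_ineq[of "z - x" "x - x0"] by simp
          then have DK: "D = K" by (simp add: D_def)
          have "norm (x - x0) powr (lam x - n) = norm (x - x0) powr (lam x - lam x0) * norm (x - x0) powr (lam x0 - n)"
            by (simp add: powr_add[symmetric])
          also have "\<dots> \<le> K * norm (x - x0) powr (lam x0 - n)"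
            using lamK[OF x0 x(1), of "norm (x - x0)"] nx near r R
            by (intro mult_right_mono) (auto simp: norm_minus_commute)
          finally have "ennreal (norm (x - x0) powr (lam x - n)) \<le> ennreal D * ?v x"
            using near K by (auto simp: DK dist_norm norm_minus_commute ennreal_mult[symmetric] intro!: ennreal_leI)
          then show ?thesis using True by (auto intro!: add_increasing)
        qed simp
      qed
    qed simp
    \<comment> \<open>The dyadic bound applied to the constant function 1: ball volumes grow like
      \<open>s powr n\<close>, and the total exponent is \<open>lam x0\<close>.\<close>
    have inner: "(\<integral>\<^sup>+x. ?v x \<partial>lebesgue) \<le> ennreal (c * r powr lam x0)"
    proof -
      have "(\<integral>\<^sup>+x\<in>ball x0 r. 1 * ennreal (norm (x0 - x) powr (lam x0 - n)) \<partial>lebesgue)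
          \<le> ennreal (2 powr \<bar>lam x0 - n\<bar> / (1 - 2 powr (- lam x0)) * \<omega> * r powr (lam x0 - n + n))"
        using emeasure_ball_n omega_pos r lp
        by (intro nn_integral_riesz_inner) (simp_all add: less_imp_le)
      then show ?thesis by (simp add: c_def)
    qed
    have Dr: "D * (c * r powr lam x0) \<le> K * c * (K * 2 powr n) * r powr lam z"
    proof (cases "norm (z - x0) < 2 * r")
      case True
      have "(2 * r) powr (lam x0 - lam z) \<le> K"
        using lamK[OF z x0, of "2 * r"] True r by simp
      then have "2 powr (lam x0 - lam z) * r powr (lam x0 - lam z) \<le> K" using r by (simp add: powr_mult)
      then have "2 powr (lam z - lam x0) * (2 powr (lam x0 - lam z) * r powr (lam x0 - lam z)) \<le> 2 powr (lam z - lam x0) * K"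
        by (intro mult_left_mono) auto
      then have "r powr (lam x0 - lam z) \<le> 2 powr (lam z - lam x0) * K"
        by (simp add: mult.assoc[symmetric] powr_add[symmetric])
      also have "\<dots> \<le> 2 powr n * K"
        using K lam_less[OF z] lam0[OF x0] by (intro mult_right_mono powr_mono) auto
      finally have "r powr (lam x0 - lam z) * r powr lam z \<le> (2 powr n * K) * r powr lam z"
        by (intro mult_right_mono) auto
      then have "r powr lam x0 \<le> (2 powr n * K) * r powr lam z" by (simp add: powr_add[symmetric])
      then have "K * c * r powr lam x0 \<le> K * c * ((2 powr n * K) * r powr lam z)"
        using K c by (intro mult_left_mono) auto
      then show ?thesis using True by (simp add: D_def mult_ac)
    qed (use K c in \<open>simp add: D_def\<close>)
    have "(\<integral>\<^sup>+x\<in>\<Omega> \<inter> ball z r. ennreal (norm (x - x0) powr (lam x - n)) \<partial>lebesgue)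
        \<le> (\<integral>\<^sup>+x. ennreal (K * r powr (lam z - n)) * indicator (ball z r) x + ennreal D * ?v x \<partial>lebesgue)"
      by (intro nn_integral_mono pt)
    also have "\<dots> = (\<integral>\<^sup>+x. ennreal (K * r powr (lam z - n)) * indicator (ball z r) x \<partial>lebesgue) + (\<integral>\<^sup>+x. ennreal D * ?v x \<partial>lebesgue)"
      by (intro nn_integral_add borel_measurable_on_ball borel_measurable_times_ennreal vm measurable_const) auto
    also have "\<dots> = ennreal (K * r powr (lam z - n)) * emeasure lebesgue (ball z r) + ennreal D * (\<integral>\<^sup>+x. ?v x \<partial>lebesgue)"
      by (intro arg_cong2[where f = plus] nn_integral_cmult_indicator nn_integral_cmult vm) simp
    also have "\<dots> \<le> ennreal (K * r powr (lam z - n)) * ennreal (\<omega> * r powr n) + ennreal D * ennreal (c * r powr lam x0)"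
      by (intro add_mono mult_left_mono inner) (simp_all only: emeasure_ball_n[OF r(1)] order_refl zero_le)
    also have "\<dots> = ennreal (K * r powr (lam z - n) * (\<omega> * r powr n) + D * (c * r powr lam x0))"
      using K omega_pos D c by (simp add: ennreal_mult[symmetric] ennreal_plus[symmetric] del: ennreal_plus)
    also have "\<dots> \<le> ennreal (C * r powr lam z)"
    proof (intro ennreal_leI)
      have "r powr (lam z - n) * r powr n = r powr lam z" by (simp add: powr_add[symmetric])
      then have "K * \<omega> * (r powr (lam z - n) * r powr n) = K * \<omega> * r powr lam z" by simp
      then have "K * r powr (lam z - n) * (\<omega> * r powr n) = K * \<omega> * r powr lam z" by (simp only: mult_ac)
      then show "K * r powr (lam z - n) * (\<omega> * r powr n) + D * (c * r powr lam x0) \<le> C * r powr lam z"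
        using Dr unfolding C_def distrib_right by linarith
    qed
    finally show ?thesis .
  qed
  then show ?thesis using that[OF C] by blast
qed

end

section \<open>The weighted fractional integral\<close>

text \<open>The bounds on \<open>a\<close> and \<open>b\<close> are kept only in the form they take
  at \<open>x0\<close>, the centre of the shells whose sums they control.\<close>

locale weighted_riesz = morrey_setting +
  fixes q :: "'a \<Rightarrow> real" and x0 :: 'a and \<gamma> a b :: real
  assumes x0: "x0 \<in> \<Omega>" and lam_x0: "0 < lam x0"
    and qK: "\<And>x y r. x \<in> \<Omega> \<Longrightarrow> y \<in> \<Omega> \<Longrightarrow> norm (x - y) \<le> r \<Longrightarrow> 0 < r \<Longrightarrow> r \<le> 2 * R \<Longrightarrow> r powr (q y - q x) \<le> K"
    and pq: "\<And>x. x \<in> \<Omega> \<Longrightarrow> p x \<le> q x" and qQ: "\<And>x. x \<in> \<Omega> \<Longrightarrow> q x \<le> Q"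
    and \<gamma>: "0 < \<gamma>" "\<gamma> < n" and ab: "a \<le> b" "b - a \<le> \<gamma>"
    and a_gt: "(lam x0 - n) / q x0 < a" and b_le: "b \<le> n * (1 - 1 / p x0)"
    and sobolev: "\<And>x. x \<in> \<Omega> \<Longrightarrow> (\<gamma> + a - b) / (n - lam x) = 1 / p x - 1 / q x"
begin

definition \<alpha> :: real where "\<alpha> = \<gamma> + a - b"

definition \<kappa>q :: "'a \<Rightarrow> real" where "\<kappa>q x = (n - lam x) / q x"

section \<open>Exponent relations drawn from the Sobolev condition\<close>

lemma q_gt1: "x \<in> \<Omega> \<Longrightarrow> 1 < q x" using p_gt1[of x] pq[of x] by simp

lemma alpha_eq: "x \<in> \<Omega> \<Longrightarrow> \<alpha> = \<kappa> x - \<kappa>q x"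
proof -
  assume x: "x \<in> \<Omega>"
  have "\<alpha> = (1 / p x - 1 / q x) * (n - lam x)"
    unfolding \<alpha>_def sobolev[OF x, symmetric] using lam_less[OF x] by simp
  then show ?thesis by (simp add: \<kappa>_def \<kappa>q_def left_diff_distrib)
qed

lemma kappaq_pos: "x \<in> \<Omega> \<Longrightarrow> 0 < \<kappa>q x"
  using q_gt1[of x] lam_less[of x] by (simp add: \<kappa>q_def)

lemma kappaq_le: "x \<in> \<Omega> \<Longrightarrow> \<kappa>q x \<le> n"
proof -
  assume x: "x \<in> \<Omega>"
  have "0 \<le> \<alpha>" using ab by (simp add: \<alpha>_def)
  then show ?thesis using alpha_eq[OF x] kappa_le[OF x] by simp
qed

text \<open>A lower bound independent of \<open>x\<close>: it makes the geometric series in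
  Hedberg's outer integral uniform.\<close>

lemma kappaq_ge: "x \<in> \<Omega> \<Longrightarrow> (n - L) / Q \<le> \<kappa>q x"
proof -
  assume x: "x \<in> \<Omega>"
  have "(n - L) / Q \<le> (n - L) / q x"
    using L qQ[OF x] q_gt1[OF x] by (intro divide_left_mono) auto
  also have "\<dots> \<le> \<kappa>q x"
    unfolding \<kappa>q_def using lamL[OF x] q_gt1[OF x] by (intro divide_right_mono) auto
  finally show ?thesis .
qed

text \<open>These are the Hardy-type integrals left over when \<open>norm (x - y)\<close> is
  comparable to the larger of the distances of \<open>x\<close> and \<open>y\<close> to
  \<open>x0\<close>. Both come from the dyadic lemmas centred at \<open>x0\<close>, with mass growth
  \<open>n - \<kappa> x0\<close>.\<close>

lemma hardy_part:
  obtains C where "0 \<le> C"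
    "\<And>g \<rho>. unit_morrey g \<Longrightarrow> 0 < \<rho> \<Longrightarrow>
      (\<integral>\<^sup>+y\<in>ball x0 \<rho>. ennreal (g y) * ennreal (norm (x0 - y) powr (- b)) \<partial>lebesgue) \<le> ennreal (C * \<rho> powr (n - \<kappa> x0 - b)) \<and>
      (\<integral>\<^sup>+y\<in>- ball x0 \<rho>. ennreal (g y) * ennreal (norm (x0 - y) powr (\<gamma> - n - b)) \<partial>lebesgue) \<le> ennreal (C * \<rho> powr (\<gamma> - \<kappa> x0 - b))"
proof -
  let ?A = "\<omega> + K powr n"
  \<comment> \<open>The two entries are the margins of the inner and the outer series, secured by
    the bounds on \<open>b\<close> and on \<open>a\<close> respectively.\<close>
  define \<epsilon> where "\<epsilon> = min (lam x0 / p x0) (a + \<kappa>q x0)"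
  have "0 < a + \<kappa>q x0" using a_gt by (simp add: \<kappa>q_def diff_divide_distrib)
  then have \<epsilon>0: "0 < \<epsilon>" using lam_x0 p_gt1[OF x0] by (simp add: \<epsilon>_def)
  have \<epsilon>1: "\<epsilon> \<le> - b + (n - \<kappa> x0)"
  proof -
    have "lam x0 / p x0 \<le> - b + (n - \<kappa> x0)"
      using b_le p_gt1[OF x0] by (simp add: \<kappa>_def field_simps)
    then show ?thesis by (simp add: \<epsilon>_def)
  qed
  have \<epsilon>2: "(\<gamma> - n - b) + (n - \<kappa> x0) \<le> - \<epsilon>"
    using alpha_eq[OF x0] by (simp add: \<epsilon>_def \<alpha>_def min_def)
  have pw: "2 powr (- \<epsilon>) < 1" using \<epsilon>0 powr_less_mono[of "- \<epsilon>" 0 "2::real"] by simp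
  define c where "c e = 2 powr \<bar>e\<bar> / (1 - 2 powr (- \<epsilon>)) * ?A" for e
  have c: "0 \<le> c e" for e using pw omega_pos by (simp add: c_def)
  define C where "C = max (c (- b)) (c (\<gamma> - n - b))"
  have C: "0 \<le> C" "c (- b) \<le> C" "c (\<gamma> - n - b) \<le> C" using c by (auto simp: C_def le_max_iff_disj)
  have "(\<integral>\<^sup>+y\<in>ball x0 \<rho>. ennreal (g y) * ennreal (norm (x0 - y) powr (- b)) \<partial>lebesgue) \<le> ennreal (C * \<rho> powr (n - \<kappa> x0 - b)) \<and>
      (\<integral>\<^sup>+y\<in>- ball x0 \<rho>. ennreal (g y) * ennreal (norm (x0 - y) powr (\<gamma> - n - b)) \<partial>lebesgue) \<le> ennreal (C * \<rho> powr (\<gamma> - \<kappa> x0 - b))"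
    if g: "unit_morrey g" and \<rho>: "0 < \<rho>" for g \<rho>
  proof -
    have gm: "(\<lambda>y. ennreal (g y)) \<in> borel_measurable lebesgue" using g by (auto simp: unit_morrey_def)
    have A: "0 \<le> ?A" using omega_pos by simp
    have "(\<integral>\<^sup>+y\<in>ball x0 \<rho>. ennreal (g y) * ennreal (norm (x0 - y) powr (- b)) \<partial>lebesgue) \<le> ennreal (c (- b) * \<rho> powr (- b + (n - \<kappa> x0)))"
      unfolding c_def by (intro nn_integral_riesz_inner gm A \<rho> \<epsilon>0 \<epsilon>1 unit_morrey_ball g x0)
    also have "\<dots> \<le> ennreal (C * \<rho> powr (- b + (n - \<kappa> x0)))"
      using C by (intro ennreal_leI mult_right_mono) auto
    finally have 1: "(\<integral>\<^sup>+y\<in>ball x0 \<rho>. ennreal (g y) * ennreal (norm (x0 - y) powr (- b)) \<partial>lebesgue) \<le> ennreal (C * \<rho> powr (n - \<kappa> x0 - b))"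
      by (simp add: algebra_simps)
    have "(\<integral>\<^sup>+y\<in>- ball x0 \<rho>. ennreal (g y) * ennreal (norm (x0 - y) powr (\<gamma> - n - b)) \<partial>lebesgue)
        \<le> ennreal (c (\<gamma> - n - b) * \<rho> powr ((\<gamma> - n - b) + (n - \<kappa> x0)))"
      unfolding c_def using \<rho> by (intro nn_integral_riesz_outer gm A \<rho> \<epsilon>0 \<epsilon>2 unit_morrey_ball g x0) auto
    also have "\<dots> \<le> ennreal (C * \<rho> powr ((\<gamma> - n - b) + (n - \<kappa> x0)))"
      using C by (intro ennreal_leI mult_right_mono) auto
    finally have 2: "(\<integral>\<^sup>+y\<in>- ball x0 \<rho>. ennreal (g y) * ennreal (norm (x0 - y) powr (\<gamma> - n - b)) \<partial>lebesgue) \<le> ennreal (C * \<rho> powr (\<gamma> - \<kappa> x0 - b))"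
      by (simp add: algebra_simps)
    from 1 2 show ?thesis ..
  qed
  then show ?thesis using that[OF C(1)] by blast
qed

text \<open>Inside the ball, \<open>norm (x - y) powr (b - a) \<le> \<rho> powr (b - a)\<close>
  lowers the order of the kernel from \<gamma> to \<alpha>. For positive \<alpha> Hedberg's
  splitting gives a bound without truncation. For \<alpha> = 0 that kernel would not be integrable,
  so the order \<gamma> = \<open>b - a\<close> is kept and the truncation itself yields the power of
  \<rho>.\<close>

lemma near_part:
  obtains C where "0 \<le> C"
    "\<And>g x h \<rho>. unit_morrey g \<Longrightarrow> x \<in> \<Omega> \<Longrightarrow> 0 < \<rho> \<Longrightarrow> 0 \<le> h \<Longrightarrow>
      (\<And>s. 0 < s \<Longrightarrow> (\<integral>\<^sup>+y\<in>ball x s. ennreal (g y powr (p y / \<sigma>)) \<partial>lebesgue) \<le> ennreal (s powr n * h)) \<Longrightarrow>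
      (\<integral>\<^sup>+y\<in>ball x \<rho>. ennreal (g y) * ennreal (norm (x - y) powr (\<gamma> - n)) \<partial>lebesgue)
        \<le> ennreal (C * \<rho> powr (b - a) * (h + 1) powr (\<sigma> / q x))"
proof (cases "\<alpha> = 0")
  case True
  let ?C = "2 powr \<bar>\<gamma> - n\<bar> / (1 - 2 powr (- \<gamma>)) * avg_const"
  have pw: "2 powr (- \<gamma>) < 1" using \<gamma> powr_less_mono[of "- \<gamma>" 0 "2::real"] by simp
  show ?thesis
  proof (rule that[of ?C])
    show "0 \<le> ?C" using pw avg_const_pos by simp
    fix g x h \<rho>
    assume g: "unit_morrey g" and x: "x \<in> \<Omega>" and \<rho>: "0 < (\<rho>::real)" and h: "0 \<le> (h::real)"
      and M: "\<And>s. 0 < s \<Longrightarrow> (\<integral>\<^sup>+y\<in>ball x s. ennreal (g y powr (p y / \<sigma>)) \<partial>lebesgue) \<le> ennreal (s powr n * h)"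
    \<comment> \<open>For \<alpha> = 0 the Sobolev relation forces equal exponents.\<close>
    have qp: "q x = p x"
      using sobolev[OF x] True by (simp add: \<alpha>_def)
    have \<gamma>': "\<gamma> = b - a" using True by (simp add: \<alpha>_def)
    have gm: "(\<lambda>y. ennreal (g y)) \<in> borel_measurable lebesgue" using g by (auto simp: unit_morrey_def)
    have "(\<integral>\<^sup>+y\<in>ball x \<rho>. ennreal (g y) * ennreal (norm (x - y) powr (\<gamma> - n)) \<partial>lebesgue)
        \<le> ennreal (2 powr \<bar>\<gamma> - n\<bar> / (1 - 2 powr (- \<gamma>)) * (avg_const * (h + 1) powr (\<sigma> / p x)) * \<rho> powr (\<gamma> - n + n))"
      using avg_const_pos \<gamma> by (intro nn_integral_riesz_inner gm \<rho> unit_morrey_average g x h M) auto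
    then show "(\<integral>\<^sup>+y\<in>ball x \<rho>. ennreal (g y) * ennreal (norm (x - y) powr (\<gamma> - n)) \<partial>lebesgue)
        \<le> ennreal (?C * \<rho> powr (b - a) * (h + 1) powr (\<sigma> / q x))"
      by (simp add: qp \<gamma>' mult_ac)
  qed
next
  case False
  then have \<alpha>: "0 < \<alpha>" using ab by (simp add: \<alpha>_def)
  let ?e = "\<alpha> - n" and ?A = "\<omega> + K powr n"
  define \<epsilon> where "\<epsilon> = (n - L) / Q"
  have Q: "0 < Q" using p_gt1[OF x0] pQ[OF x0] by simp
  then have \<epsilon>: "0 < \<epsilon>" using L by (simp add: \<epsilon>_def)
  have pw: "2 powr (- \<epsilon>) < 1" "2 powr (- \<alpha>) < 1"
    using \<epsilon> \<alpha> powr_less_mono[of "- \<epsilon>" 0 "2::real"] powr_less_mono[of "- \<alpha>" 0 "2::real"] by simp_all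
  let ?c1 = "2 powr \<bar>?e\<bar> / (1 - 2 powr (- \<alpha>)) * avg_const"
  let ?c2 = "2 powr \<bar>?e\<bar> / (1 - 2 powr (- \<epsilon>)) * ?A"
  have c: "0 \<le> ?c1" "0 \<le> ?c2" using pw avg_const_pos omega_pos by auto
  show ?thesis
  proof (rule that[of "?c1 + ?c2"])
    show "0 \<le> ?c1 + ?c2" using c by (rule add_nonneg_nonneg)
    fix g x h \<rho>
    assume g: "unit_morrey g" and x: "x \<in> \<Omega>" and \<rho>: "0 < (\<rho>::real)" and h: "0 \<le> (h::real)"
      and M: "\<And>s. 0 < s \<Longrightarrow> (\<integral>\<^sup>+y\<in>ball x s. ennreal (g y powr (p y / \<sigma>)) \<partial>lebesgue) \<le> ennreal (s powr n * h)"
    have gm [measurable]: "(\<lambda>y. ennreal (g y)) \<in> borel_measurable lebesgue" using g by (auto simp: unit_morrey_def)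
    have nm: "(\<lambda>y. ennreal (norm (x - y) powr ?e)) \<in> borel_measurable lebesgue"
      by (rule measurable_compose[OF borel_measurable_norm_powr measurable_ennreal])
    \<comment> \<open>Hedberg's choice of \<open>\<delta>\<close> balances the maximal bound below \<open>\<delta>\<close> against the Morrey bound above it.\<close>
    define m where "m = (h + 1) powr (\<sigma> / p x)"
    define \<delta> where "\<delta> = m powr (- 1 / \<kappa> x)"
    have m: "0 < m" using h by (simp add: m_def)
    have \<delta>: "0 < \<delta>" using m by (simp add: \<delta>_def)
    have \<kappa>: "0 < \<kappa> x" using kappa_pos[OF x] .
    \<comment> \<open>This is where the Sobolev relation acts: it turns the exponent
      \<open>\<sigma> / p x\<close> of \<open>m\<close> into \<open>\<sigma> / q x\<close>, for the
      inner and the outer part alike.\<close>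
    have ratio: "1 - \<alpha> / \<kappa> x = p x / q x"
    proof -
      have "1 - \<alpha> / \<kappa> x = \<kappa>q x / \<kappa> x" using \<kappa> alpha_eq[OF x] by (simp add: field_simps)
      then show ?thesis using lam_less[OF x] p_gt1[OF x] by (simp add: \<kappa>_def \<kappa>q_def)
    qed
    have e1: "m * \<delta> powr \<alpha> = (h + 1) powr (\<sigma> / q x)"
    proof -
      have "m * \<delta> powr \<alpha> = m powr 1 * m powr (- (\<alpha> / \<kappa> x))"
        using m by (simp add: \<delta>_def powr_powr)
      also have "\<dots> = m powr (1 - \<alpha> / \<kappa> x)"
        unfolding powr_add[symmetric] by simp
      finally show ?thesis unfolding ratio using p_gt1[OF x] by (simp add: m_def powr_powr)
    qed
    have e2: "\<delta> powr (\<alpha> - \<kappa> x) = (h + 1) powr (\<sigma> / q x)"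
    proof -
      have "- 1 / \<kappa> x * (\<alpha> - \<kappa> x) = 1 - \<alpha> / \<kappa> x"
        using \<kappa> by (simp add: field_simps)
      then have "\<delta> powr (\<alpha> - \<kappa> x) = m powr (1 - \<alpha> / \<kappa> x)"
        by (simp only: \<delta>_def powr_powr)
      then show ?thesis unfolding ratio using p_gt1[OF x] by (simp add: m_def powr_powr)
    qed
    have "(\<integral>\<^sup>+y\<in>ball x \<delta>. ennreal (g y) * ennreal (norm (x - y) powr ?e) \<partial>lebesgue)
        \<le> ennreal (2 powr \<bar>?e\<bar> / (1 - 2 powr (- \<alpha>)) * (avg_const * m) * \<delta> powr (?e + n))"
      unfolding m_def using avg_const_pos \<alpha> by (intro nn_integral_riesz_inner gm \<delta> unit_morrey_average g x h M) auto
    also have "\<dots> = ennreal (?c1 * (m * \<delta> powr \<alpha>))" by (simp add: mult_ac)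
    finally have i1: "(\<integral>\<^sup>+y\<in>ball x \<delta>. ennreal (g y) * ennreal (norm (x - y) powr ?e) \<partial>lebesgue)
        \<le> ennreal (?c1 * (h + 1) powr (\<sigma> / q x))" by (simp only: e1)
    have "(\<integral>\<^sup>+y\<in>- ball x \<delta>. ennreal (g y) * ennreal (norm (x - y) powr ?e) \<partial>lebesgue)
        \<le> ennreal (2 powr \<bar>?e\<bar> / (1 - 2 powr (- \<epsilon>)) * ?A * \<delta> powr (?e + (n - \<kappa> x)))"
      using omega_pos \<epsilon> kappaq_ge[OF x] alpha_eq[OF x] \<delta> unfolding \<epsilon>_def[symmetric]
      by (intro nn_integral_riesz_outer gm unit_morrey_ball g x) auto
    also have "\<dots> = ennreal (?c2 * \<delta> powr (\<alpha> - \<kappa> x))" by simp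
    finally have i2: "(\<integral>\<^sup>+y\<in>- ball x \<delta>. ennreal (g y) * ennreal (norm (x - y) powr ?e) \<partial>lebesgue)
        \<le> ennreal (?c2 * (h + 1) powr (\<sigma> / q x))" by (simp only: e2)
    have nn: "0 \<le> ?c1 * (h + 1) powr (\<sigma> / q x)" "0 \<le> ?c2 * (h + 1) powr (\<sigma> / q x)"
      by (rule mult_nonneg_nonneg, rule c, rule powr_ge_zero)+
    let ?w = "\<lambda>y. ennreal (g y) * ennreal (norm (x - y) powr ?e)"
    have wm: "?w \<in> borel_measurable lebesgue" by (intro borel_measurable_times_ennreal gm nm)
    have wm': "(\<lambda>y. ?w y * indicator (- ball x \<delta>) y) \<in> borel_measurable lebesgue"
      by (intro borel_measurable_times_ennreal[OF wm] borel_measurable_indicator) simp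
    have pt: "ennreal (g y) * ennreal (norm (x - y) powr (\<gamma> - n)) * indicator (ball x \<rho>) y
        \<le> ennreal (\<rho> powr (b - a)) * (?w y * indicator (ball x \<delta>) y + ?w y * indicator (- ball x \<delta>) y)" for y
    proof (cases "y \<in> ball x \<rho> \<and> y \<noteq> x")
      case True
      then have d: "0 < norm (x - y)" "norm (x - y) < \<rho>" by (auto simp: dist_norm)
      have "norm (x - y) powr (\<gamma> - n) = norm (x - y) powr (b - a) * norm (x - y) powr ?e"
        by (simp add: powr_add[symmetric] \<alpha>_def)
      also have "\<dots> \<le> \<rho> powr (b - a) * norm (x - y) powr ?e"
        using d ab by (intro mult_right_mono powr_mono2) auto
      finally have "ennreal (norm (x - y) powr (\<gamma> - n)) \<le> ennreal (\<rho> powr (b - a)) * ennreal (norm (x - y) powr ?e)"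
        by (simp add: ennreal_mult[symmetric] ennreal_leI)
      then have "ennreal (g y) * ennreal (norm (x - y) powr (\<gamma> - n)) \<le> ennreal (\<rho> powr (b - a)) * ?w y"
        by (metis mult.left_commute mult_left_mono zero_le)
      then show ?thesis using True by (auto simp: indicator_def)
    qed (auto simp: indicator_def)
    have "(\<integral>\<^sup>+y\<in>ball x \<rho>. ennreal (g y) * ennreal (norm (x - y) powr (\<gamma> - n)) \<partial>lebesgue)
        \<le> (\<integral>\<^sup>+y. ennreal (\<rho> powr (b - a)) * (?w y * indicator (ball x \<delta>) y + ?w y * indicator (- ball x \<delta>) y) \<partial>lebesgue)"
      by (intro nn_integral_mono pt)
    also have "\<dots> = ennreal (\<rho> powr (b - a)) * (\<integral>\<^sup>+y. ?w y * indicator (ball x \<delta>) y + ?w y * indicator (- ball x \<delta>) y \<partial>lebesgue)"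
      by (intro nn_integral_cmult borel_measurable_add borel_measurable_on_ball wm wm')
    also have "\<dots> = ennreal (\<rho> powr (b - a)) * ((\<integral>\<^sup>+y\<in>ball x \<delta>. ?w y \<partial>lebesgue) + (\<integral>\<^sup>+y\<in>- ball x \<delta>. ?w y \<partial>lebesgue))"
      by (subst nn_integral_add) (intro borel_measurable_on_ball wm wm' refl)+
    also have "\<dots> \<le> ennreal (\<rho> powr (b - a)) * (ennreal (?c1 * (h + 1) powr (\<sigma> / q x)) + ennreal (?c2 * (h + 1) powr (\<sigma> / q x)))"
      by (intro mult_left_mono add_mono i1 i2) simp
    also have "\<dots> = ennreal (\<rho> powr (b - a) * (?c1 * (h + 1) powr (\<sigma> / q x) + ?c2 * (h + 1) powr (\<sigma> / q x)))"
      by (simp only: ennreal_plus[OF nn, symmetric] ennreal_mult[OF powr_ge_zero add_nonneg_nonneg[OF nn], symmetric])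
    also have "\<rho> powr (b - a) * (?c1 * (h + 1) powr (\<sigma> / q x) + ?c2 * (h + 1) powr (\<sigma> / q x))
        = (?c1 + ?c2) * \<rho> powr (b - a) * (h + 1) powr (\<sigma> / q x)"
      by (simp add: algebra_simps)
    finally show "(\<integral>\<^sup>+y\<in>ball x \<rho>. ennreal (g y) * ennreal (norm (x - y) powr (\<gamma> - n)) \<partial>lebesgue)
        \<le> ennreal ((?c1 + ?c2) * \<rho> powr (b - a) * (h + 1) powr (\<sigma> / q x))" .
  qed
qed

text \<open>With \<rho> the distance from \<open>x\<close> to \<open>x0\<close>, the integral is
  divided according to whether \<open>norm (x0 - y)\<close> is below \<open>\<rho> / 2\<close>,
  above \<open>2 * \<rho>\<close>, or in between. In the outer ranges the kernel is comparable to a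
  power of \<rho> or of \<open>norm (x0 - y)\<close>; in the middle range the weight is comparable
  to a power of \<rho>. The witness \<open>j\<close> records finiteness and allows real
  arithmetic.\<close>

lemma riesz_pointwise:
  obtains C where "1 \<le> C"
    "\<And>f g x h. unit_morrey g \<Longrightarrow> (\<And>y. g y = norm (y - x0) powr b * \<bar>f y\<bar>) \<Longrightarrow> x \<in> \<Omega> \<Longrightarrow> x \<noteq> x0 \<Longrightarrow> 0 \<le> h \<Longrightarrow>
      (\<And>s. 0 < s \<Longrightarrow> (\<integral>\<^sup>+y\<in>ball x s. ennreal (g y powr (p y / \<sigma>)) \<partial>lebesgue) \<le> ennreal (s powr n * h)) \<Longrightarrow>
      \<exists>j\<ge>0. (\<integral>\<^sup>+y. ennreal (\<bar>f y\<bar> * norm (x - y) powr (\<gamma> - n)) \<partial>lebesgue) \<le> ennreal j \<and>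
        (norm (x - x0) powr a * j) powr q x \<le> C * ((h + 1) powr \<sigma> + norm (x - x0) powr (lam x - n))"
proof -
  obtain C1 where C1: "0 \<le> C1"
    and hardy: "\<And>g \<rho>. unit_morrey g \<Longrightarrow> 0 < \<rho> \<Longrightarrow>
      (\<integral>\<^sup>+y\<in>ball x0 \<rho>. ennreal (g y) * ennreal (norm (x0 - y) powr (- b)) \<partial>lebesgue) \<le> ennreal (C1 * \<rho> powr (n - \<kappa> x0 - b)) \<and>
      (\<integral>\<^sup>+y\<in>- ball x0 \<rho>. ennreal (g y) * ennreal (norm (x0 - y) powr (\<gamma> - n - b)) \<partial>lebesgue) \<le> ennreal (C1 * \<rho> powr (\<gamma> - \<kappa> x0 - b))"
    by (rule hardy_part) (rule that, assumption, blast)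
  obtain C2 where C2: "0 \<le> C2"
    and near: "\<And>g x h \<rho>. unit_morrey g \<Longrightarrow> x \<in> \<Omega> \<Longrightarrow> 0 < \<rho> \<Longrightarrow> 0 \<le> h \<Longrightarrow>
      (\<And>s. 0 < s \<Longrightarrow> (\<integral>\<^sup>+y\<in>ball x s. ennreal (g y powr (p y / \<sigma>)) \<partial>lebesgue) \<le> ennreal (s powr n * h)) \<Longrightarrow>
      (\<integral>\<^sup>+y\<in>ball x \<rho>. ennreal (g y) * ennreal (norm (x - y) powr (\<gamma> - n)) \<partial>lebesgue)
        \<le> ennreal (C2 * \<rho> powr (b - a) * (h + 1) powr (\<sigma> / q x))"
    by (rule near_part) (rule that, assumption, blast)
  define c1 where "c1 = 2 powr (n - \<gamma>)"
  define c2 where "c2 = 2 powr \<bar>b\<bar>"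
  define D where "D = max 1 (max (2 * c1 * C1) (c2 * C2 * 4 powr (b - a)))"
  have D: "1 \<le> D" "2 * c1 * C1 \<le> D" "c2 * C2 * 4 powr (b - a) \<le> D" by (auto simp: D_def)
  define C where "C = (2 * D) powr Q * (K powr n * K)"
  have Q: "0 < Q" using p_gt1[OF x0] pQ[OF x0] by simp
  have KK: "1 \<le> K powr n * K"
    using mult_mono[of 1 "K powr n" 1 K] K n_pos by (simp add: ge_one_powr_ge_zero)
  have DQ: "1 \<le> (2 * D) powr Q" using D Q by (intro ge_one_powr_ge_zero) auto
  have C: "1 \<le> C" unfolding C_def using mult_mono[OF DQ KK] KK by simp
  show ?thesis
  proof (rule that[OF C])
    fix f g :: "'a \<Rightarrow> real" and x h
    assume g: "unit_morrey g" and gf: "\<And>y. g y = norm (y - x0) powr b * \<bar>f y\<bar>"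
      and x: "x \<in> \<Omega>" "x \<noteq> x0" and h: "0 \<le> h"
      and M: "\<And>s. 0 < s \<Longrightarrow> (\<integral>\<^sup>+y\<in>ball x s. ennreal (g y powr (p y / \<sigma>)) \<partial>lebesgue) \<le> ennreal (s powr n * h)"
    have gm: "(\<lambda>y. ennreal (g y)) \<in> borel_measurable lebesgue" using g by (auto simp: unit_morrey_def)
    have nm: "(\<lambda>y. ennreal (norm (z - y) powr e)) \<in> borel_measurable lebesgue" for z :: 'a and e
      by (rule measurable_compose[OF borel_measurable_norm_powr measurable_ennreal])
    define \<rho> where "\<rho> = norm (x - x0)"
    have \<rho>: "0 < \<rho>" "\<rho> < R" using x diam[OF x(1) x0] by (auto simp: \<rho>_def)
    define V where "V = (h + 1) powr (\<sigma> / q x)"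
    \<comment> \<open>The supports are larger than the three ranges, which does no harm. In the
      middle range \<open>norm (x - y) \<le> 3 * \<rho>\<close>, hence the ball of radius
      \<open>4 * \<rho>\<close>.\<close>
    define w1 where "w1 y = ennreal (g y) * ennreal (norm (x0 - y) powr (- b)) * indicator (ball x0 \<rho>) y" for y
    define w2 where "w2 y = ennreal (g y) * ennreal (norm (x0 - y) powr (\<gamma> - n - b)) * indicator (- ball x0 \<rho>) y" for y
    define w3 where "w3 y = ennreal (g y) * ennreal (norm (x - y) powr (\<gamma> - n)) * indicator (ball x (4 * \<rho>)) y" for y
    have wm: "w1 \<in> borel_measurable lebesgue" "w2 \<in> borel_measurable lebesgue" "w3 \<in> borel_measurable lebesgue"
      unfolding w1_def w2_def w3_def
      by (intro borel_measurable_times_ennreal gm nm borel_measurable_indicator; simp)+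
    let ?k1 = "c1 * \<rho> powr (\<gamma> - n)" and ?k3 = "c2 * \<rho> powr (- b)"
    \<comment> \<open>Recovering \<open>f\<close> from \<open>g\<close> divides by a power of
      \<open>norm (y - x0)\<close>, so the null set consisting of \<open>x0\<close> is left
      out.\<close>
    have pt: "ennreal (\<bar>f y\<bar> * norm (x - y) powr (\<gamma> - n)) \<le> ennreal ?k1 * w1 y + ennreal c1 * w2 y + ennreal ?k3 * w3 y"
      if y: "y \<noteq> x0" for y
    proof -
      let ?d = "norm (x0 - y)"
      have d: "0 < ?d" using y by simp
      have f: "\<bar>f y\<bar> = g y * ?d powr (- b)"
        using d y by (simp add: gf powr_minus norm_minus_commute)
      have g0: "0 \<le> g y" using g by (simp add: unit_morrey_def)
      have tri: "\<rho> - ?d \<le> norm (x - y)" "?d - \<rho> \<le> norm (x - y)" "norm (x - y) \<le> \<rho> + ?d"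
        using norm_triangle_ineq[of "x - y" "y - x0"] norm_triangle_ineq[of "x0 - x" "x - y"]
          norm_triangle_ineq[of "x - x0" "x0 - y"] by (simp_all add: \<rho>_def norm_minus_commute)
      consider "?d < \<rho> / 2" | "2 * \<rho> < ?d" | "\<rho> / 2 \<le> ?d" "?d \<le> 2 * \<rho>" by linarith
      then show ?thesis
      proof cases
        case 1
        have "norm (x - y) powr (\<gamma> - n) \<le> (\<rho> / 2) powr (\<gamma> - n)"
          using 1 tri \<rho> \<gamma> by (intro powr_mono2') auto
        also have "\<dots> = ?k1"
          using \<rho> by (simp add: c1_def powr_divide powr_diff field_simps)
        finally have "g y * ?d powr (- b) * norm (x - y) powr (\<gamma> - n) \<le> g y * ?d powr (- b) * ?k1"
          using g0 by (intro mult_left_mono) auto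
        then have "ennreal (\<bar>f y\<bar> * norm (x - y) powr (\<gamma> - n)) \<le> ennreal (?k1 * (g y * ?d powr (- b)))"
          unfolding f by (intro ennreal_leI) (simp add: mult_ac)
        also have "\<dots> = ennreal ?k1 * w1 y"
          using 1 \<rho> g0 by (simp add: w1_def dist_norm ennreal_mult c1_def)
        finally show ?thesis by (simp add: add_increasing2 add.assoc)
      next
        case 2
        have "norm (x - y) powr (\<gamma> - n) \<le> (?d / 2) powr (\<gamma> - n)"
          using 2 tri \<rho> \<gamma> by (intro powr_mono2') auto
        also have "\<dots> = c1 * ?d powr (\<gamma> - n)"
          using \<rho> by (simp add: c1_def powr_divide powr_diff field_simps)
        finally have "g y * ?d powr (- b) * norm (x - y) powr (\<gamma> - n) \<le> g y * ?d powr (- b) * (c1 * ?d powr (\<gamma> - n))"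
          using g0 by (intro mult_left_mono) auto
        also have "\<dots> = c1 * (g y * (?d powr (- b) * ?d powr (\<gamma> - n)))" by (simp add: mult_ac)
        also have "?d powr (- b) * ?d powr (\<gamma> - n) = ?d powr (\<gamma> - n - b)"
          by (simp add: powr_add[symmetric])
        finally have "ennreal (\<bar>f y\<bar> * norm (x - y) powr (\<gamma> - n)) \<le> ennreal (c1 * (g y * ?d powr (\<gamma> - n - b)))"
          unfolding f by (intro ennreal_leI)
        also have "\<dots> = ennreal c1 * w2 y"
          using 2 \<rho> g0 by (simp add: w2_def dist_norm ennreal_mult c1_def)
        finally show ?thesis by (simp add: add_increasing2 add_increasing add.assoc)
      next
        case 3
        have "?d powr (- b) \<le> ?k3"
        proof (cases "0 \<le> b")
          case True
          have "?d powr (- b) \<le> (\<rho> / 2) powr (- b)" using 3 \<rho> True by (intro powr_mono2') auto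
          also have "\<dots> = ?k3" using \<rho> True by (simp add: c2_def powr_divide powr_minus field_simps)
          finally show ?thesis .
        next
          case False
          have "?d powr (- b) \<le> (2 * \<rho>) powr (- b)" using 3 \<rho> False by (intro powr_mono2) auto
          also have "\<dots> = ?k3" using \<rho> False by (simp add: c2_def powr_mult)
          finally show ?thesis .
        qed
        then have "g y * norm (x - y) powr (\<gamma> - n) * ?d powr (- b) \<le> g y * norm (x - y) powr (\<gamma> - n) * ?k3"
          using g0 by (intro mult_left_mono) auto
        then have "ennreal (\<bar>f y\<bar> * norm (x - y) powr (\<gamma> - n)) \<le> ennreal (?k3 * (g y * norm (x - y) powr (\<gamma> - n)))"
          unfolding f by (intro ennreal_leI) (simp add: mult_ac)
        also have "\<dots> = ennreal ?k3 * w3 y"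
          using 3 tri \<rho> g0 by (simp add: w3_def dist_norm ennreal_mult c2_def)
        finally show ?thesis by (simp add: add_increasing)
      qed
    qed
    define j where "j = ?k1 * (C1 * \<rho> powr (n - \<kappa> x0 - b)) + c1 * (C1 * \<rho> powr (\<gamma> - \<kappa> x0 - b)) + ?k3 * (C2 * (4 * \<rho>) powr (b - a) * V)"
    have j0: "0 \<le> j" using C1 C2 by (simp add: j_def c1_def c2_def V_def)
    have "(\<integral>\<^sup>+y. ennreal (\<bar>f y\<bar> * norm (x - y) powr (\<gamma> - n)) \<partial>lebesgue)
        \<le> (\<integral>\<^sup>+y. ennreal ?k1 * w1 y + ennreal c1 * w2 y + ennreal ?k3 * w3 y \<partial>lebesgue)"
      using AE_lebesgue_neq[of x0] by (intro nn_integral_mono_AE) (auto elim!: eventually_mono intro: pt)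
    also have "\<dots> = ennreal ?k1 * (\<integral>\<^sup>+y. w1 y \<partial>lebesgue) + ennreal c1 * (\<integral>\<^sup>+y. w2 y \<partial>lebesgue) + ennreal ?k3 * (\<integral>\<^sup>+y. w3 y \<partial>lebesgue)"
      using wm by (simp add: nn_integral_add nn_integral_cmult)
    also have "\<dots> \<le> ennreal ?k1 * ennreal (C1 * \<rho> powr (n - \<kappa> x0 - b)) + ennreal c1 * ennreal (C1 * \<rho> powr (\<gamma> - \<kappa> x0 - b))
        + ennreal ?k3 * ennreal (C2 * (4 * \<rho>) powr (b - a) * V)"
      unfolding w1_def w2_def w3_def V_def using hardy[OF g \<rho>(1)] \<rho>
      by (intro add_mono mult_left_mono near g x h M) auto
    also have "\<dots> = ennreal j"
      using C1 C2 by (simp add: j_def c1_def c2_def V_def ennreal_mult[symmetric] ennreal_plus[symmetric] del: ennreal_plus)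
    finally have int: "(\<integral>\<^sup>+y. ennreal (\<bar>f y\<bar> * norm (x - y) powr (\<gamma> - n)) \<partial>lebesgue) \<le> ennreal j" .
    let ?u = "\<rho> powr (- \<kappa>q x0)"
    \<comment> \<open>Multiplication by \<open>\<rho> powr a\<close> gives both Hardy terms the
      exponent \<open>- \<kappa>q x0\<close>, through \<alpha> =
      \<open>\<kappa> x0 - \<kappa>q x0\<close>, and cancels every power of \<rho> in the middle
      term.\<close>
    have "\<rho> powr a * j = 2 * c1 * C1 * ?u + c2 * C2 * 4 powr (b - a) * V"
    proof -
      have ex: "a + (\<gamma> - n) + (n - \<kappa> x0 - b) = - \<kappa>q x0" "a + (\<gamma> - \<kappa> x0 - b) = - \<kappa>q x0"
        using alpha_eq[OF x0] by (auto simp: \<alpha>_def)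
      have "\<rho> powr a * \<rho> powr (\<gamma> - n) * \<rho> powr (n - \<kappa> x0 - b) = ?u"
        unfolding powr_add[symmetric] ex ..
      moreover have "\<rho> powr a * \<rho> powr (\<gamma> - \<kappa> x0 - b) = ?u"
        unfolding powr_add[symmetric] ex ..
      moreover have "\<rho> powr a * \<rho> powr (- b) * \<rho> powr (b - a) = 1"
        unfolding powr_add[symmetric] using \<rho> by simp
      moreover have "\<rho> powr a * j = c1 * C1 * (\<rho> powr a * \<rho> powr (\<gamma> - n) * \<rho> powr (n - \<kappa> x0 - b))
          + c1 * C1 * (\<rho> powr a * \<rho> powr (\<gamma> - \<kappa> x0 - b)) + c2 * C2 * 4 powr (b - a) * V * (\<rho> powr a * \<rho> powr (- b) * \<rho> powr (b - a))"
        using \<rho> by (simp add: j_def powr_mult algebra_simps)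
      ultimately show ?thesis by simp
    qed
    also have "\<dots> \<le> D * ?u + D * V"
      using D by (intro add_mono mult_right_mono) (auto simp: V_def)
    also have "\<dots> \<le> 2 * D * max ?u V"
    proof -
      have "?u + V \<le> 2 * max ?u V" by linarith
      then have "D * (?u + V) \<le> D * (2 * max ?u V)" using D by (intro mult_left_mono) auto
      then show ?thesis by (simp add: distrib_left mult.left_commute mult.assoc)
    qed
    finally have "(\<rho> powr a * j) powr q x \<le> (2 * D * max ?u V) powr q x"
      using j0 q_gt1[OF x(1)] by (intro powr_mono2) auto
    also have "\<dots> = (2 * D) powr q x * (max ?u V) powr q x"
      using D by (simp add: powr_mult V_def le_max_iff_disj)
    also have "\<dots> \<le> (2 * D) powr Q * (K powr n * K * ((h + 1) powr \<sigma> + \<rho> powr (lam x - n)))"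
    proof (intro mult_mono)
      show "(2 * D) powr q x \<le> (2 * D) powr Q" using D qQ[OF x(1)] by (intro powr_mono) auto
      have V: "V powr q x = (h + 1) powr \<sigma>" using q_gt1[OF x(1)] by (simp add: V_def powr_powr)
      have n1: "norm (x - x0) \<le> \<rho>" "norm (x0 - x) \<le> \<rho>" "\<rho> \<le> 2 * R"
        using \<rho> R by (auto simp: \<rho>_def norm_minus_commute)
      have "\<kappa>q x0 * q x0 = n - lam x0" using q_gt1[OF x0] by (simp add: \<kappa>q_def)
      \<comment> \<open>The two differences cost at most \<open>K powr n\<close> and
        \<open>K\<close> by log-Hoelder continuity, as \<open>\<kappa>q x0 \<le> n\<close>. What
        remains is the weight whose Morrey bound is known.\<close>
      then have "- \<kappa>q x0 * q x = (q x0 - q x) * \<kappa>q x0 + (lam x0 - lam x) + (lam x - n)"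
        by (simp add: algebra_simps)
      then have "?u powr q x = \<rho> powr ((q x0 - q x) * \<kappa>q x0) * \<rho> powr (lam x0 - lam x) * \<rho> powr (lam x - n)"
        by (simp only: powr_powr powr_add)
      also have "\<dots> \<le> K powr n * K * \<rho> powr (lam x - n)"
        using K qK[OF x(1) x0 n1(1) \<rho>(1) n1(3)] lamK[OF x(1) x0 n1(1) \<rho>(1) n1(3)] kappaq_pos[OF x0] kappaq_le[OF x0]
        by (intro mult_mono powr_K_le) auto
      finally have u: "?u powr q x \<le> K powr n * K * \<rho> powr (lam x - n)" .
      have v: "V powr q x \<le> K powr n * K * (h + 1) powr \<sigma>"
        unfolding V using KK by (simp add: mult_le_cancel_right1)
      have u0: "0 \<le> K powr n * K * \<rho> powr (lam x - n)" "0 \<le> K powr n * K * (h + 1) powr \<sigma>" using K by auto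
      have "(max ?u V) powr q x \<le> max (?u powr q x) (V powr q x)" by (auto simp: max_def)
      also have "\<dots> \<le> K powr n * K * ((h + 1) powr \<sigma> + \<rho> powr (lam x - n))"
        unfolding distrib_left using u v u0 by linarith
      finally show "(max ?u V) powr q x \<le> K powr n * K * ((h + 1) powr \<sigma> + \<rho> powr (lam x - n))" .
    qed auto
    also have "\<dots> = C * ((h + 1) powr \<sigma> + \<rho> powr (lam x - n))" by (simp add: C_def mult_ac)
    finally show "\<exists>j\<ge>0. (\<integral>\<^sup>+y. ennreal (\<bar>f y\<bar> * norm (x - y) powr (\<gamma> - n)) \<partial>lebesgue) \<le> ennreal j \<and>
        (norm (x - x0) powr a * j) powr q x \<le> C * ((h + 1) powr \<sigma> + norm (x - x0) powr (lam x - n))"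
      using j0 int unfolding \<rho>_def by blast
  qed
qed

text \<open>The pointwise bound is integrated with \<open>h = W powr (1 / \<sigma>)\<close>, for the
  majorant \<open>W\<close> belonging to the ball in question. Since the \<sigma>-th power of
  \<open>h + 1\<close> is at most \<open>2 powr \<sigma> * (W + 1)\<close>, three terms arise:
  \<open>W\<close>, a constant, and the power weight, each of order
  \<open>r powr lam z\<close>.\<close>

lemma riesz_morrey:
  assumes lam_meas: "lam \<in> borel_measurable (lebesgue_on \<Omega>)"
  obtains C where "1 \<le> C"
    "\<And>f g. unit_morrey g \<Longrightarrow> (\<And>y. g y = norm (y - x0) powr b * \<bar>f y\<bar>) \<Longrightarrow>
      (AE x in lebesgue. x \<in> \<Omega> \<longrightarrow> (\<integral>\<^sup>+y. ennreal (\<bar>f y\<bar> * norm (x - y) powr (\<gamma> - n)) \<partial>lebesgue) < \<infinity>) \<and>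
      (\<forall>z\<in>\<Omega>. \<forall>r>0. (\<integral>\<^sup>+x\<in>\<Omega> \<inter> ball z r. ennreal ((norm (x - x0) powr a *
          enn2real (\<integral>\<^sup>+y. ennreal (\<bar>f y\<bar> * norm (x - y) powr (\<gamma> - n)) \<partial>lebesgue)) powr q x) \<partial>lebesgue)
        \<le> ennreal (C * r powr lam z))"
proof -
  obtain C1 where C1: "1 \<le> C1"
    and pointwise: "\<And>f g x h. unit_morrey g \<Longrightarrow> (\<And>y. g y = norm (y - x0) powr b * \<bar>f y\<bar>) \<Longrightarrow> x \<in> \<Omega> \<Longrightarrow> x \<noteq> x0 \<Longrightarrow> 0 \<le> h \<Longrightarrow>
      (\<And>s. 0 < s \<Longrightarrow> (\<integral>\<^sup>+y\<in>ball x s. ennreal (g y powr (p y / \<sigma>)) \<partial>lebesgue) \<le> ennreal (s powr n * h)) \<Longrightarrow>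
      \<exists>j\<ge>0. (\<integral>\<^sup>+y. ennreal (\<bar>f y\<bar> * norm (x - y) powr (\<gamma> - n)) \<partial>lebesgue) \<le> ennreal j \<and>
        (norm (x - x0) powr a * j) powr q x \<le> C1 * ((h + 1) powr \<sigma> + norm (x - x0) powr (lam x - n))"
    by (rule riesz_pointwise) (rule that, assumption, blast)
  obtain C2 where C2: "0 < C2"
    and maximal: "\<And>g z r. unit_morrey g \<Longrightarrow> z \<in> \<Omega> \<Longrightarrow> 0 < r \<Longrightarrow> r \<le> R \<Longrightarrow>
      \<exists>W\<in>borel_measurable lebesgue.
        (\<integral>\<^sup>+x\<in>ball z r. W x \<partial>lebesgue) \<le> ennreal (C2 * r powr lam z) \<and>
        (\<forall>x\<in>\<Omega> \<inter> ball z r. W x < \<infinity> \<longrightarrow> (\<forall>s>0. (\<integral>\<^sup>+y\<in>ball x s. ennreal (g y powr (p y / \<sigma>)) \<partial>lebesgue)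
           \<le> ennreal (s powr n * enn2real (W x) powr (1 / \<sigma>))))"
    by (rule unit_morrey_maximal) (rule that, assumption, blast)
  obtain C3 where C3: "0 < C3"
    and weight: "\<And>z r. z \<in> \<Omega> \<Longrightarrow> 0 < r \<Longrightarrow> r \<le> R \<Longrightarrow>
      (\<integral>\<^sup>+x\<in>\<Omega> \<inter> ball z r. ennreal (norm (x - x0) powr (lam x - n)) \<partial>lebesgue) \<le> ennreal (C3 * r powr lam z)"
    by (rule power_weight_morrey[OF x0 lam_x0]) (rule that, assumption, blast)
  define C where "C = max 1 (C1 * (2 powr \<sigma> * (C2 + \<omega> * R powr n) + C3))"
  have "1 \<le> C" by (simp add: C_def)
  then show ?thesis
  proof (rule that)
    fix f g :: "'a \<Rightarrow> real"
    assume g: "unit_morrey g" and gf: "\<And>y. g y = norm (y - x0) powr b * \<bar>f y\<bar>"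
    define J where "J x = (\<integral>\<^sup>+y. ennreal (\<bar>f y\<bar> * norm (x - y) powr (\<gamma> - n)) \<partial>lebesgue)" for x
    define T where "T x = (norm (x - x0) powr a * enn2real (J x)) powr q x" for x
    define w where "w x = ennreal (norm (x - x0) powr (lam x - n))" for x
    have key: "J x < \<infinity> \<and> T x \<le> C1 * (2 powr \<sigma> * (enn2real (W x) + 1) + norm (x - x0) powr (lam x - n))"
      if x: "x \<in> \<Omega>" "x \<noteq> x0" and
        M: "\<And>s. 0 < s \<Longrightarrow> (\<integral>\<^sup>+y\<in>ball x s. ennreal (g y powr (p y / \<sigma>)) \<partial>lebesgue)
           \<le> ennreal (s powr n * enn2real (W x) powr (1 / \<sigma>))" for x and W :: "'a \<Rightarrow> ennreal"
    proof -
      let ?h = "enn2real (W x) powr (1 / \<sigma>)"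
      obtain j where j: "0 \<le> j" "J x \<le> ennreal j"
        "(norm (x - x0) powr a * j) powr q x \<le> C1 * ((?h + 1) powr \<sigma> + norm (x - x0) powr (lam x - n))"
        using pointwise[OF g gf x, of ?h] M unfolding J_def by auto
      have fin: "J x < \<infinity>" using j(2) by (auto intro: le_less_trans)
      have "enn2real (J x) \<le> j" using j by (simp add: enn2real_leI)
      then have "T x \<le> (norm (x - x0) powr a * j) powr q x"
        unfolding T_def using q_gt1[OF x(1)] by (intro powr_mono2 mult_left_mono) auto
      moreover have "(?h + 1) powr \<sigma> \<le> 2 powr \<sigma> * (enn2real (W x) + 1)"
      proof -
        have h\<sigma>: "?h powr \<sigma> = enn2real (W x)" using \<sigma> by (simp add: powr_powr)
        have "(?h + 1) powr \<sigma> \<le> (2 * max ?h 1) powr \<sigma>" using \<sigma> by (intro powr_mono2) auto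
        also have "\<dots> = 2 powr \<sigma> * (max ?h 1) powr \<sigma>" by (simp add: powr_mult le_max_iff_disj)
        also have "\<dots> \<le> 2 powr \<sigma> * (enn2real (W x) + 1)"
          using h\<sigma> by (intro mult_left_mono) (auto simp: max_def)
        finally show ?thesis .
      qed
      ultimately have "T x \<le> C1 * (2 powr \<sigma> * (enn2real (W x) + 1) + norm (x - x0) powr (lam x - n))"
        using j(3) C1 by (meson add_right_mono mult_left_mono order_trans zero_le_one)
      with fin show ?thesis ..
    qed
    have small: "(\<integral>\<^sup>+x\<in>\<Omega> \<inter> ball z r. ennreal (T x) \<partial>lebesgue) \<le> ennreal (C * r powr lam z)"
      if z: "z \<in> \<Omega>" and r: "0 < r" "r \<le> R" for z r
    proof -
      obtain W where W: "W \<in> borel_measurable lebesgue"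
        and WI: "(\<integral>\<^sup>+x\<in>ball z r. W x \<partial>lebesgue) \<le> ennreal (C2 * r powr lam z)"
        and WM: "\<And>x s. x \<in> \<Omega> \<Longrightarrow> x \<in> ball z r \<Longrightarrow> W x < \<infinity> \<Longrightarrow> 0 < s \<Longrightarrow> (\<integral>\<^sup>+y\<in>ball x s. ennreal (g y powr (p y / \<sigma>)) \<partial>lebesgue)
           \<le> ennreal (s powr n * enn2real (W x) powr (1 / \<sigma>))"
        using maximal[OF g z r] by blast
      let ?S = "\<Omega> \<inter> ball z r"
      have pt: "ennreal (T x) * indicator ?S x \<le> ennreal C1 * (ennreal (2 powr \<sigma>) *
          (W x * indicator (ball z r) x + 1 * indicator (ball z r) x) + w x * indicator ?S x)" for x
      proof (cases "x \<in> ?S")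
        case True
        show ?thesis
        \<comment> \<open>Both exceptional cases are harmless: \<open>T x0 = 0\<close> because
          \<open>0 powr a = 0\<close>, and where \<open>W\<close> is infinite so is the
          majorant.\<close>
        proof (cases "x = x0 \<or> W x = \<infinity>")
          case True
          then show ?thesis
          proof
            assume "x = x0"
            then show ?thesis by (simp add: T_def)
          next
            assume "W x = \<infinity>"
            then show ?thesis using \<open>x \<in> ?S\<close> C1 by (simp add: ennreal_mult_top ennreal_mult_eq_top_iff)
          qed
        next
          case False
          then have fin: "W x < \<infinity>" by (simp add: less_top)
          then have Wx: "W x = ennreal (enn2real (W x))" by simp
          have "T x \<le> C1 * (2 powr \<sigma> * (enn2real (W x) + 1) + norm (x - x0) powr (lam x - n))"
            using key[of x W] True False WM[of x] fin by auto
          then have "ennreal (T x) \<le> ennreal (C1 * (2 powr \<sigma> * (enn2real (W x) + 1) + norm (x - x0) powr (lam x - n)))"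
            by (rule ennreal_leI)
          also have "\<dots> = ennreal C1 * (ennreal (2 powr \<sigma>) * (ennreal (enn2real (W x)) + 1) + w x)"
            using C1 by (simp add: ennreal_mult w_def)
          finally show ?thesis using True by (simp add: Wx[symmetric])
        qed
      qed simp
      have rn: "r powr n \<le> R powr n * r powr lam z"
        using z r by (rule powr_n_le)
      \<comment> \<open>\<open>lam\<close> is measurable only on \<Omega>; the extension by zero
        gives a weight measurable on the whole space that agrees with \<open>w\<close> on
        \<open>?S\<close>.\<close>
      have lm: "(\<lambda>x. lam x * indicator \<Omega> x) \<in> borel_measurable lebesgue"
        using lam_meas Omega by (simp add: borel_measurable_restrict_space_iff mult.commute)
      have "(\<lambda>x. ennreal (norm (x - x0) powr (lam x * indicator \<Omega> x - n)) * indicator ?S x) \<in> borel_measurable lebesgue"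
      proof (intro borel_measurable_times_ennreal measurable_compose[OF _ measurable_ennreal] borel_measurable_indicator)
        have "(\<lambda>x. norm (x - x0)) \<in> borel_measurable lebesgue"
          by (rule measurable_completion) simp
        with lm show "(\<lambda>x. norm (x - x0) powr (lam x * indicator \<Omega> x - n)) \<in> borel_measurable lebesgue"
          by measurable
        show "?S \<in> sets lebesgue" by (intro sets.Int Omega) simp
      qed
      moreover have "ennreal (norm (x - x0) powr (lam x * indicator \<Omega> x - n)) * indicator ?S x = w x * indicator ?S x" for x
        by (simp add: w_def indicator_def)
      ultimately have wm: "(\<lambda>x. w x * indicator ?S x) \<in> borel_measurable lebesgue" by simp
      have bm: "(\<lambda>x. W x * indicator (ball z r) x) \<in> borel_measurable lebesgue"
        "(\<lambda>x. 1 * indicator (ball z r) x :: ennreal) \<in> borel_measurable lebesgue"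
        by (intro borel_measurable_on_ball W measurable_const)+ simp
      have bm': "(\<lambda>x. W x * indicator (ball z r) x + 1 * indicator (ball z r) x) \<in> borel_measurable lebesgue"
        by (intro borel_measurable_add bm)
      have bm'': "(\<lambda>x. ennreal (2 powr \<sigma>) * (W x * indicator (ball z r) x + 1 * indicator (ball z r) x)) \<in> borel_measurable lebesgue"
        by (intro borel_measurable_times_ennreal bm' measurable_const) simp
      have "(\<integral>\<^sup>+x\<in>?S. ennreal (T x) \<partial>lebesgue) \<le> (\<integral>\<^sup>+x. ennreal C1 * (ennreal (2 powr \<sigma>) *
          (W x * indicator (ball z r) x + 1 * indicator (ball z r) x) + w x * indicator ?S x) \<partial>lebesgue)"
        by (intro nn_integral_mono pt)
      also have "\<dots> = ennreal C1 * (ennreal (2 powr \<sigma>) * ((\<integral>\<^sup>+x\<in>ball z r. W x \<partial>lebesgue) + (\<integral>\<^sup>+x\<in>ball z r. 1 \<partial>lebesgue))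
          + (\<integral>\<^sup>+x\<in>?S. w x \<partial>lebesgue))"
        by (simp only: nn_integral_cmult[OF borel_measurable_add[OF bm'' wm]] nn_integral_add[OF bm'' wm]
            nn_integral_cmult[OF bm'] nn_integral_add[OF bm])
      also have "(\<integral>\<^sup>+x\<in>ball z r. 1 \<partial>lebesgue) = ennreal (\<omega> * r powr n)"
        using emeasure_ball_n[OF r(1), of z] by (simp add: nn_integral_cmult_indicator)
      also have "ennreal C1 * (ennreal (2 powr \<sigma>) * ((\<integral>\<^sup>+x\<in>ball z r. W x \<partial>lebesgue) + ennreal (\<omega> * r powr n)) + (\<integral>\<^sup>+x\<in>?S. w x \<partial>lebesgue))
          \<le> ennreal C1 * (ennreal (2 powr \<sigma>) * (ennreal (C2 * r powr lam z) + ennreal (\<omega> * (R powr n * r powr lam z))) + ennreal (C3 * r powr lam z))"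
        unfolding w_def using rn omega_pos
        by (intro mult_left_mono add_mono WI weight z r ennreal_leI) auto
      also have "\<dots> = ennreal (C1 * (2 powr \<sigma> * (C2 * r powr lam z + \<omega> * (R powr n * r powr lam z)) + C3 * r powr lam z))"
        using C1 C2 C3 omega_pos by (simp add: ennreal_mult[symmetric] ennreal_plus[symmetric] del: ennreal_plus)
      also have "C1 * (2 powr \<sigma> * (C2 * r powr lam z + \<omega> * (R powr n * r powr lam z)) + C3 * r powr lam z)
          = C1 * (2 powr \<sigma> * (C2 + \<omega> * R powr n) + C3) * r powr lam z"
        by (simp add: algebra_simps)
      also have "ennreal \<dots> \<le> ennreal (C * r powr lam z)"
        by (intro ennreal_leI mult_right_mono) (auto simp: C_def)
      finally show ?thesis .
    qed
    have "(\<integral>\<^sup>+x\<in>\<Omega> \<inter> ball z r. ennreal (T x) \<partial>lebesgue) \<le> ennreal (C * r powr lam z)"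
      if z: "z \<in> \<Omega>" and r: "0 < r" for z r
    proof (cases "r \<le> R")
      case False
      have "\<Omega> \<inter> ball z r = \<Omega> \<inter> ball z R"
        using diam[OF z] False by (auto simp: dist_norm) (meson diam z not_le order_less_le_trans order_less_trans)+
      then have "(\<integral>\<^sup>+x\<in>\<Omega> \<inter> ball z r. ennreal (T x) \<partial>lebesgue) \<le> ennreal (C * R powr lam z)"
        using small[OF z, of R] R by simp
      also have "\<dots> \<le> ennreal (C * r powr lam z)"
        using False R lam0[OF z] by (intro ennreal_leI mult_left_mono powr_mono2) (auto simp: C_def)
      finally show ?thesis .
    qed (use small[OF z r] in simp)
    \<comment> \<open>One ball of radius \<open>R\<close> about \<open>x0\<close> contains \<Omega>,
      and its majorant is integrable there, hence finite almost everywhere.\<close>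
    moreover have "AE x in lebesgue. x \<in> \<Omega> \<longrightarrow> J x < \<infinity>"
    proof -
      obtain W where W: "W \<in> borel_measurable lebesgue"
        and WI: "(\<integral>\<^sup>+x\<in>ball x0 R. W x \<partial>lebesgue) \<le> ennreal (C2 * R powr lam x0)"
        and WM: "\<And>x s. x \<in> \<Omega> \<Longrightarrow> x \<in> ball x0 R \<Longrightarrow> W x < \<infinity> \<Longrightarrow> 0 < s \<Longrightarrow> (\<integral>\<^sup>+y\<in>ball x s. ennreal (g y powr (p y / \<sigma>)) \<partial>lebesgue)
           \<le> ennreal (s powr n * enn2real (W x) powr (1 / \<sigma>))"
        using maximal[OF g x0, of R] R by auto
      have "(\<integral>\<^sup>+x\<in>ball x0 R. W x \<partial>lebesgue) \<noteq> \<infinity>" using WI by (auto simp: top_unique)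
      then have "AE x in lebesgue. W x * indicator (ball x0 R) x \<noteq> \<infinity>"
        by (intro nn_integral_PInf_AE borel_measurable_on_ball W)
      with AE_lebesgue_neq[of x0] show ?thesis
      proof eventually_elim
        case (elim x)
        show ?case
        proof
          assume x: "x \<in> \<Omega>"
          then have xb: "x \<in> ball x0 R" using diam[OF x0 x] by (simp add: dist_norm)
          then have "W x < \<infinity>" using elim(2) by (simp add: less_top)
          then show "J x < \<infinity>" using key[of x W] x elim(1) WM[OF x xb] by auto
        qed
      qed
    qed
    ultimately show "(AE x in lebesgue. x \<in> \<Omega> \<longrightarrow> (\<integral>\<^sup>+y. ennreal (\<bar>f y\<bar> * norm (x - y) powr (\<gamma> - n)) \<partial>lebesgue) < \<infinity>) \<and>
      (\<forall>z\<in>\<Omega>. \<forall>r>0. (\<integral>\<^sup>+x\<in>\<Omega> \<inter> ball z r. ennreal ((norm (x - x0) powr a *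
          enn2real (\<integral>\<^sup>+y. ennreal (\<bar>f y\<bar> * norm (x - y) powr (\<gamma> - n)) \<partial>lebesgue)) powr q x) \<partial>lebesgue)
        \<le> ennreal (C * r powr lam z))"
      unfolding J_def[symmetric] T_def by blast
  qed
qed

end

section \<open>Essential bounds and Morrey norms\<close>

text \<open>\<open>C / (- ln t)\<close> tends to 0 with \<open>t\<close>. Continuity is what makes
  essential bounds available at every point, in particular at \<open>x0\<close>.\<close>

lemma LH0_continuous_on:
  fixes u :: "'a::euclidean_space \<Rightarrow> real"
  assumes "u \<in> LH0 \<Omega>"
  shows "continuous_on \<Omega> u"
proof -
  obtain C where C: "\<And>x y. x \<in> \<Omega> \<Longrightarrow> y \<in> \<Omega> \<Longrightarrow> norm (x - y) < 1 / 2 \<Longrightarrow> \<bar>u x - u y\<bar> \<le> C / (- ln (norm (x - y)))"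
    using assms by (auto simp: LH0_def)
  show ?thesis
    unfolding continuous_on_iff
  proof (intro ballI allI impI)
    fix x and e :: real assume x: "x \<in> \<Omega>" and e: "0 < e"
    define d where "d = min (1 / 2) (exp (- (\<bar>C\<bar> / e)))"
    have "dist (u y) (u x) < e" if y: "y \<in> \<Omega>" "dist y x < d" for y
    proof (cases "y = x")
      case False
      let ?t = "norm (y - x)"
      have t: "0 < ?t" "?t < 1 / 2" "?t < exp (- (\<bar>C\<bar> / e))"
        using False y by (auto simp: d_def dist_norm)
      have "ln ?t < ln (exp (- (\<bar>C\<bar> / e)))" using t by (subst ln_less_cancel_iff) auto
      then have l: "\<bar>C\<bar> / e < - ln ?t" by simp
      moreover have "0 \<le> \<bar>C\<bar> / e" using e by simp
      ultimately have "0 < - ln ?t" by linarith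
      then have "C / (- ln ?t) \<le> \<bar>C\<bar> / (- ln ?t)" by (intro divide_right_mono) auto
      also have "\<dots> < e" using l e \<open>0 < - ln ?t\<close> by (simp add: field_simps)
      finally show ?thesis using C[OF y(1) x] t by (simp add: dist_real_def)
    qed (use e in simp)
    then show "\<exists>d>0. \<forall>y\<in>\<Omega>. dist y x < d \<longrightarrow> dist (u y) (u x) < e"
      by (intro exI[of _ d]) (auto simp: d_def)
  qed
qed

text \<open>The set where the bound fails is open by continuity, and a nonempty open set is not
  negligible.\<close>

lemma AE_le_imp_le_on_open:
  fixes u :: "'a::euclidean_space \<Rightarrow> real"
  assumes \<Omega>: "open \<Omega>" and u: "continuous_on \<Omega> u" and ae: "AE x in lebesgue_on \<Omega>. u x \<le> c" and x: "x \<in> \<Omega>"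
  shows "u x \<le> c"
proof (rule ccontr)
  assume "\<not> u x \<le> c"
  let ?S = "\<Omega> \<inter> u -` {c<..}"
  have "open ?S" using u \<Omega> by (intro continuous_open_preimage) auto
  moreover have "?S \<noteq> {}" using x \<open>\<not> u x \<le> c\<close> by auto
  ultimately have "\<not> negligible ?S" by (rule open_not_negligible)
  have "AE x in lebesgue. x \<in> \<Omega> \<longrightarrow> u x \<le> c"
    using ae \<Omega> by (subst (asm) AE_restrict_space_iff) auto
  then obtain N where "{x. \<not> (x \<in> \<Omega> \<longrightarrow> u x \<le> c)} \<subseteq> N" "N \<in> null_sets lebesgue"
    by (auto elim!: AE_E simp: null_sets_def)
  then have "negligible N" "?S \<subseteq> N" by (auto simp: negligible_iff_null_sets)
  with \<open>\<not> negligible ?S\<close> show False using negligible_subset by blast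
qed

lemma AE_lebesgue_on_open_ex:
  fixes \<Omega> :: "'a::euclidean_space set"
  assumes "open \<Omega>" and "\<Omega> \<noteq> {}" and "AE x in lebesgue_on \<Omega>. P x"
  shows "\<exists>x\<in>\<Omega>. P x"
proof (rule ccontr)
  assume "\<not> ?thesis"
  \<comment> \<open>If \<open>P\<close> failed at every point, a false inequality would hold almost
    everywhere, hence pointwise by the preceding lemma.\<close>
  then have "AE x in lebesgue_on \<Omega>. (0::real) \<le> - 1"
    using assms(3) AE_space[of "lebesgue_on \<Omega>"] by (auto elim: eventually_elim2)
  then have "(0::real) \<le> - 1"
    using assms(1,2) AE_le_imp_le_on_open[of \<Omega> "\<lambda>_. 0::real" "- 1"] by auto
  then show False by simp
qed

lemma ess_sup_on_le:
  fixes u :: "'a::euclidean_space \<Rightarrow> real"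
  assumes "open \<Omega>" and "continuous_on \<Omega> u" and "x \<in> \<Omega>"
  shows "ereal (u x) \<le> ess_sup_on \<Omega> u"
proof -
  have ae: "AE x in lebesgue_on \<Omega>. ereal (u x) \<le> ess_sup_on \<Omega> u"
    unfolding ess_sup_on_def by (rule esssup_AE)
  show ?thesis
  proof (cases "ess_sup_on \<Omega> u")
    case (real c)
    then show ?thesis using AE_le_imp_le_on_open[OF assms(1,2) _ assms(3), of c] ae by simp
  next
    case MInf
    then show ?thesis using AE_lebesgue_on_open_ex[OF assms(1) _ ae] assms(3) by auto
  qed simp
qed

lemma ess_inf_on_ge:
  fixes u :: "'a::euclidean_space \<Rightarrow> real"
  assumes "open \<Omega>" and "continuous_on \<Omega> u" and "x \<in> \<Omega>"
  shows "ess_inf_on \<Omega> u \<le> ereal (u x)"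
proof -
  have "ereal (- u x) \<le> ess_sup_on \<Omega> (\<lambda>x. ereal (- u x))"
    using assms by (intro ess_sup_on_le continuous_intros)
  then show ?thesis
    unfolding ess_inf_on_def ess_sup_on_def by (simp add: ereal_uminus_le_reorder)
qed

lemma conjugate_exponent_ereal: "1 < p \<Longrightarrow> conjugate_exponent (ereal p) = ereal (p / (p - 1))"
  by (simp add: conjugate_exponent_def one_ereal_def divide_ereal_def field_simps)

text \<open>The right-hand side is \<open>n\<close> divided by the conjugate exponent at
  \<open>x\<close>. The bound holds almost everywhere by definition of the essential supremum and
  extends to every point by continuity.\<close>

lemma less_divide_ess_sup_conjugate:
  fixes p :: "'a::euclidean_space \<Rightarrow> real"
  assumes \<Omega>: "open \<Omega>" and p: "continuous_on \<Omega> p" "\<And>x. x \<in> \<Omega> \<Longrightarrow> 1 < p x" and n: "0 < n"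
    and b: "ereal b < ereal n / ess_sup_on \<Omega> (\<lambda>x. conjugate_exponent (ereal (p x)))" and x: "x \<in> \<Omega>"
  shows "b \<le> n * (1 - 1 / p x)"
proof -
  let ?S = "ess_sup_on \<Omega> (\<lambda>x. conjugate_exponent (ereal (p x)))"
  have "AE x in lebesgue_on \<Omega>. - (n * (1 - 1 / p x)) \<le> - b"
    using esssup_AE[where M = "lebesgue_on \<Omega>" and f = "\<lambda>x. conjugate_exponent (ereal (p x))"] AE_space[of "lebesgue_on \<Omega>"]
  proof eventually_elim
    case (elim y)
    then have y: "y \<in> \<Omega>" by simp
    then have le: "ereal (p y / (p y - 1)) \<le> ?S"
      using elim p(2)[OF y] by (simp add: ess_sup_on_def conjugate_exponent_ereal)
    have py: "1 < p y" using p(2)[OF y] .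
    have "b \<le> n * (1 - 1 / p y)"
    proof (cases ?S)
      case (real s)
      have s: "p y / (p y - 1) \<le> s" using le real by simp
      moreover have s0: "0 < p y / (p y - 1)" using py by simp
      ultimately have "0 < s" by linarith
      then have "b < n / s" using b real by simp
      also have "\<dots> \<le> n / (p y / (p y - 1))"
        using s s0 \<open>0 < s\<close> n by (intro divide_left_mono mult_pos_pos) auto
      also have "\<dots> = n * (1 - 1 / p y)" using py by (simp add: field_simps)
      finally show ?thesis by simp
    next
      case PInf
      \<comment> \<open>In \<open>ereal\<close>, division by \<infinity> gives 0.\<close>
      then have "b < 0" using b by simp
      also have "0 \<le> n * (1 - 1 / p y)" using py n by simp
      finally show ?thesis by simp
    next
      case MInf
      then show ?thesis using le by simp
    qed
    then show ?case by simp
  qed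
  moreover have "continuous_on \<Omega> (\<lambda>x. - (n * (1 - 1 / p x)))"
    using p(2) by (intro continuous_intros p(1)) (auto dest: p(2))
  ultimately have "- (n * (1 - 1 / p x)) \<le> - b"
    using AE_le_imp_le_on_open[OF \<Omega>] x by blast
  then show ?thesis by simp
qed

section \<open>From modulars at most one to norms, and the Bochner form of the fractional
  integral\<close>

lemma morrey_norm_le:
  assumes "0 < \<eta>" and "morrey_modular \<Omega> p lam (\<lambda>x. f x / \<eta>) \<le> 1"
  shows "morrey_norm \<Omega> p lam f \<le> ennreal \<eta>"
  unfolding morrey_norm_def using assms by (intro Inf_lower) auto

text \<open>Dividing by \<open>C\<close> reduces the claim to a lower bound for an infimum. An
  infinite norm is included: the infimum is then over the empty set and the condition is
  vacuous.\<close>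

lemma le_morrey_normI:
  assumes C: "0 < C"
    and *: "\<And>\<eta>. 0 < \<eta> \<Longrightarrow> morrey_modular \<Omega> p lam (\<lambda>x. f x / \<eta>) \<le> 1 \<Longrightarrow> A \<le> ennreal (C * \<eta>)"
  shows "A \<le> ennreal C * morrey_norm \<Omega> p lam f"
proof -
  have "A / ennreal C \<le> morrey_norm \<Omega> p lam f"
    unfolding morrey_norm_def
  proof (rule Inf_greatest, clarify)
    fix \<eta> assume "0 < \<eta>" "morrey_modular \<Omega> p lam (\<lambda>x. f x / \<eta>) \<le> 1"
    then have "A / ennreal C \<le> ennreal (C * \<eta>) / ennreal C" by (intro divide_right_mono_ennreal *)
    also have "\<dots> = ennreal \<eta>" using C \<open>0 < \<eta>\<close> by (simp add: divide_ennreal)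
    finally show "A / ennreal C \<le> ennreal \<eta>" .
  qed
  then have "ennreal C * (A / ennreal C) \<le> ennreal C * morrey_norm \<Omega> p lam f" by (rule mult_left_mono) simp
  also have "ennreal C * (A / ennreal C) = A"
    using C by (simp add: ennreal_times_divide ennreal_mult_divide_eq mult.commute)
  finally show ?thesis .
qed

lemma nn_integral_lebesgue_on_ball:
  fixes \<Omega> :: "'a::euclidean_space set"
  assumes "\<Omega> \<in> sets lebesgue"
  shows "(\<integral>\<^sup>+y. f y \<partial>lebesgue_on {y \<in> \<Omega>. norm (x - y) < r}) = (\<integral>\<^sup>+y\<in>\<Omega> \<inter> ball x r. f y \<partial>lebesgue)"
proof -
  have eq: "{y \<in> \<Omega>. norm (x - y) < r} = \<Omega> \<inter> ball x r" by (auto simp: dist_norm)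
  have "\<Omega> \<inter> ball x r \<in> sets lebesgue" by (intro sets.Int assms) simp
  then show ?thesis unfolding eq by (subst nn_integral_restrict_space) auto
qed

lemma morrey_modular_le_1_iff:
  fixes \<Omega> :: "'a::euclidean_space set"
  assumes \<Omega>: "\<Omega> \<in> sets lebesgue"
  shows "morrey_modular \<Omega> p lam f \<le> 1 \<longleftrightarrow>
    (\<forall>x\<in>\<Omega>. \<forall>r>0. (\<integral>\<^sup>+y\<in>\<Omega> \<inter> ball x r. ennreal (\<bar>f y\<bar> powr p y) \<partial>lebesgue) \<le> ennreal (r powr lam x))"
proof -
  have "ennreal (r powr (- l)) * X \<le> 1 \<longleftrightarrow> X \<le> ennreal (r powr l)" if r: "0 < r" for r l and X
  proof
    assume "ennreal (r powr (- l)) * X \<le> 1"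
    then have "ennreal (r powr l) * (ennreal (r powr (- l)) * X) \<le> ennreal (r powr l) * 1" by (rule mult_left_mono) simp
    then show "X \<le> ennreal (r powr l)"
      using r by (simp add: mult.assoc[symmetric] ennreal_mult[symmetric] powr_add[symmetric])
  next
    assume "X \<le> ennreal (r powr l)"
    then have "ennreal (r powr (- l)) * X \<le> ennreal (r powr (- l)) * ennreal (r powr l)" by (rule mult_left_mono) simp
    then show "ennreal (r powr (- l)) * X \<le> 1"
      using r by (simp add: ennreal_mult[symmetric] powr_add[symmetric])
  qed
  then show ?thesis
    unfolding morrey_modular_def nn_integral_lebesgue_on_ball[OF \<Omega>] SUP_le_iff by auto
qed

text \<open>The default values agree: where the integrand is not integrable the Bochner integral is
  0, so \<open>enn2real\<close> sending \<infinity> to 0 does no damage and the bound holds at every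
  \<open>x\<close>.\<close>

lemma abs_fractional_integral_le:
  "\<bar>fractional_integral \<Omega> \<gamma> f x\<bar> \<le> enn2real (\<integral>\<^sup>+y. ennreal \<bar>riesz_integrand \<gamma> f x y\<bar> \<partial>lebesgue_on \<Omega>)"
proof (cases "integrable (lebesgue_on \<Omega>) (riesz_integrand \<gamma> f x)")
  case True
  then have fin: "(\<integral>\<^sup>+y. ennreal \<bar>riesz_integrand \<gamma> f x y\<bar> \<partial>lebesgue_on \<Omega>) < \<infinity>"
    by (simp add: integrable_iff_bounded)
  have "ennreal \<bar>fractional_integral \<Omega> \<gamma> f x\<bar> \<le> (\<integral>\<^sup>+y. ennreal \<bar>riesz_integrand \<gamma> f x y\<bar> \<partial>lebesgue_on \<Omega>)"
    unfolding fractional_integral_def using integral_norm_bound_ennreal[OF True] by simp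
  then show ?thesis using fin by (metis abs_ge_zero enn2real_ennreal enn2real_mono infinity_ennreal_def)
qed (simp add: fractional_integral_def not_integrable_integral_eq)

text \<open>The integrability clause gives the norm inequality its content: without it, the Bochner
  default 0 could make the left-hand side small for the wrong reason.\<close>

theorem theorem1p7:
  fixes \<Omega> :: "'a::euclidean_space set"
    and x0 :: 'a
    and p q lam :: "'a \<Rightarrow> real"
    and \<gamma> a b :: real
  assumes "0 < \<gamma>" and "\<gamma> < real DIM('a)"
    and "open \<Omega>" and "connected \<Omega>" and "bounded \<Omega>" and "x0 \<in> \<Omega>"
    and "(\<lambda>x. ereal (p x)) \<in> variable_exponents \<Omega>"
    and "(\<lambda>x. ereal (q x)) \<in> variable_exponents \<Omega>"
    and "p \<in> LH0 \<Omega>" and "q \<in> LH0 \<Omega>"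
    and "1 < ess_inf_on \<Omega> p" and "ess_inf_on \<Omega> p \<le> ess_sup_on \<Omega> p" and "ess_sup_on \<Omega> p < \<infinity>"
    and "1 < ess_inf_on \<Omega> q" and "ess_inf_on \<Omega> q \<le> ess_sup_on \<Omega> q" and "ess_sup_on \<Omega> q < \<infinity>"
    and "\<forall>x\<in>\<Omega>. p x \<le> q x"
    and "lam \<in> borel_measurable (lebesgue_on \<Omega>)"
    and "\<forall>x\<in>\<Omega>. 0 \<le> lam x \<and> lam x \<le> real DIM('a)"
    and "0 < ess_inf_on \<Omega> lam" and "ess_inf_on \<Omega> lam \<le> ess_sup_on \<Omega> lam"
    and "ess_sup_on \<Omega> lam < ereal (real DIM('a))"
    and "lam \<in> LH0 \<Omega>"
    and "0 \<le> b - a" and "b - a \<le> \<gamma>"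
    and "(ess_sup_on \<Omega> lam - ereal (real DIM('a))) / ess_sup_on \<Omega> q < ereal a"
    and "a \<le> b"
    and "ereal b < ereal (real DIM('a)) / ess_sup_on \<Omega> (\<lambda>x. conjugate_exponent (ereal (p x)))"
    and "\<forall>x\<in>\<Omega>. ess_inf_on \<Omega> lam \<le> ereal (lam x) \<and>
                lam x < real DIM('a) - (\<gamma> - b + a) * p x"
    and "\<forall>x\<in>\<Omega>. (\<gamma> + a - b) / (real DIM('a) - lam x) = 1 / p x - 1 / q x"
  shows "\<exists>C::real. 0 < C \<and>
    (\<forall>f \<in> borel_measurable (lebesgue_on \<Omega>).
       (morrey_norm \<Omega> p lam (\<lambda>x. norm (x - x0) powr b * f x) < \<infinity> \<longrightarrow>
          (AE x in lebesgue_on \<Omega>. integrable (lebesgue_on \<Omega>) (riesz_integrand \<gamma> f x))) \<and>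
       morrey_norm \<Omega> q lam (\<lambda>x. norm (x - x0) powr a * fractional_integral \<Omega> \<gamma> f x)
         \<le> ennreal C * morrey_norm \<Omega> p lam (\<lambda>x. norm (x - x0) powr b * f x))"
proof -
  let ?n = "real DIM('a)"
  have \<gamma>: "0 < \<gamma>" "\<gamma> < ?n" and \<Omega>: "open \<Omega>" "bounded \<Omega>" and x0: "x0 \<in> \<Omega>"
    and LH: "p \<in> LH0 \<Omega>" "q \<in> LH0 \<Omega>" "lam \<in> LH0 \<Omega>" and pq: "\<And>x. x \<in> \<Omega> \<Longrightarrow> p x \<le> q x"
    and lam_meas: "lam \<in> borel_measurable (lebesgue_on \<Omega>)"
    and lam_range: "\<And>x. x \<in> \<Omega> \<Longrightarrow> 0 \<le> lam x" "\<And>x. x \<in> \<Omega> \<Longrightarrow> lam x \<le> ?n"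
    and ab: "a \<le> b" "b - a \<le> \<gamma>"
    and sobolev: "\<And>x. x \<in> \<Omega> \<Longrightarrow> (\<gamma> + a - b) / (?n - lam x) = 1 / p x - 1 / q x"
    using assms by auto
  have \<Omega>m: "\<Omega> \<in> sets lebesgue" using \<Omega>(1) by simp
  have cont: "continuous_on \<Omega> p" "continuous_on \<Omega> q" "continuous_on \<Omega> lam"
    using LH by (simp_all add: LH0_continuous_on)
  have "(\<lambda>x. ereal (p x)) \<in> borel_measurable (lebesgue_on \<Omega>)"
    using assms(7) by (simp add: variable_exponents_def)
  then have p_meas: "p \<in> borel_measurable (lebesgue_on \<Omega>)" by simp
  \<comment> \<open>The strict gap between 1 and the essential infimum of \<open>p\<close> leaves
    room for a maximal theorem with exponent above 1.\<close>
  obtain \<sigma> where \<sigma>: "1 < ereal \<sigma>" "ereal \<sigma> < ess_inf_on \<Omega> p"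
    using ereal_dense2[OF assms(11)] by auto
  have p\<sigma>: "\<sigma> \<le> p x" if "x \<in> \<Omega>" for x
    using less_le_trans[OF \<sigma>(2) ess_inf_on_ge[OF \<Omega>(1) cont(1) that]] by simp
  obtain Q where Q: "ess_sup_on \<Omega> q = ereal Q"
    using assms(16) ess_sup_on_le[OF \<Omega>(1) cont(2) x0] by (cases "ess_sup_on \<Omega> q") auto
  have qQ: "q x \<le> Q" if "x \<in> \<Omega>" for x
    using ess_sup_on_le[OF \<Omega>(1) cont(2) that] Q by simp
  obtain L where L: "ess_sup_on \<Omega> lam = ereal L"
    using assms(22) ess_sup_on_le[OF \<Omega>(1) cont(3) x0] by (cases "ess_sup_on \<Omega> lam") auto
  have lamL: "lam x \<le> L" if "x \<in> \<Omega>" for x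
    using ess_sup_on_le[OF \<Omega>(1) cont(3) that] L by simp
  have Ln: "L < ?n" using assms(22) L by simp
  have p1: "1 < p x" if "x \<in> \<Omega>" for x using p\<sigma>[OF that] \<sigma>(1) by simp
  have q1: "1 < q x" if "x \<in> \<Omega>" for x using p1[OF that] pq[OF that] by simp
  have lam_x0: "0 < lam x0"
    using less_le_trans[OF assms(20) ess_inf_on_ge[OF \<Omega>(1) cont(3) x0]] by simp
  have a_gt: "(lam x0 - ?n) / q x0 < a"
  proof -
    have "0 < Q" using q1[OF x0] qQ[OF x0] by simp
    then have "(L - ?n) / Q < a" using assms(26) L Q by simp
    moreover have "(lam x0 - ?n) / q x0 \<le> (L - ?n) / q x0"
      using lamL[OF x0] q1[OF x0] by (intro divide_right_mono) auto
    moreover have "(L - ?n) / q x0 \<le> (L - ?n) / Q"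
      using Ln q1[OF x0] qQ[OF x0] by (intro divide_left_mono_neg mult_pos_pos) auto
    ultimately show ?thesis by linarith
  qed
  have b_le: "b \<le> ?n * (1 - 1 / p x0)"
    using assms(28) by (intro less_divide_ess_sup_conjugate[OF \<Omega>(1) cont(1) p1]) (auto simp: x0)
  obtain B where B: "\<And>x. x \<in> \<Omega> \<Longrightarrow> norm x \<le> B" using \<Omega>(2) by (auto simp: bounded_iff)
  \<comment> \<open>Twice a norm bound dominates the diameter; the added 1 makes the inequality
    strict and gives \<open>R \<ge> 1\<close>.\<close>
  define R where "R = 2 * \<bar>B\<bar> + 1"
  have R: "1 \<le> R" by (simp add: R_def)
  have diam: "norm (x - y) < R" if "x \<in> \<Omega>" "y \<in> \<Omega>" for x y
    using norm_triangle_ineq4[of x y] B[OF that(1)] B[OF that(2)] by (simp add: R_def)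
  have R2: "1 \<le> 2 * R" using R by simp
  obtain Kp where Kp: "1 \<le> Kp" "\<And>x y r. x \<in> \<Omega> \<Longrightarrow> y \<in> \<Omega> \<Longrightarrow> norm (x - y) \<le> r \<Longrightarrow> 0 < r \<Longrightarrow> r \<le> 2 * R \<Longrightarrow> r powr (p y - p x) \<le> Kp"
  proof (rule LH0_powr_bound[OF LH(1) _ R2])
    show "\<bar>p x\<bar> \<le> Q" if "x \<in> \<Omega>" for x using p1[OF that] pq[OF that] qQ[OF that] by simp
  qed (rule that)
  obtain Kq where Kq: "1 \<le> Kq" "\<And>x y r. x \<in> \<Omega> \<Longrightarrow> y \<in> \<Omega> \<Longrightarrow> norm (x - y) \<le> r \<Longrightarrow> 0 < r \<Longrightarrow> r \<le> 2 * R \<Longrightarrow> r powr (q y - q x) \<le> Kq"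
  proof (rule LH0_powr_bound[OF LH(2) _ R2])
    show "\<bar>q x\<bar> \<le> Q" if "x \<in> \<Omega>" for x using q1[OF that] qQ[OF that] by simp
  qed (rule that)
  obtain Kl where Kl: "1 \<le> Kl" "\<And>x y r. x \<in> \<Omega> \<Longrightarrow> y \<in> \<Omega> \<Longrightarrow> norm (x - y) \<le> r \<Longrightarrow> 0 < r \<Longrightarrow> r \<le> 2 * R \<Longrightarrow> r powr (lam y - lam x) \<le> Kl"
  proof (rule LH0_powr_bound[OF LH(3) _ R2])
    show "\<bar>lam x\<bar> \<le> ?n" if "x \<in> \<Omega>" for x using lam_range[OF that] by simp
  qed (rule that)
  define K where "K = max Kp (max Kq Kl)"
  have K: "1 \<le> K" "Kp \<le> K" "Kq \<le> K" "Kl \<le> K" using Kp(1) by (auto simp: K_def)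
  interpret weighted_riesz \<Omega> p lam ?n "unit_ball_vol ?n" R K \<sigma> L Q q x0 \<gamma> a b
  proof
    show "p x \<le> Q" if "x \<in> \<Omega>" for x using pq[OF that] qQ[OF that] by simp
    show "1 < \<sigma>" using \<sigma>(1) by simp
    show "r powr (p y - p x) \<le> K" if "x \<in> \<Omega>" "y \<in> \<Omega>" "norm (x - y) \<le> r" "0 < r" "r \<le> 2 * R" for x y r
      using Kp(2)[OF that] K by simp
    show "r powr (q y - q x) \<le> K" if "x \<in> \<Omega>" "y \<in> \<Omega>" "norm (x - y) \<le> r" "0 < r" "r \<le> 2 * R" for x y r
      using Kq(2)[OF that] K by simp
    show "r powr (lam y - lam x) \<le> K" if "x \<in> \<Omega>" "y \<in> \<Omega>" "norm (x - y) \<le> r" "0 < r" "r \<le> 2 * R" for x y r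
      using Kl(2)[OF that] K by simp
  qed (fact \<Omega>m R K(1) Ln \<gamma> x0 lam_x0 ab a_gt b_le refl | erule diam p\<sigma> lamL lam_range(1) pq qQ sobolev, assumption?)+
  obtain C where C: "1 \<le> C" and
    main: "\<And>f g. unit_morrey g \<Longrightarrow> (\<And>y. g y = norm (y - x0) powr b * \<bar>f y\<bar>) \<Longrightarrow>
      (AE x in lebesgue. x \<in> \<Omega> \<longrightarrow> (\<integral>\<^sup>+y. ennreal (\<bar>f y\<bar> * norm (x - y) powr (\<gamma> - ?n)) \<partial>lebesgue) < \<infinity>) \<and>
      (\<forall>z\<in>\<Omega>. \<forall>r>0. (\<integral>\<^sup>+x\<in>\<Omega> \<inter> ball z r. ennreal ((norm (x - x0) powr a *
          enn2real (\<integral>\<^sup>+y. ennreal (\<bar>f y\<bar> * norm (x - y) powr (\<gamma> - ?n)) \<partial>lebesgue)) powr q x) \<partial>lebesgue)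
        \<le> ennreal (C * r powr lam z))"
    by (rule riesz_morrey[OF lam_meas]) (rule that, assumption, blast)
  have key: "(AE x in lebesgue_on \<Omega>. integrable (lebesgue_on \<Omega>) (riesz_integrand \<gamma> f x)) \<and>
      morrey_norm \<Omega> q lam (\<lambda>x. norm (x - x0) powr a * fractional_integral \<Omega> \<gamma> f x) \<le> ennreal (C * \<eta>)"
    if f: "f \<in> borel_measurable (lebesgue_on \<Omega>)" and \<eta>: "0 < \<eta>"
      and mod: "morrey_modular \<Omega> p lam (\<lambda>x. norm (x - x0) powr b * f x / \<eta>) \<le> 1" for f and \<eta> :: real
  proof -
    \<comment> \<open>Normalised by \<eta> and extended by zero, so that the weighted function has
      unit modular.\<close>
    define f' where "f' y = indicator \<Omega> y * (f y / \<eta>)" for y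
    define g where "g y = norm (y - x0) powr b * \<bar>f' y\<bar>" for y
    define J where "J x = (\<integral>\<^sup>+y. ennreal (\<bar>f' y\<bar> * norm (x - y) powr (\<gamma> - ?n)) \<partial>lebesgue)" for x
    have nm: "(\<lambda>y. norm (y - c)) \<in> borel_measurable (lebesgue_on \<Omega>)" for c :: 'a
      by (intro measurable_restrict_space1 measurable_completion) simp
    have g_on: "(\<lambda>y. norm (y - x0) powr b * \<bar>f y / \<eta>\<bar>) \<in> borel_measurable (lebesgue_on \<Omega>)"
      using f nm[of x0] by measurable
    have gp_on: "(\<lambda>y. (norm (y - x0) powr b * \<bar>f y / \<eta>\<bar>) powr p y) \<in> borel_measurable (lebesgue_on \<Omega>)"
      using g_on p_meas by measurable
    have g_eq: "g = (\<lambda>y. indicator \<Omega> y * (norm (y - x0) powr b * \<bar>f y / \<eta>\<bar>))"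
      by (auto simp: g_def f'_def indicator_def fun_eq_iff)
    have gp_eq: "(\<lambda>y. g y powr p y) = (\<lambda>y. indicator \<Omega> y * (norm (y - x0) powr b * \<bar>f y / \<eta>\<bar>) powr p y)"
      by (auto simp: g_def f'_def indicator_def fun_eq_iff)
    have g: "unit_morrey g"
      unfolding unit_morrey_def
    proof (intro conjI ballI allI impI)
      show "g \<in> borel_measurable lebesgue"
        using g_on \<Omega>m unfolding g_eq by (simp add: borel_measurable_restrict_space_iff)
      show "(\<lambda>y. g y powr p y) \<in> borel_measurable lebesgue"
        using gp_on \<Omega>m unfolding gp_eq by (simp add: borel_measurable_restrict_space_iff)
      show "0 \<le> g y" for y by (simp add: g_def)
      show "g y = 0" if "y \<notin> \<Omega>" for y using that by (simp add: g_def f'_def)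
      fix x and r :: real assume x: "x \<in> \<Omega>" "0 < r"
      have "(\<integral>\<^sup>+y\<in>ball x r. ennreal (g y powr p y) \<partial>lebesgue)
          = (\<integral>\<^sup>+y\<in>\<Omega> \<inter> ball x r. ennreal (\<bar>norm (y - x0) powr b * f y / \<eta>\<bar> powr p y) \<partial>lebesgue)"
        by (intro nn_integral_cong) (auto simp: g_def f'_def indicator_def abs_mult)
      also have "\<dots> \<le> ennreal (r powr lam x)"
        using mod x unfolding morrey_modular_le_1_iff[OF \<Omega>m] by blast
      finally show "(\<integral>\<^sup>+y\<in>ball x r. ennreal (g y powr p y) \<partial>lebesgue) \<le> ennreal (r powr lam x)" .
    qed
    have fin: "AE x in lebesgue. x \<in> \<Omega> \<longrightarrow> J x < \<infinity>"
      and bound: "\<And>z r. z \<in> \<Omega> \<Longrightarrow> 0 < r \<Longrightarrow> (\<integral>\<^sup>+x\<in>\<Omega> \<inter> ball z r. ennreal ((norm (x - x0) powr a * enn2real (J x)) powr q x) \<partial>lebesgue)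
        \<le> ennreal (C * r powr lam z)"
      using main[OF g g_def] unfolding J_def by blast+
    have riesz: "(\<integral>\<^sup>+y. ennreal \<bar>riesz_integrand \<gamma> f x y\<bar> \<partial>lebesgue_on \<Omega>) = ennreal \<eta> * J x" for x
    proof -
      have m: "(\<lambda>y. ennreal (\<bar>f' y\<bar> * norm (x - y) powr (\<gamma> - ?n))) \<in> borel_measurable lebesgue"
      proof (rule measurable_compose[OF _ measurable_ennreal], intro borel_measurable_times borel_measurable_norm_powr)
        have "(\<lambda>y. f y / \<eta>) \<in> borel_measurable (lebesgue_on \<Omega>)" using f by simp
        then have "f' \<in> borel_measurable lebesgue"
          using \<Omega>m unfolding f'_def[abs_def] by (simp add: borel_measurable_restrict_space_iff)
        then show "(\<lambda>y. \<bar>f' y\<bar>) \<in> borel_measurable lebesgue" by simp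
      qed
      have "(\<integral>\<^sup>+y. ennreal \<bar>riesz_integrand \<gamma> f x y\<bar> \<partial>lebesgue_on \<Omega>)
          = (\<integral>\<^sup>+y\<in>\<Omega>. ennreal \<bar>riesz_integrand \<gamma> f x y\<bar> \<partial>lebesgue)"
        using \<Omega>m by (subst nn_integral_restrict_space) auto
      also have "\<dots> = (\<integral>\<^sup>+y. ennreal \<eta> * ennreal (\<bar>f' y\<bar> * norm (x - y) powr (\<gamma> - ?n)) \<partial>lebesgue)"
      proof (intro nn_integral_cong)
        fix y
        \<comment> \<open>This also holds at \<open>y = x\<close>, where both sides are 0 by the
          conventions for \<open>powr\<close> and division.\<close>
        have "norm (x - y) powr (\<gamma> - ?n) = 1 / norm (x - y) powr (?n - \<gamma>)"
          using powr_minus_divide[of "norm (x - y)" "?n - \<gamma>"] by simp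
        then show "ennreal \<bar>riesz_integrand \<gamma> f x y\<bar> * indicator \<Omega> y
            = ennreal \<eta> * ennreal (\<bar>f' y\<bar> * norm (x - y) powr (\<gamma> - ?n))"
          using \<eta> by (auto simp: riesz_integrand_def f'_def indicator_def ennreal_mult[symmetric] abs_mult)
      qed
      also have "\<dots> = ennreal \<eta> * J x" unfolding J_def by (rule nn_integral_cmult[OF m])
      finally show ?thesis .
    qed
    have "AE x in lebesgue_on \<Omega>. J x < \<infinity>"
      using fin \<Omega>m by (subst AE_restrict_space_iff) auto
    then have "AE x in lebesgue_on \<Omega>. integrable (lebesgue_on \<Omega>) (riesz_integrand \<gamma> f x)"
    proof eventually_elim
      case (elim x)
      have "(\<lambda>y. f y / norm (y - x) powr (?n - \<gamma>)) \<in> borel_measurable (lebesgue_on \<Omega>)"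
        using f nm[of x] by measurable
      then have "riesz_integrand \<gamma> f x \<in> borel_measurable (lebesgue_on \<Omega>)"
        by (simp add: riesz_integrand_def[abs_def] norm_minus_commute)
      then show ?case
        using elim by (simp add: integrable_iff_bounded riesz ennreal_mult_less_top)
    qed
    moreover have "morrey_norm \<Omega> q lam (\<lambda>x. norm (x - x0) powr a * fractional_integral \<Omega> \<gamma> f x) \<le> ennreal (C * \<eta>)"
    proof (rule morrey_norm_le)
      show "0 < C * \<eta>" using C \<eta> by simp
      show "morrey_modular \<Omega> q lam (\<lambda>x. norm (x - x0) powr a * fractional_integral \<Omega> \<gamma> f x / (C * \<eta>)) \<le> 1"
        unfolding morrey_modular_le_1_iff[OF \<Omega>m]
      proof (intro ballI allI impI)
        fix z and r :: real assume z: "z \<in> \<Omega>" "0 < r"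
        let ?t = "\<lambda>x. norm (x - x0) powr a * enn2real (J x)"
        have pt: "ennreal (\<bar>norm (x - x0) powr a * fractional_integral \<Omega> \<gamma> f x / (C * \<eta>)\<bar> powr q x) * indicator (\<Omega> \<inter> ball z r) x
            \<le> ennreal (1 / C) * (ennreal (?t x powr q x) * indicator (\<Omega> \<inter> ball z r) x)" for x
        proof (cases "x \<in> \<Omega> \<inter> ball z r")
          case True
          have "\<bar>fractional_integral \<Omega> \<gamma> f x\<bar> \<le> \<eta> * enn2real (J x)"
            using abs_fractional_integral_le[of \<Omega> \<gamma> f x] \<eta> by (simp add: riesz enn2real_mult)
          then have "\<bar>norm (x - x0) powr a * fractional_integral \<Omega> \<gamma> f x / (C * \<eta>)\<bar> \<le> ?t x * (1 / C)"
            using C \<eta> mult_left_mono[of "\<bar>fractional_integral \<Omega> \<gamma> f x\<bar>" "\<eta> * enn2real (J x)" "norm (x - x0) powr a"]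
            by (simp add: abs_mult field_simps)
          then have "\<bar>norm (x - x0) powr a * fractional_integral \<Omega> \<gamma> f x / (C * \<eta>)\<bar> powr q x \<le> (?t x * (1 / C)) powr q x"
            using q1[of x] True by (intro powr_mono2) auto
          also have "\<dots> = ?t x powr q x * (1 / C) powr q x" by (rule powr_mult)
          \<comment> \<open>A constant in the modular becomes the same constant in the norm: as
            \<open>C \<ge> 1\<close> and \<open>q x \<ge> 1\<close>, the factor
            \<open>(1 / C) powr q x\<close> is at most \<open>1 / C\<close>.\<close>
          also have "\<dots> \<le> ?t x powr q x * (1 / C) powr 1"
            using C q1[of x] True by (intro mult_left_mono powr_mono') auto
          also have "\<dots> = 1 / C * ?t x powr q x" using C by simp
          finally show ?thesis using True C by (simp add: ennreal_mult[symmetric] ennreal_leI)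
        qed simp
        have "(\<integral>\<^sup>+x\<in>\<Omega> \<inter> ball z r. ennreal (\<bar>norm (x - x0) powr a * fractional_integral \<Omega> \<gamma> f x / (C * \<eta>)\<bar> powr q x) \<partial>lebesgue)
            \<le> (\<integral>\<^sup>+x. ennreal (1 / C) * (ennreal (?t x powr q x) * indicator (\<Omega> \<inter> ball z r) x) \<partial>lebesgue)"
          by (intro nn_integral_mono pt)
        also have "\<dots> \<le> ennreal (1 / C) * (\<integral>\<^sup>+x\<in>\<Omega> \<inter> ball z r. ennreal (?t x powr q x) \<partial>lebesgue)"
          using C by (intro nn_integral_cmult_le) simp
        also have "\<dots> \<le> ennreal (1 / C) * ennreal (C * r powr lam z)"
          by (intro mult_left_mono bound z) simp
        also have "\<dots> = ennreal (r powr lam z)" using C by (simp add: ennreal_mult[symmetric])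
        finally show "(\<integral>\<^sup>+x\<in>\<Omega> \<inter> ball z r. ennreal (\<bar>norm (x - x0) powr a * fractional_integral \<Omega> \<gamma> f x / (C * \<eta>)\<bar> powr q x) \<partial>lebesgue)
            \<le> ennreal (r powr lam z)" .
      qed
    qed
    ultimately show ?thesis ..
  qed
  show ?thesis
  proof (intro exI[of _ C] conjI ballI impI)
    show C0: "0 < C" using C by simp
    fix f :: "'a \<Rightarrow> real" assume f: "f \<in> borel_measurable (lebesgue_on \<Omega>)"
    show "morrey_norm \<Omega> q lam (\<lambda>x. norm (x - x0) powr a * fractional_integral \<Omega> \<gamma> f x)
        \<le> ennreal C * morrey_norm \<Omega> p lam (\<lambda>x. norm (x - x0) powr b * f x)"
      using key[OF f] by (intro le_morrey_normI C0) blast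
    assume "morrey_norm \<Omega> p lam (\<lambda>x. norm (x - x0) powr b * f x) < \<infinity>"
    \<comment> \<open>Finiteness of the infimum provides an admissible \<eta>, since the infimum of
      the empty set is \<infinity>.\<close>
    then obtain \<eta> where "0 < \<eta>" "morrey_modular \<Omega> p lam (\<lambda>x. norm (x - x0) powr b * f x / \<eta>) \<le> 1"
      unfolding morrey_norm_def Inf_less_iff by auto
    then show "AE x in lebesgue_on \<Omega>. integrable (lebesgue_on \<Omega>) (riesz_integrand \<gamma> f x)"
      using key[OF f] by blast
  qed
qed

end
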